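(* Let $f$ be a bounded measurable probability density function on $\mathbb{R}^d$, let $r = r_n$ be a sequence of positive reals with $r = \Theta(n^{-1/d})$, and let $k \ge 1$ be a fixed integer. Then, for either the random Vietoris-Rips complex $R(X_n;r)$ or the random Čech complex $C(X_n;r)$, the $k$th Betti number $\beta_k$ satisfies $E[\beta_k] = \Theta(n)$.
   Context: Let $x_1, x_2, \ldots$ be i.i.d. random points in $\mathbb{R}^d$ with common density $f$, and let $X_n = \{x_1, \ldots, x_n\}$. $B(p,s)$ is the closed Euclidean ball of radius $s$ centered at $p$. For $r>0$, the random Vietoris-Rips complex $R(X_n;r)$ is the simplicial complex with vertex set $X_n$ in which $\sigma \subseteq X_n$ is a face iff $B(x_i,r/2)\cap B(x_j,r/2)\neq\emptyset$ for every pair $x_i,x_j\in\sigma$ (equivalently, all pairwise Euclidean distances between points of $\sigma$ are at most $r$). The random Čech complex $C(X_n;r)$ is the simplicial complex with vertex set $X_n$ in which $\sigma \subseteq X_n$ is a face iff $\bigcap_{x_i \in \sigma} B(x_i, r/2) \neq \emptyset$. Homology is simplicial homology with coefficients in an arbitrary fixed field, and $\beta_k = \dim H_k$. For non-negative sequences, $g=\Theta(h)$ means that there are constants $a,b>0$ with $a\,h(n) \le g(n) \le b\,h(n)$ for all large $n$.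
   Formalization: The formal theorem assumes d ≥ 2 and claims the Čech case only for k < d; for d = 1 (both complexes, k ≥ 1) and for the Čech complex with k ≥ d, the Betti number β_k is always 0, so E[β_k] = Θ(n) fails there. *)

theory Defs
  imports
    "HOL-Probability.Probability"
    "HOL-Algebra.AbelCoset"
    "Jordan_Normal_Form.VS_Connect"
begin

text \<open>
  A simplicial complex is given by its set of nonempty finite faces. In both complexes below,
  \<open>r\<close> is twice the radius of the balls.
\<close>

definition vietoris_rips :: "'a::euclidean_space set \<Rightarrow> real \<Rightarrow> 'a set set" where
  "vietoris_rips S r = {\<sigma>. \<sigma> \<subseteq> S \<and> finite \<sigma> \<and> \<sigma> \<noteq> {} \<and>
     (\<forall>p\<in>\<sigma>. \<forall>q\<in>\<sigma>. cball p (r / 2) \<inter> cball q (r / 2) \<noteq> {})}"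

definition cech :: "'a::euclidean_space set \<Rightarrow> real \<Rightarrow> 'a set set" where
  "cech S r = {\<sigma>. \<sigma> \<subseteq> S \<and> finite \<sigma> \<and> \<sigma> \<noteq> {} \<and> (\<Inter>p\<in>\<sigma>. cball p (r / 2)) \<noteq> {}}"

text \<open>
  Oriented simplicial chains, without a choice of vertex order: a \<open>k\<close>-chain is a finitely
  supported function on the lists \<open>[v\<^sub>0, \<dots>, v\<^sub>k]\<close> of distinct vertices of a \<open>k\<close>-face
  which changes sign when two vertices are exchanged. The elementary chain of the oriented simplex
  \<open>[v\<^sub>0, \<dots>, v\<^sub>k]\<close> takes the value \<open>1\<close> on this list, \<open>sign \<pi>\<close> on its
  rearrangement by \<open>\<pi>\<close>, and \<open>0\<close> on all other lists.
\<close>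

definition oriented_chains :: "'a set set \<Rightarrow> nat \<Rightarrow> ('a list \<Rightarrow> 'f::field) set" where
  "oriented_chains K k = {c. finite {vs. c vs \<noteq> 0} \<and>
     (\<forall>vs. c vs \<noteq> 0 \<longrightarrow> distinct vs \<and> length vs = Suc k \<and> set vs \<in> K) \<and>
     (\<forall>vs i j. i < j \<and> j < length vs \<longrightarrow> c (vs[i := vs ! j, j := vs ! i]) = - c vs)}"

text \<open>
  This is the linear map sending the elementary chain of \<open>[v\<^sub>0, \<dots>, v\<^sub>k]\<close> to the
  alternating sum \<open>\<Sum>i\<le>k. (-1)^i\<close> times the elementary chain of the list with
  \<open>v\<^sub>i\<close> deleted: as \<open>[v, w\<^sub>1, \<dots>, w\<^sub>k]\<close> has \<open>[w\<^sub>1, \<dots>, w\<^sub>k]\<close> in its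
  boundary with sign \<open>+1\<close>, the coefficient of \<open>ws\<close> in the boundary of \<open>c\<close> is the sum
  of the \<open>c (v # ws)\<close>.
\<close>

definition boundary :: "('a list \<Rightarrow> 'f::field) \<Rightarrow> 'a list \<Rightarrow> 'f" where
  "boundary c = (\<lambda>ws. \<Sum>v | c (v # ws) \<noteq> 0. c (v # ws))"

text \<open>Homology is not reduced, so every \<open>0\<close>-chain is a cycle.\<close>

definition cycles :: "'a set set \<Rightarrow> nat \<Rightarrow> ('a list \<Rightarrow> 'f::field) set" where
  "cycles K k = {c \<in> oriented_chains K k. k = 0 \<or> boundary c = (\<lambda>_. 0)}"

definition boundaries :: "'a set set \<Rightarrow> nat \<Rightarrow> ('a list \<Rightarrow> 'f::field) set" where
  "boundaries K k = boundary ` oriented_chains K (Suc k)"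

text \<open>The ring multiplication and unit that the record of a module carries play no role.\<close>

definition cycle_module :: "'a set set \<Rightarrow> nat \<Rightarrow> ('f::field, 'a list \<Rightarrow> 'f) module" where
  "cycle_module K k = \<lparr>carrier = cycles K k, mult = undefined, one = undefined,
     zero = (\<lambda>_. 0), add = (\<lambda>c c' vs. c vs + c' vs), smult = (\<lambda>a c vs. a * c vs)\<rparr>"

definition quotient_module :: "('r, 'm) module \<Rightarrow> 'm set \<Rightarrow> ('r, 'm set) module" where
  "quotient_module M N = \<lparr>carrier = a_rcosets\<^bsub>M\<^esub> N, mult = undefined, one = undefined,
     zero = N, add = set_add M, smult = (\<lambda>a U. \<Union>u\<in>U. N +>\<^bsub>M\<^esub> (a \<odot>\<^bsub>M\<^esub> u))\<rparr>"

definition homology :: "'a set set \<Rightarrow> nat \<Rightarrow> ('f::field, ('a list \<Rightarrow> 'f) set) module" where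
  "homology K k = quotient_module (cycle_module K k) (boundaries K k)"

definition betti :: "'f::field itself \<Rightarrow> 'a set set \<Rightarrow> nat \<Rightarrow> nat" where
  "betti F K k =
     vectorspace.dim (class_ring :: 'f ring) (homology K k :: ('f, ('a list \<Rightarrow> 'f) set) module)"

end

theory Submission
  imports Defs
begin

text \<open>
The upper bound counts faces. The \<open>k\<close>-th Betti number is at most the number of lists of \<open>k + 1\<close> distinct vertices
that span a face. Such vertices are within distance \<open>r\<close> of the first one, and a bounded density
puts each of the \<open>k\<close> others there with probability \<open>O(r^d) = O(1/n)\<close>
(\<open>prob_close_le\<close>). There are at most \<open>n^(k+1)\<close> lists, so the expectation is
\<open>O(n)\<close>.

The lower bound counts small isolated spheres. For each of the two complexes there are \<open>m\<close>
places in space such that any points near these places span a triangulated \<open>k\<close>-sphere without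
\<open>(k+1)\<close>-faces: the boundary of a cross-polytope for Vietoris-Rips complexes, the boundary of a
\<open>(k+1)\<close>-simplex, for which there is room when \<open>k < d\<close>, for Cech complexes (\<open>rips_spherical_configuration\<close>,
\<open>cech_spherical_configuration\<close>). Space is cut into cubes whose side is a large multiple of
\<open>r\<close>. If a cube contains exactly \<open>m\<close> of the random points and these lie near the places
scaled by \<open>r\<close> about the centre of the cube, they span a sphere that meets no other face. The
spheres of different cubes are independent in homology, so the Betti number is at least the number of
such cubes (\<open>card_isolated_spheres_le_betti\<close>).

It remains to find order of \<open>n\<close> cubes in which this event has probability bounded below. The
density is at least some \<open>\<delta> > 0\<close> on a compact set \<open>K\<close> of positive volume. Since
\<open>K\<close> has open neighbourhoods of almost the same volume, at least half of the small cubes that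
meet \<open>K\<close> are almost filled by it (\<open>many_cells_mostly_inside_compact\<close>); for a density
that is merely measurable this stands in for the Lebesgue density theorem. In such a cube the mass near
each of the \<open>m\<close> places is at least of order \<open>1/n\<close>, which the number of order
\<open>n^m\<close> choices of indices outweighs, and the mass of the whole cube is \<open>O(1/n)\<close>, so
that the other points avoid it with probability bounded below
(\<open>expectation_random_betti_ge\<close>).

Two points of linear algebra carry the topology. Evaluation of chains at a face that lies in no
\<open>(k+1)\<close>-face vanishes on boundaries, so cycles are independent in homology once such evaluations
separate them (\<open>card_le_betti\<close>). The fundamental cycles of both spheres are determinants: if
vectors \<open>a v\<close> in a space of dimension \<open>k + 1\<close> are attached to the vertices and add up to
zero, then \<open>det (a v\<^sub>0, \<dots>, a v\<^sub>k)\<close> is a \<open>k\<close>-cycle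
(\<open>det_chain_cycle\<close>).

Expectations are Bochner integrals, hence the Betti number must be shown to be measurable. It depends only
on which points coincide and which index sets span a face (\<open>betti_measurable\<close>), because Betti
numbers are invariant under isomorphism of complexes (\<open>betti_isomorphic\<close>).
\<close>

section \<open>Quotients of function spaces\<close>

text \<open>
Gaussian elimination: if some \<open>c0\<close> in the space does not vanish at \<open>t\<close>, subtracting multiples
of it leads to the subspace of functions that vanish at \<open>t\<close>, which is determined by the
remaining points.
\<close>

lemma spanning_family:
  fixes Y :: "('l \<Rightarrow> 'f::field) set"
  assumes "finite T" "(\<lambda>_. 0) \<in> Y"
    "\<And>c c' a. c \<in> Y \<Longrightarrow> c' \<in> Y \<Longrightarrow> (\<lambda>l. c l + a * c' l) \<in> Y"
    "\<And>c. c \<in> Y \<Longrightarrow> (\<And>l. l \<in> T \<Longrightarrow> c l = 0) \<Longrightarrow> c = (\<lambda>_. 0)"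
  shows "\<exists>C \<subseteq> Y. finite C \<and> card C \<le> card T \<and> (\<forall>c\<in>Y. \<exists>u. c = (\<lambda>l. \<Sum>b\<in>C. u b * b l))"
  using assms
proof (induction T arbitrary: Y rule: finite_induct)
  case empty
  then show ?case by (intro exI[of _ "{}"]) auto
next
  case (insert t T)
  define Y' where "Y' = {c \<in> Y. c t = 0}"
  have "\<exists>C \<subseteq> Y'. finite C \<and> card C \<le> card T \<and> (\<forall>c\<in>Y'. \<exists>u. c = (\<lambda>l. \<Sum>b\<in>C. u b * b l))"
  proof (rule insert.IH)
    show "c = (\<lambda>_. 0)" if "c \<in> Y'" "\<And>l. l \<in> T \<Longrightarrow> c l = 0" for c
      using that by (intro insert.prems(3)) (auto simp: Y'_def)
  qed (use insert.prems(1-2) in \<open>auto simp: Y'_def\<close>)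
  then obtain C where C: "C \<subseteq> Y'" "finite C" "card C \<le> card T"
    "\<And>c. c \<in> Y' \<Longrightarrow> \<exists>u. c = (\<lambda>l. \<Sum>b\<in>C. u b * b l)" by blast
  show ?case
  proof (cases "\<exists>c0\<in>Y. c0 t \<noteq> 0")
    case False
    then have "Y' = Y" by (auto simp: Y'_def)
    then show ?thesis using C insert.hyps by (intro exI[of _ C]) auto
  next
    case True
    then obtain c0 where c0: "c0 \<in> Y" "c0 t \<noteq> 0" by blast
    have "c0 \<notin> C" using C(1) c0(2) by (auto simp: Y'_def)
    have "\<exists>u. c = (\<lambda>l. \<Sum>b\<in>insert c0 C. u b * b l)" if "c \<in> Y" for c
    proof -
      have "(\<lambda>l. c l + (- (c t / c0 t)) * c0 l) \<in> Y'"
        using insert.prems(2)[OF that c0(1), of "- (c t / c0 t)"] c0(2) by (simp add: Y'_def)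
      then obtain u where u: "(\<lambda>l. c l + (- (c t / c0 t)) * c0 l) = (\<lambda>l. \<Sum>b\<in>C. u b * b l)"
        using C(4) by blast
      have "c l = (\<Sum>b\<in>insert c0 C. (u(c0 := c t / c0 t)) b * b l)" for l
      proof -
        have "(\<Sum>b\<in>C. (u(c0 := c t / c0 t)) b * b l) = (\<Sum>b\<in>C. u b * b l)"
          by (rule sum.cong) (use \<open>c0 \<notin> C\<close> in auto)
        then show ?thesis using fun_cong[OF u, of l] \<open>c0 \<notin> C\<close> C(2) by (simp add: algebra_simps)
      qed
      then show ?thesis by blast
    qed
    moreover have "card (insert c0 C) \<le> card (insert t T)"
      using C(2,3) \<open>c0 \<notin> C\<close> insert.hyps by simp
    ultimately show ?thesis using C(1,2) c0(1)
      by (intro exI[of _ "insert c0 C"]) (auto simp: Y'_def)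
  qed
qed

text \<open>
\<open>Z\<close> and \<open>B\<close> stand for the cycles and the boundaries. \<open>Z\<close> may have
infinite dimension; finiteness enters only with the set \<open>T\<close> in \<open>dim_Q_le\<close>.
\<close>

locale function_quotient =
  fixes Z B :: "('l \<Rightarrow> 'f::field) set"
  assumes zero_B: "(\<lambda>_. 0) \<in> B"
    and add_B: "c \<in> B \<Longrightarrow> c' \<in> B \<Longrightarrow> (\<lambda>l. c l + c' l) \<in> B"
    and scale_B: "c \<in> B \<Longrightarrow> (\<lambda>l. a * c l) \<in> B"
    and add_Z: "c \<in> Z \<Longrightarrow> c' \<in> Z \<Longrightarrow> (\<lambda>l. c l + c' l) \<in> Z"
    and scale_Z: "c \<in> Z \<Longrightarrow> (\<lambda>l. a * c l) \<in> Z"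
    and B_subset_Z: "B \<subseteq> Z"
begin

definition Q :: "('f, ('l \<Rightarrow> 'f) set) module" where
  "Q = quotient_module \<lparr>carrier = Z, mult = undefined, one = undefined,
     zero = (\<lambda>_. 0), add = (\<lambda>c c' l. c l + c' l), smult = (\<lambda>a c l. a * c l)\<rparr> B"

text \<open>
The element of the quotient represented by \<open>c\<close>, in a form that does not refer to \<open>Z\<close>.
\<close>

definition coset :: "('l \<Rightarrow> 'f) \<Rightarrow> ('l \<Rightarrow> 'f) set" where
  "coset c = {c'. (\<lambda>l. c' l - c l) \<in> B}"

lemma diff_B: "c \<in> B \<Longrightarrow> c' \<in> B \<Longrightarrow> (\<lambda>l. c l - c' l) \<in> B"
  using add_B[of c "\<lambda>l. (-1) * c' l"] scale_B[of c' "-1"] by simp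

lemma coset_eq_iff: "coset c = coset c' \<longleftrightarrow> (\<lambda>l. c l - c' l) \<in> B"
proof
  assume "coset c = coset c'"
  moreover have "c \<in> coset c" using zero_B by (simp add: coset_def)
  ultimately show "(\<lambda>l. c l - c' l) \<in> B" by (auto simp: coset_def)
next
  assume h: "(\<lambda>l. c l - c' l) \<in> B"
  have "(\<lambda>l. d l - c l) \<in> B \<longleftrightarrow> (\<lambda>l. d l - c' l) \<in> B" for d
    using add_B[OF _ h, of "\<lambda>l. d l - c l"] diff_B[OF _ h, of "\<lambda>l. d l - c' l"] by auto
  then show "coset c = coset c'" by (auto simp: coset_def)
qed

lemma sum_Z: "finite A \<Longrightarrow> (\<And>i. i \<in> A \<Longrightarrow> g i \<in> Z) \<Longrightarrow> (\<lambda>l. \<Sum>i\<in>A. g i l) \<in> Z"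
proof (induction A rule: finite_induct)
  case empty
  then show ?case using zero_B B_subset_Z by auto
next
  case (insert i A)
  then show ?case using add_Z[of "g i" "\<lambda>l. \<Sum>i\<in>A. g i l"] by simp
qed

lemma coset_r_coset: "B +>\<^bsub>\<lparr>carrier = Z, mult = undefined, one = undefined,
     zero = (\<lambda>_. 0), add = (\<lambda>c c' l. c l + c' l), smult = (\<lambda>a c l. a * c l)\<rparr>\<^esub> c = coset c"
proof -
  have "d \<in> (\<lambda>b l. b l + c l) ` B" if "(\<lambda>l. d l - c l) \<in> B" for d
    using that by (intro image_eqI[of _ _ "\<lambda>l. d l - c l"]) auto
  then show ?thesis
    by (auto simp: a_r_coset_def r_coset_def coset_def)
qed

lemma carrier_Q: "carrier Q = coset ` Z"
  unfolding Q_def quotient_module_def A_RCOSETS_def RCOSETS_def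
  using coset_r_coset by (auto simp: a_r_coset_def)

lemma zero_Q: "\<zero>\<^bsub>Q\<^esub> = coset (\<lambda>_. 0)"
  by (simp add: Q_def quotient_module_def coset_def)

lemma add_Q: "coset c \<oplus>\<^bsub>Q\<^esub> coset c' = coset (\<lambda>l. c l + c' l)"
proof -
  have "(\<exists>d. (\<lambda>l. d l - c l) \<in> B \<and> (\<exists>d'. (\<lambda>l. d' l - c' l) \<in> B \<and> e = (\<lambda>l. d l + d' l)))
      \<longleftrightarrow> (\<lambda>l. e l - (c l + c' l)) \<in> B" for e
  proof
    assume "\<exists>d. (\<lambda>l. d l - c l) \<in> B \<and> (\<exists>d'. (\<lambda>l. d' l - c' l) \<in> B \<and> e = (\<lambda>l. d l + d' l))"
    then obtain d d' where "(\<lambda>l. d l - c l) \<in> B" "(\<lambda>l. d' l - c' l) \<in> B" "e = (\<lambda>l. d l + d' l)"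
      by blast
    then show "(\<lambda>l. e l - (c l + c' l)) \<in> B"
      using add_B[of "\<lambda>l. d l - c l" "\<lambda>l. d' l - c' l"] by (simp add: algebra_simps)
  next
    assume "(\<lambda>l. e l - (c l + c' l)) \<in> B"
    then show "\<exists>d. (\<lambda>l. d l - c l) \<in> B \<and> (\<exists>d'. (\<lambda>l. d' l - c' l) \<in> B \<and> e = (\<lambda>l. d l + d' l))"
      using zero_B
      by (intro exI[of _ c] conjI exI[of _ "\<lambda>l. e l - c l"]) (auto simp: algebra_simps)
  qed
  then have "(\<Union>d\<in>coset c. \<Union>d'\<in>coset c'. {\<lambda>l. d l + d' l}) = coset (\<lambda>l. c l + c' l)"
    unfolding set_eq_iff by (simp add: coset_def)
  moreover have "coset c \<oplus>\<^bsub>Q\<^esub> coset c' = (\<Union>d\<in>coset c. \<Union>d'\<in>coset c'. {\<lambda>l. d l + d' l})"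
    by (simp add: Q_def quotient_module_def set_add_def set_mult_def)
  ultimately show ?thesis by simp
qed

lemma scale_Q: "a \<odot>\<^bsub>Q\<^esub> coset c = coset (\<lambda>l. a * c l)"
proof -
  have "a \<odot>\<^bsub>Q\<^esub> coset c = (\<Union>u\<in>coset c. coset (\<lambda>l. a * u l))"
    by (simp add: Q_def quotient_module_def coset_r_coset)
  also have "\<dots> = (\<Union>u\<in>coset c. coset (\<lambda>l. a * c l))"
  proof (intro SUP_cong refl)
    fix u assume "u \<in> coset c"
    then have "(\<lambda>l. u l - c l) \<in> B" by (simp add: coset_def)
    then show "coset (\<lambda>l. a * u l) = coset (\<lambda>l. a * c l)"
      using scale_B[of "\<lambda>l. u l - c l" a] by (simp add: coset_eq_iff algebra_simps)
  qed
  also have "\<dots> = coset (\<lambda>l. a * c l)"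
  proof -
    have "c \<in> coset c" using zero_B by (simp add: coset_def)
    then show ?thesis by (intro SUP_const) auto
  qed
  finally show ?thesis .
qed

lemma vectorspace_Q: "vectorspace class_ring Q"
proof (rule vs_criteria)
  show "field (class_ring :: 'f ring)" by (rule class_field)
  show "\<zero>\<^bsub>Q\<^esub> \<in> carrier Q" using zero_B B_subset_Z by (auto simp: zero_Q carrier_Q)
  show "\<forall>v\<in>carrier Q. \<exists>neg_v\<in>carrier Q. v \<oplus>\<^bsub>Q\<^esub> neg_v = \<zero>\<^bsub>Q\<^esub>"
  proof
    fix v assume "v \<in> carrier Q"
    then obtain c where c: "c \<in> Z" "v = coset c" by (auto simp: carrier_Q)
    show "\<exists>neg_v\<in>carrier Q. v \<oplus>\<^bsub>Q\<^esub> neg_v = \<zero>\<^bsub>Q\<^esub>"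
      using scale_Z[OF c(1), of "-1"] c
      by (intro bexI[of _ "coset (\<lambda>l. (-1) * c l)"])
        (simp_all only: add_Q zero_Q carrier_Q coset_eq_iff, auto simp: zero_B)
  qed
qed (auto simp: carrier_Q add_Q scale_Q zero_Q algebra_simps intro!: imageI add_Z scale_Z)

sublocale Q: vectorspace "class_ring :: 'f ring" Q
  by (rule vectorspace_Q)

lemma finsum_Q:
  assumes "finite A" "\<And>i. i \<in> A \<Longrightarrow> g i \<in> Z"
  shows "finsum Q (\<lambda>i. coset (g i)) A = coset (\<lambda>l. \<Sum>i\<in>A. g i l)"
  using assms
proof (induction A rule: finite_induct)
  case (insert i A)
  have "finsum Q (\<lambda>i. coset (g i)) (insert i A) = coset (g i) \<oplus>\<^bsub>Q\<^esub> finsum Q (\<lambda>i. coset (g i)) A"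
    by (rule Q.M.finsum_insert) (use insert in \<open>auto simp: carrier_Q\<close>)
  then show ?case using insert by (simp add: add_Q)
qed (simp add: zero_Q)

definition independent_mod :: "nat \<Rightarrow> (nat \<Rightarrow> 'l \<Rightarrow> 'f) \<Rightarrow> bool" where
  "independent_mod N z \<longleftrightarrow> z ` {..<N} \<subseteq> Z \<and>
     (\<forall>a. (\<lambda>l. \<Sum>i<N. a i * z i l) \<in> B \<longrightarrow> (\<forall>i<N. a i = 0))"

lemma lincomb_coset:
  assumes "finite A" "inj_on (\<lambda>i. coset (g i)) A" "\<And>i. i \<in> A \<Longrightarrow> g i \<in> Z"
  shows "Q.lincomb a ((\<lambda>i. coset (g i)) ` A) = coset (\<lambda>l. \<Sum>i\<in>A. a (coset (g i)) * g i l)"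
proof -
  have "Q.lincomb a ((\<lambda>i. coset (g i)) ` A)
      = finsum Q (\<lambda>i. a (coset (g i)) \<odot>\<^bsub>Q\<^esub> coset (g i)) A"
    unfolding Q.lincomb_def
    by (rule Q.M.add.finprod_reindex[OF _ assms(2)])
      (use assms(3) in \<open>auto simp: scale_Q carrier_Q intro!: imageI scale_Z\<close>)
  also have "\<dots> = finsum Q (\<lambda>i. coset (\<lambda>l. a (coset (g i)) * g i l)) A"
    by (simp add: scale_Q)
  also have "\<dots> = coset (\<lambda>l. \<Sum>i\<in>A. a (coset (g i)) * g i l)"
    by (rule finsum_Q) (use assms in \<open>auto intro: scale_Z\<close>)
  finally show ?thesis .
qed

lemma coset_zero_iff: "coset c = \<zero>\<^bsub>Q\<^esub> \<longleftrightarrow> c \<in> B"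
  by (simp add: zero_Q coset_eq_iff)

text \<open>
Reduces the dimension of the quotient to families of representatives, which can be transported
between different complexes without speaking of cosets.
\<close>

lemma le_dim_Q_iff:
  assumes fin: "Q.fin_dim"
  shows "N \<le> Q.dim \<longleftrightarrow> (\<exists>z. independent_mod N z)"
proof
  assume "\<exists>z. independent_mod N z"
  then obtain z where z: "\<And>i. i < N \<Longrightarrow> z i \<in> Z"
    and ind: "\<And>a i. (\<lambda>l. \<Sum>i<N. a i * z i l) \<in> B \<Longrightarrow> i < N \<Longrightarrow> a i = 0"
    by (auto simp: independent_mod_def image_subset_iff)
  have inj: "inj_on (\<lambda>i. coset (z i)) {..<N}"
  proof (rule inj_onI, rule ccontr)
    fix i j assume ij: "i \<in> {..<N}" "j \<in> {..<N}" "coset (z i) = coset (z j)" "i \<noteq> j"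
    define a where "a = (\<lambda>k. if k = i then 1 else if k = j then - 1 else 0 :: 'f)"
    have "(\<Sum>k<N. a k * z k l) = z i l - z j l" for l
    proof -
      have "(\<Sum>k<N. a k * z k l) = (\<Sum>k\<in>{i, j}. a k * z k l)"
        by (rule sum.mono_neutral_right) (use ij in \<open>auto simp: a_def\<close>)
      then show ?thesis using ij by (simp add: a_def)
    qed
    then have "a i = 0" using ij ind[of a i] by (simp add: coset_eq_iff)
    then show False by (simp add: a_def)
  qed
  have "Q.lin_indpt ((\<lambda>i. coset (z i)) ` {..<N})"
  proof (rule Q.finite_lin_indpt2)
    fix a :: "('l \<Rightarrow> 'f) set \<Rightarrow> 'f"
    assume "Q.lincomb a ((\<lambda>i. coset (z i)) ` {..<N}) = \<zero>\<^bsub>Q\<^esub>"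
    moreover have "Q.lincomb a ((\<lambda>i. coset (z i)) ` {..<N})
        = coset (\<lambda>l. \<Sum>i<N. a (coset (z i)) * z i l)"
      by (rule lincomb_coset) (use inj z in auto)
    ultimately have "coset (\<lambda>l. \<Sum>i<N. a (coset (z i)) * z i l) = \<zero>\<^bsub>Q\<^esub>"
      by (rule subst[rotated])
    then have "(\<lambda>l. \<Sum>i<N. a (coset (z i)) * z i l) \<in> B"
      by (rule coset_zero_iff[THEN iffD1])
    from ind[OF this] show "\<forall>v\<in>(\<lambda>i. coset (z i)) ` {..<N}. a v = \<zero>\<^bsub>class_ring\<^esub>"
      by auto
  qed (use z in \<open>auto simp: carrier_Q\<close>)
  then have "card ((\<lambda>i. coset (z i)) ` {..<N}) \<le> Q.dim"
    by (intro Q.li_le_dim(2)[OF fin]) (use z in \<open>auto simp: carrier_Q\<close>)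
  then show "N \<le> Q.dim" by (simp add: card_image[OF inj])
next
  assume N: "N \<le> Q.dim"
  from Q.finite_basis_exists[OF fin] obtain \<beta> where \<beta>: "finite \<beta>" "Q.basis \<beta>" by blast
  have "card \<beta> = Q.dim" using Q.dim_basis[OF \<beta>] by simp
  then obtain A where A: "A \<subseteq> \<beta>" "card A = N" "finite A"
    using N \<beta>(1) by (metis obtain_subset_with_card_n finite_subset)
  have li: "Q.lin_indpt A" "A \<subseteq> carrier Q"
    using \<beta>(2) A(1) Q.subset_li_is_li unfolding Q.basis_def by blast+
  obtain e where e: "bij_betw e {..<N} A"
    using A(2,3) ex_bij_betw_nat_finite[of A] by (auto simp: atLeast0LessThan)
  have "\<exists>c. c \<in> Z \<and> coset c = e i" if "i < N" for i
    using that e li(2) by (force simp: bij_betw_def carrier_Q)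
  then obtain z where z: "\<And>i. i < N \<Longrightarrow> z i \<in> Z" "\<And>i. i < N \<Longrightarrow> coset (z i) = e i"
    by metis
  have img: "(\<lambda>i. coset (z i)) ` {..<N} = A" and inj: "inj_on (\<lambda>i. coset (z i)) {..<N}"
    using e z(2) by (auto simp: bij_betw_def inj_on_def)
  have "a i = 0" if "(\<lambda>l. \<Sum>i<N. a i * z i l) \<in> B" "i < N" for a i
  proof -
    define a' where "a' = (\<lambda>v. a (inv_into {..<N} e v))"
    have a': "a' (coset (z i)) = a i" if "i < N" for i
      using that z(2)[OF that] e by (simp add: a'_def bij_betw_def)
    have "Q.lincomb a' A = coset (\<lambda>l. \<Sum>i<N. a i * z i l)"
      using lincomb_coset[OF _ inj, of a'] z(1) a' by (simp add: img)
    then have "Q.lincomb a' A = \<zero>\<^bsub>Q\<^esub>" using that(1) by (simp add: coset_zero_iff)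
    then have "a' (coset (z i)) = \<zero>\<^bsub>class_ring\<^esub>" if "i < N" for i
      using li A(3) img that unfolding Q.lin_dep_def by (auto intro!: exI[of _ A] exI[of _ a'])
    then show ?thesis using a' that(2) by simp
  qed
  then show "\<exists>z. independent_mod N z"
    using z(1) by (auto simp: independent_mod_def)
qed

text \<open>
If an element of \<open>Z\<close> is determined by its values on \<open>T\<close>, then \<open>Z\<close> is spanned by
at most \<open>card T\<close> elements, and so is every quotient of it.
\<close>

lemma dim_Q_le:
  assumes "finite T" "\<And>c. c \<in> Z \<Longrightarrow> (\<And>l. l \<in> T \<Longrightarrow> c l = 0) \<Longrightarrow> c = (\<lambda>_. 0)"
  shows "Q.fin_dim" "Q.dim \<le> card T"
proof -
  have "\<exists>C \<subseteq> Z. finite C \<and> card C \<le> card T \<and> (\<forall>c\<in>Z. \<exists>u. c = (\<lambda>l. \<Sum>b\<in>C. u b * b l))"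
    using zero_B B_subset_Z by (intro spanning_family assms) (auto intro!: add_Z scale_Z)
  then obtain C where C: "C \<subseteq> Z" "finite C" "card C \<le> card T"
    "\<And>c. c \<in> Z \<Longrightarrow> \<exists>u. c = (\<lambda>l. \<Sum>b\<in>C. u b * b l)" by blast
  have sub: "coset ` C \<subseteq> carrier Q" using C(1) by (auto simp: carrier_Q)
  have sp: "submodule class_ring (Q.span (coset ` C)) Q"
    by (rule Q.span_is_submodule[OF sub])
  have "coset c \<in> Q.span (coset ` C)" if c: "c \<in> Z" for c
  proof -
    obtain u where u: "c = (\<lambda>l. \<Sum>b\<in>C. u b * b l)" using C(4)[OF c] by blast
    have "coset (\<lambda>l. \<Sum>b\<in>E. u b * b l) \<in> Q.span (coset ` C)" if "finite E" "E \<subseteq> C" for E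
      using that
    proof (induction E rule: finite_induct)
      case empty
      then show ?case using submodule.zero_closed[OF sp] by (simp add: zero_Q)
    next
      case (insert b E)
      have "u b \<odot>\<^bsub>Q\<^esub> coset b \<in> Q.span (coset ` C)"
        using insert.prems Q.in_own_span[OF sub] by (intro submodule.smult_closed[OF sp]) auto
      then have "u b \<odot>\<^bsub>Q\<^esub> coset b \<oplus>\<^bsub>Q\<^esub> coset (\<lambda>l. \<Sum>b\<in>E. u b * b l) \<in> Q.span (coset ` C)"
        using insert by (intro submodule.m_closed[OF sp]) auto
      then show ?case using insert by (simp add: add_Q scale_Q)
    qed
    from this[of C] show ?thesis using C(2) u by simp
  qed
  then have gen: "Q.gen_set (coset ` C)"
    using Q.span_is_subset2[OF sub] by (auto simp: carrier_Q)
  show "Q.fin_dim" unfolding Q.fin_dim_def using C(2) sub gen by blast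
  show "Q.dim \<le> card T"
    using Q.gen_ge_dim[OF _ sub gen] C(2,3) card_image_le[OF C(2), of coset] by simp
qed

end

section \<open>Chains and homology of a simplicial complex\<close>

definition simplicial_complex :: "'a set set \<Rightarrow> bool" where
  "simplicial_complex K \<longleftrightarrow> (\<forall>\<sigma>\<in>K. \<forall>\<tau>. \<tau> \<subseteq> \<sigma> \<longrightarrow> \<tau> \<noteq> {} \<longrightarrow> \<tau> \<in> K)"

text \<open>
Every face occurs once for each order of its vertices. This overcounts the dimension of the space of
chains by the constant factor \<open>(k+1)!\<close>, which is harmless for growth rates, and it
avoids the choice of an orientation.
\<close>

definition simplex_lists :: "'a set set \<Rightarrow> nat \<Rightarrow> 'a list set" where
  "simplex_lists K k = {vs. distinct vs \<and> length vs = Suc k \<and> set vs \<in> K}"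

lemma chain_support: "c \<in> oriented_chains K k \<Longrightarrow> c vs \<noteq> 0 \<Longrightarrow> vs \<in> simplex_lists K k"
  by (auto simp: oriented_chains_def simplex_lists_def)

lemma chain_swap:
  "c \<in> oriented_chains K k \<Longrightarrow> i < j \<Longrightarrow> j < length vs \<Longrightarrow>
    c (vs[i := vs ! j, j := vs ! i]) = - c vs"
  by (auto simp: oriented_chains_def)

lemma boundary_eq_sum:
  assumes "finite V" "\<And>v. c (v # ws) \<noteq> 0 \<Longrightarrow> v \<in> V"
  shows "boundary c ws = (\<Sum>v\<in>V. c (v # ws))"
  unfolding boundary_def by (rule sum.mono_neutral_left) (use assms in auto)

definition chain_vertices :: "('a list \<Rightarrow> 'f::zero) \<Rightarrow> 'a set" where
  "chain_vertices c = (\<Union>vs\<in>{vs. c vs \<noteq> 0}. set vs)"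

lemma finite_chain_vertices: "c \<in> oriented_chains K k \<Longrightarrow> finite (chain_vertices c)"
  by (auto simp: chain_vertices_def oriented_chains_def)

lemma boundary_eq_sum_vertices:
  assumes "finite V" "chain_vertices c \<subseteq> V"
  shows "boundary c ws = (\<Sum>v\<in>V. c (v # ws))"
  using assms by (intro boundary_eq_sum) (force simp: chain_vertices_def)+

lemma chains_zero: "(\<lambda>_. 0) \<in> oriented_chains K k"
  by (simp add: oriented_chains_def)

lemma chains_scale: "c \<in> oriented_chains K k \<Longrightarrow> (\<lambda>l. a * c l) \<in> oriented_chains K k"
  by (auto simp: oriented_chains_def elim!: rev_finite_subset)

lemma chains_add:
  assumes "c \<in> oriented_chains K k" "c' \<in> oriented_chains K k"
  shows "(\<lambda>l. c l + c' l) \<in> oriented_chains K k"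
proof -
  have "finite {vs. c vs + c' vs \<noteq> 0}"
    by (rule finite_subset[of _ "{vs. c vs \<noteq> 0} \<union> {vs. c' vs \<noteq> 0}"])
      (use assms in \<open>auto simp: oriented_chains_def\<close>)
  moreover have "c vs + c' vs \<noteq> 0 \<Longrightarrow> c vs \<noteq> 0 \<or> c' vs \<noteq> 0" for vs by auto
  ultimately show ?thesis
    using assms unfolding oriented_chains_def by (simp add: algebra_simps) metis
qed

lemma boundary_add:
  assumes "c \<in> oriented_chains K k" "c' \<in> oriented_chains K k"
  shows "boundary (\<lambda>l. c l + c' l) = (\<lambda>l. boundary c l + boundary c' l)"
proof
  fix ws
  let ?V = "chain_vertices c \<union> chain_vertices c'"
  have V: "finite ?V" using assms by (simp add: finite_chain_vertices)
  have "boundary (\<lambda>l. c l + c' l) ws = (\<Sum>v\<in>?V. c (v # ws) + c' (v # ws))"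
    by (rule boundary_eq_sum_vertices[OF V]) (force simp: chain_vertices_def)
  then show "boundary (\<lambda>l. c l + c' l) ws = boundary c ws + boundary c' ws"
    using boundary_eq_sum_vertices[OF V, of c ws] boundary_eq_sum_vertices[OF V, of c' ws]
    by (simp add: sum.distrib)
qed

lemma boundary_scale: "boundary (\<lambda>l. a * c l) = (\<lambda>l. a * boundary c l)"
  by (cases "a = 0") (auto simp: boundary_def sum_distrib_left)

lemma boundary_zero: "boundary (\<lambda>_. 0) = (\<lambda>_. 0)"
  by (simp add: boundary_def)

lemma boundary_in_chains:
  assumes K: "simplicial_complex K" and c: "c \<in> oriented_chains K (Suc k)"
  shows "boundary c \<in> oriented_chains K k"
proof -
  have nz: "\<exists>v. c (v # ws) \<noteq> 0" if "boundary c ws \<noteq> 0" for ws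
    using that unfolding boundary_def by (metis (mono_tags, lifting) mem_Collect_eq sum.neutral)
  have "finite (tl ` {vs. c vs \<noteq> 0})"
    using c by (simp add: oriented_chains_def)
  moreover have "{ws. boundary c ws \<noteq> 0} \<subseteq> tl ` {vs. c vs \<noteq> 0}"
    using nz by force
  ultimately have "finite {ws. boundary c ws \<noteq> 0}" by (rule rev_finite_subset)
  moreover have "distinct ws \<and> length ws = Suc k \<and> set ws \<in> K" if "boundary c ws \<noteq> 0" for ws
  proof -
    obtain v where "v # ws \<in> simplex_lists K (Suc k)"
      using nz[OF \<open>boundary c ws \<noteq> 0\<close>] chain_support[OF c] by blast
    then have "distinct ws" "length ws = Suc k" "insert v (set ws) \<in> K"
      by (auto simp: simplex_lists_def)
    then show ?thesis
      using K unfolding simplicial_complex_def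
      by (metis set_empty2 Zero_not_Suc list.size(3) subset_insertI)
  qed
  moreover have "boundary c (ws[i := ws ! j, j := ws ! i]) = - boundary c ws"
    if "i < j" "j < length ws" for ws i j
  proof -
    have "c (v # ws[i := ws ! j, j := ws ! i]) = - c (v # ws)" for v
      using chain_swap[OF c, of "Suc i" "Suc j" "v # ws"] that by simp
    then show ?thesis
      by (simp add: boundary_def sum_negf)
  qed
  ultimately show ?thesis by (simp add: oriented_chains_def)
qed

text \<open>
The terms of the pairs \<open>(u, v)\<close> and \<open>(v, u)\<close> cancel. The two sides of an exchange of
summation would only give that twice the sum is zero, which says nothing in characteristic two.
\<close>

lemma sum_antisymmetric:
  fixes g :: "'a \<Rightarrow> 'a \<Rightarrow> 'b::ab_group_add"
  assumes "finite A" "\<And>u v. g u v = - g v u" "\<And>u. g u u = 0"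
  shows "(\<Sum>u\<in>A. \<Sum>v\<in>A. g u v) = 0"
  using assms(1)
proof (induction A rule: finite_induct)
  case (insert a A)
  have "(\<Sum>u\<in>insert a A. \<Sum>v\<in>insert a A. g u v)
      = g a a + (\<Sum>v\<in>A. g a v) + (\<Sum>u\<in>A. g u a) + (\<Sum>u\<in>A. \<Sum>v\<in>A. g u v)"
    using insert.hyps by (simp add: sum.distrib add.assoc)
  moreover have "(\<Sum>u\<in>A. g u a) = - (\<Sum>v\<in>A. g a v)"
    using assms(2)[of _ a] by (simp add: sum_negf)
  ultimately show ?case using insert.IH assms(3) by simp
qed simp

lemma boundary_boundary:
  assumes c: "c \<in> oriented_chains K (Suc k)"
  shows "boundary (boundary c) = (\<lambda>_. 0)"
proof
  fix ws
  define V where "V = chain_vertices c"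
  have V: "finite V" using finite_chain_vertices[OF c] by (simp add: V_def)
  have b: "boundary c ws = (\<Sum>u\<in>V. c (u # ws))" for ws
    by (rule boundary_eq_sum_vertices[OF V]) (simp add: V_def)
  have "boundary (boundary c) ws = (\<Sum>v\<in>V. boundary c (v # ws))"
  proof (rule boundary_eq_sum[OF V])
    fix v assume "boundary c (v # ws) \<noteq> 0"
    then obtain u where "c (u # v # ws) \<noteq> 0"
      unfolding boundary_def by (metis (mono_tags, lifting) mem_Collect_eq sum.neutral)
    then show "v \<in> V" by (force simp: V_def chain_vertices_def)
  qed
  also have "\<dots> = (\<Sum>v\<in>V. \<Sum>u\<in>V. c (u # v # ws))" by (simp add: b)
  also have "\<dots> = 0"
  proof (rule sum_antisymmetric[OF V])
    show "c (u # v # ws) = - c (v # u # ws)" for u v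
      using chain_swap[OF c, of 0 1 "v # u # ws"] by simp
    show "c (u # u # ws) = 0" for u
      using chain_support[OF c, of "u # u # ws"] by (auto simp: simplex_lists_def)
  qed
  finally show "boundary (boundary c) ws = 0" .
qed

lemma cycle_in_chains: "c \<in> cycles K k \<Longrightarrow> c \<in> oriented_chains K k"
  by (simp add: cycles_def)

lemma function_quotient_cycles:
  assumes K: "simplicial_complex K"
  shows "function_quotient (cycles K k) (boundaries K k)"
proof
  show "(\<lambda>_. 0) \<in> boundaries K k"
    unfolding boundaries_def
    by (intro image_eqI[of _ _ "\<lambda>_. 0"]) (simp_all add: chains_zero boundary_zero)
  show "(\<lambda>l. c l + c' l) \<in> boundaries K k"
    if "c \<in> boundaries K k" "c' \<in> boundaries K k" for c c' :: "'a list \<Rightarrow> 'b"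
    using that unfolding boundaries_def by (auto simp flip: boundary_add intro!: imageI chains_add)
  show "(\<lambda>l. a * c l) \<in> boundaries K k" if "c \<in> boundaries K k" for a and c :: "'a list \<Rightarrow> 'b"
    using that unfolding boundaries_def by (auto simp flip: boundary_scale intro!: imageI chains_scale)
  show "(\<lambda>l. c l + c' l) \<in> cycles K k"
    if "c \<in> cycles K k" "c' \<in> cycles K k" for c c' :: "'a list \<Rightarrow> 'b"
    using that by (auto simp: cycles_def chains_add boundary_add)
  show "(\<lambda>l. a * c l) \<in> cycles K k" if "c \<in> cycles K k" for a and c :: "'a list \<Rightarrow> 'b"
    using that by (auto simp: cycles_def chains_scale boundary_scale)
  show "boundaries K k \<subseteq> (cycles K k :: ('a list \<Rightarrow> 'b) set)"
    by (auto simp: boundaries_def cycles_def boundary_boundary intro: boundary_in_chains[OF K])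
qed

section \<open>Bounds for Betti numbers\<close>

context
  fixes F :: "'f::field itself" and K :: "'a set set" and k :: nat
  assumes K: "simplicial_complex K" and fin: "finite (simplex_lists K k)"
begin

interpretation function_quotient "cycles K k :: ('a list \<Rightarrow> 'f) set" "boundaries K k"
  by (rule function_quotient_cycles[OF K])

lemma betti_eq_dim: "betti F K k = Q.dim"
  by (simp add: betti_def homology_def cycle_module_def Q_def)

lemma cycle_eq_zero:
  assumes "c \<in> cycles K k" "\<And>vs. vs \<in> simplex_lists K k \<Longrightarrow> c vs = 0"
  shows "c = (\<lambda>_. 0)"
  using assms chain_support cycle_in_chains by blast

lemma betti_le: "betti F K k \<le> card (simplex_lists K k)"
  unfolding betti_eq_dim by (rule dim_Q_le(2)[OF fin cycle_eq_zero])

lemma le_betti_iff: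
  "N \<le> betti F K k \<longleftrightarrow> (\<exists>z. independent_mod N z)"
  unfolding betti_eq_dim by (rule le_dim_Q_iff) (rule dim_Q_le(1)[OF fin cycle_eq_zero])

text \<open>
A boundary at \<open>apex s\<close> is a sum of values of a chain at lists \<open>v # apex s\<close>, none of which
spans a face. Evaluation at \<open>apex s\<close> is therefore a linear functional on homology, and these
functionals are dual to the classes of the cycles \<open>z s\<close> up to nonzero factors.
\<close>

lemma card_le_betti:
  fixes z :: "'i \<Rightarrow> 'a list \<Rightarrow> 'f" and apex :: "'i \<Rightarrow> 'a list"
  assumes S: "finite S"
    and z: "\<And>s. s \<in> S \<Longrightarrow> z s \<in> cycles K k" "\<And>s. s \<in> S \<Longrightarrow> z s (apex s) \<noteq> 0"
      "\<And>s t. s \<in> S \<Longrightarrow> t \<in> S \<Longrightarrow> s \<noteq> t \<Longrightarrow> z s (apex t) = 0"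
    and maximal: "\<And>s \<sigma>. s \<in> S \<Longrightarrow> \<sigma> \<in> K \<Longrightarrow> set (apex s) \<subseteq> \<sigma> \<Longrightarrow> card \<sigma> \<noteq> k + 2"
  shows "card S \<le> betti F K k"
proof -
  have bd: "b (apex s) = 0" if b: "b \<in> boundaries K k" and s: "s \<in> S" for b :: "'a list \<Rightarrow> 'f" and s
  proof -
    obtain c where c: "c \<in> oriented_chains K (Suc k)" "b = boundary c"
      using b by (auto simp: boundaries_def)
    have "c (v # apex s) = 0" for v
    proof (rule ccontr)
      assume "c (v # apex s) \<noteq> 0"
      then have "v # apex s \<in> simplex_lists K (Suc k)" by (rule chain_support[OF c(1)])
      then have "set (v # apex s) \<in> K" "card (set (v # apex s)) = k + 2"
        by (auto simp: simplex_lists_def distinct_card)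
      then show False using maximal[OF s, of "set (v # apex s)"] by auto
    qed
    then show ?thesis by (simp add: c(2) boundary_def)
  qed
  obtain e where e: "bij_betw e {..<card S} S"
    using S ex_bij_betw_nat_finite[of S] by (auto simp: atLeast0LessThan)
  have eS: "e i \<in> S" if "i < card S" for i using e that by (auto simp: bij_betw_def)
  have "independent_mod (card S) (\<lambda>i. z (e i))"
    unfolding independent_mod_def
  proof (intro conjI allI impI)
    show "(\<lambda>i. z (e i)) ` {..<card S} \<subseteq> cycles K k" using z(1) eS by auto
    fix a i assume h: "(\<lambda>l. \<Sum>i<card S. a i * z (e i) l) \<in> boundaries K k" "i < card S"
    have "z (e j) (apex (e i)) = 0" if "j < card S" "j \<noteq> i" for j
      using z(3)[of "e j" "e i"] eS that h(2) e by (auto simp: bij_betw_def inj_on_def)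
    then have "(\<Sum>j<card S. a j * z (e j) (apex (e i))) = (\<Sum>j\<in>{i}. a j * z (e j) (apex (e i)))"
      by (intro sum.mono_neutral_right) (use h(2) in auto)
    then have "a i * z (e i) (apex (e i)) = 0"
      using bd[OF h(1) eS[OF h(2)]] by simp
    then show "a i = 0" using z(2)[OF eS[OF h(2)]] by simp
  qed
  then show ?thesis unfolding le_betti_iff by blast
qed

end

text \<open>
The chain map induced by the bijection inverse to \<open>h\<close>. It is zero on lists that leave \<open>W\<close>
because \<open>h\<close> is arbitrary there.
\<close>

definition relabel :: "'b set \<Rightarrow> ('b \<Rightarrow> 'a) \<Rightarrow> ('a list \<Rightarrow> 'f::field) \<Rightarrow> 'b list \<Rightarrow> 'f" where
  "relabel W h c ws = (if set ws \<subseteq> W then c (map h ws) else 0)"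

lemma relabel_chain:
  assumes h: "bij_betw h W V" "finite W" and K: "\<And>\<sigma>. \<sigma> \<subseteq> W \<Longrightarrow> h ` \<sigma> \<in> K \<Longrightarrow> \<sigma> \<in> L"
    and c: "c \<in> oriented_chains K k"
  shows "relabel W h c \<in> oriented_chains L k"
proof -
  have inj: "inj_on h W" using h by (simp add: bij_betw_def)
  have supp: "distinct ws \<and> length ws = Suc k \<and> set ws \<in> L" if "relabel W h c ws \<noteq> 0" for ws
  proof -
    have ws: "set ws \<subseteq> W" "c (map h ws) \<noteq> 0"
      using that by (auto simp: relabel_def split: if_splits)
    then have "map h ws \<in> simplex_lists K k" by (intro chain_support[OF c])
    then show ?thesis using ws K by (auto simp: simplex_lists_def distinct_map)
  qed
  moreover have "finite {ws. relabel W h c ws \<noteq> 0}"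
  proof (rule finite_subset)
    show "{ws. relabel W h c ws \<noteq> 0} \<subseteq> {ws. set ws \<subseteq> W \<and> length ws = Suc k}"
      using supp by (auto simp: relabel_def split: if_splits)
    show "finite {ws. set ws \<subseteq> W \<and> length ws = Suc k}"
      by (rule finite_lists_length_eq[OF h(2)])
  qed
  moreover have "relabel W h c (ws[i := ws ! j, j := ws ! i]) = - relabel W h c ws"
    if "i < j" "j < length ws" for ws i j
  proof -
    have "set (ws[i := ws ! j, j := ws ! i]) = set ws"
      using that set_swap[of i ws j] by simp
    then show ?thesis
      using chain_swap[OF c, of i j "map h ws"] that by (simp add: relabel_def map_update)
  qed
  ultimately show ?thesis by (simp add: oriented_chains_def)
qed

lemma boundary_relabel:
  assumes h: "bij_betw h W V" "finite W" and K: "K \<subseteq> Pow V" and c: "c \<in> oriented_chains K k"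
  shows "boundary (relabel W h c) = relabel W h (boundary c)"
proof
  fix ws
  have V: "finite V" "h ` W = V" "inj_on h W" using h by (auto simp: bij_betw_def)
  show "boundary (relabel W h c) ws = relabel W h (boundary c) ws"
  proof (cases "set ws \<subseteq> W")
    case True
    have "boundary (relabel W h c) ws = (\<Sum>w\<in>W. relabel W h c (w # ws))"
      by (rule boundary_eq_sum[OF h(2)]) (auto simp: relabel_def split: if_splits)
    also have "\<dots> = (\<Sum>w\<in>W. c (h w # map h ws))"
      using True by (intro sum.cong) (auto simp: relabel_def)
    also have "\<dots> = (\<Sum>v\<in>V. c (v # map h ws))"
      using sum.reindex[OF V(3), of "\<lambda>v. c (v # map h ws)"] V(2) by simp
    also have "\<dots> = boundary c (map h ws)"
      by (rule boundary_eq_sum[OF V(1), symmetric])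
        (use chain_support[OF c] K in \<open>fastforce simp: simplex_lists_def\<close>)
    finally show ?thesis using True by (simp add: relabel_def)
  next
    case False
    then show ?thesis by (simp add: relabel_def boundary_def)
  qed
qed

lemma relabel_inverse:
  assumes h: "bij_betw h W V" and K: "K \<subseteq> Pow V" and c: "c \<in> oriented_chains K k"
  shows "relabel V (inv_into W h) (relabel W h c) = c"
proof
  fix vs
  show "relabel V (inv_into W h) (relabel W h c) vs = c vs"
  proof (cases "set vs \<subseteq> V")
    case True
    have "map h (map (inv_into W h) vs) = vs"
      using True h by (auto simp: bij_betw_def f_inv_into_f subset_iff intro!: map_idI)
    moreover have "set (map (inv_into W h) vs) \<subseteq> W"
      using True h by (auto simp: bij_betw_def intro!: inv_into_into)
    ultimately show ?thesis using True by (simp add: relabel_def)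
  next
    case False
    then have "c vs = 0" using chain_support[OF c, of vs] K by (auto simp: simplex_lists_def)
    then show ?thesis using False by (auto simp: relabel_def)
  qed
qed

lemma finite_simplex_lists: "finite V \<Longrightarrow> K \<subseteq> Pow V \<Longrightarrow> finite (simplex_lists K k)"
  by (rule finite_subset[OF _ finite_lists_length_eq[of V "Suc k"]])
    (auto simp: simplex_lists_def)

text \<open>
Relabelling maps cycles to cycles, and its inverse maps boundaries to boundaries, so it keeps
families of cycles independent modulo boundaries.
\<close>

lemma betti_le_isomorphic:
  fixes F :: "'f::field itself" and h :: "'b \<Rightarrow> 'a"
  assumes h: "bij_betw h W V" and fin: "finite W"
    and K: "simplicial_complex K" "K \<subseteq> Pow V" and L: "simplicial_complex L" "L \<subseteq> Pow W"
    and iso: "\<And>\<sigma>. \<sigma> \<subseteq> W \<Longrightarrow> \<sigma> \<in> L \<longleftrightarrow> h ` \<sigma> \<in> K"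
  shows "betti F K k \<le> betti F L k"
proof -
  have V: "finite V" using h fin bij_betw_finite by blast
  note fK = finite_simplex_lists[OF V K(2), of k] and fL = finite_simplex_lists[OF fin L(2), of k]
  define g where "g = inv_into W h"
  have g: "bij_betw g V W" unfolding g_def by (rule bij_betw_inv_into[OF h])
  interpret K: function_quotient "cycles K k :: ('a list \<Rightarrow> 'f) set" "boundaries K k"
    by (rule function_quotient_cycles[OF K(1)])
  interpret L: function_quotient "cycles L k :: ('b list \<Rightarrow> 'f) set" "boundaries L k"
    by (rule function_quotient_cycles[OF L(1)])
  obtain z where z: "K.independent_mod (betti F K k) z"
    using le_betti_iff[OF K(1) fK, of "betti F K k" F] by auto
  let ?N = "betti F K k"
  have zc: "z i \<in> cycles K k" if "i < ?N" for i
    using z that by (auto simp: K.independent_mod_def)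
  have "L.independent_mod ?N (\<lambda>i. relabel W h (z i))"
    unfolding L.independent_mod_def
  proof (intro conjI allI impI)
    show "(\<lambda>i. relabel W h (z i)) ` {..<?N} \<subseteq> cycles L k"
    proof (rule image_subsetI)
      fix i assume "i \<in> {..<?N}"
      then have c: "z i \<in> oriented_chains K k" and b: "k = 0 \<or> boundary (z i) = (\<lambda>_. 0)"
        using zc by (auto simp: cycles_def)
      have "boundary (relabel W h (z i)) = (\<lambda>_. 0)" if "boundary (z i) = (\<lambda>_. 0)"
        using boundary_relabel[OF h fin K(2) c] that by (auto simp: relabel_def)
      then show "relabel W h (z i) \<in> cycles L k"
        using b relabel_chain[OF h fin _ c, of L] iso by (auto simp: cycles_def)
    qed
    fix a i assume a: "(\<lambda>l. \<Sum>i<?N. a i * relabel W h (z i) l) \<in> boundaries L k" and i: "i < ?N"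
    define y where "y = (\<lambda>l. \<Sum>i<?N. a i * z i l)"
    have y: "y \<in> oriented_chains K k"
      using K.sum_Z[of "{..<?N}" "\<lambda>i l. a i * z i l"] zc K.scale_Z cycle_in_chains
      by (auto simp: y_def)
    have "(\<lambda>l. \<Sum>i<?N. a i * relabel W h (z i) l) = relabel W h y"
      by (auto simp: relabel_def y_def)
    then obtain d where d: "d \<in> oriented_chains L (Suc k)" "boundary d = relabel W h y"
      using a by (auto simp: boundaries_def)
    have Kd: "\<sigma> \<in> K" if "\<sigma> \<subseteq> V" "g ` \<sigma> \<in> L" for \<sigma>
    proof -
      have "h ` g ` \<sigma> = \<sigma>"
        using that(1) h unfolding g_def by (simp add: bij_betw_def image_inv_into_cancel)
      moreover have "g ` \<sigma> \<subseteq> W" using that(1) g by (auto simp: bij_betw_def)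
      ultimately show ?thesis using iso[of "g ` \<sigma>"] that(2) by simp
    qed
    have "y = relabel V g (relabel W h y)"
      unfolding g_def by (rule relabel_inverse[OF h K(2) y, symmetric])
    also have "\<dots> = boundary (relabel V g d)"
      using boundary_relabel[OF g V L(2) d(1)] d(2) by simp
    finally have "y \<in> boundaries K k"
      using relabel_chain[OF g V Kd d(1)] by (auto simp: boundaries_def)
    then show "a i = 0"
      using z i by (auto simp: K.independent_mod_def y_def)
  qed
  then show ?thesis using le_betti_iff[OF L(1) fL, of ?N F] by blast
qed

lemma betti_isomorphic:
  fixes F :: "'f::field itself" and h :: "'b \<Rightarrow> 'a"
  assumes h: "bij_betw h W V" and fin: "finite W"
    and K: "simplicial_complex K" "K \<subseteq> Pow V" and L: "simplicial_complex L" "L \<subseteq> Pow W"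
    and iso: "\<And>\<sigma>. \<sigma> \<subseteq> W \<Longrightarrow> \<sigma> \<in> L \<longleftrightarrow> h ` \<sigma> \<in> K"
  shows "betti F K k = betti F L k"
proof (rule antisym)
  show "betti F K k \<le> betti F L k" by (rule betti_le_isomorphic[OF h fin K L iso])
  have g: "bij_betw (inv_into W h) V W" by (rule bij_betw_inv_into[OF h])
  show "betti F L k \<le> betti F K k"
  proof (rule betti_le_isomorphic[OF g _ L K])
    show "finite V" using h fin bij_betw_finite by blast
    fix \<sigma> assume s: "\<sigma> \<subseteq> V"
    have "h ` inv_into W h ` \<sigma> = \<sigma>"
      using s h by (simp add: bij_betw_def image_inv_into_cancel)
    moreover have "inv_into W h ` \<sigma> \<subseteq> W" using s g by (auto simp: bij_betw_def)
    ultimately show "\<sigma> \<in> K \<longleftrightarrow> inv_into W h ` \<sigma> \<in> L"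
      using iso[of "inv_into W h ` \<sigma>"] by simp
  qed
qed

section \<open>Cycles from determinants\<close>

definition weight_det :: "('i \<Rightarrow> nat \<Rightarrow> 'f::field) \<Rightarrow> 'i list \<Rightarrow> 'f" where
  "weight_det a js = Determinant.det (Matrix.mat (length js) (length js) (\<lambda>(i, l). a (js ! i) l))"

lemma weight_det_map: "weight_det a (map h ws) = weight_det (\<lambda>v. a (h v)) ws"
proof -
  have "Matrix.mat (length ws) (length ws) (\<lambda>(i, l). a (map h ws ! i) l)
      = Matrix.mat (length ws) (length ws) (\<lambda>(i, l). a (h (ws ! i)) l)"
    by (rule eq_matI) auto
  then show ?thesis by (simp add: weight_det_def)
qed

lemma weight_det_swap:
  assumes "i < j" "j < length js"
  shows "weight_det a (js[i := js ! j, j := js ! i]) = - weight_det a js"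
proof -
  let ?A = "Matrix.mat (length js) (length js) (\<lambda>(i, l). a (js ! i) l)"
  have "Matrix.mat (length js) (length js) (\<lambda>(i', l). a (js[i := js ! j, j := js ! i] ! i') l)
      = swaprows i j ?A"
    by (rule eq_matI) (use assms in \<open>auto simp: mat_swaprows_def nth_list_update\<close>)
  then show ?thesis
    using det_swaprows[of i "length js" j ?A] assms by (simp add: weight_det_def)
qed

lemma weight_det_distinct:
  assumes "weight_det a js \<noteq> 0"
  shows "distinct js"
proof (rule ccontr)
  assume "\<not> distinct js"
  then obtain i j where ij: "i < length js" "j < length js" "i \<noteq> j" "js ! i = js ! j"
    by (auto simp: distinct_conv_nth)
  have "weight_det a js = 0"
    unfolding weight_det_def
    by (rule det_identical_rows[of _ "length js" i j]) (use ij in \<open>auto simp: Matrix.row_def\<close>)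
  then show False using assms by simp
qed

lemma weight_det_transversal:
  assumes "weight_det a js \<noteq> 0"
  obtains \<pi> where "\<pi> permutes {0..<length js}" "\<And>i. i < length js \<Longrightarrow> a (js ! i) (\<pi> i) \<noteq> 0"
proof -
  let ?A = "Matrix.mat (length js) (length js) (\<lambda>(i, l). a (js ! i) l)"
  have "(\<Sum>\<pi> | \<pi> permutes {0..<length js}. signof \<pi> * (\<Prod>i = 0..<length js. ?A $$ (i, \<pi> i))) \<noteq> 0"
    using assms unfolding weight_det_def by (subst (asm) det_def'[of _ "length js"]) auto
  then obtain \<pi> where \<pi>: "\<pi> permutes {0..<length js}"
    "(\<Prod>i = 0..<length js. ?A $$ (i, \<pi> i)) \<noteq> 0"
    by (metis (mono_tags, lifting) mem_Collect_eq mult_zero_right sum.neutral)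
  have "a (js ! i) (\<pi> i) \<noteq> 0" if "i < length js" for i
  proof -
    have "\<pi> i < length js" using permutes_in_image[OF \<pi>(1), of i] that by simp
    moreover have "?A $$ (i, \<pi> i) \<noteq> 0" using \<pi>(2) that by (simp del: index_mat)
    ultimately show ?thesis using that by simp
  qed
  then show thesis using that \<pi>(1) by blast
qed

text \<open>
The determinant is linear in its first row.
\<close>

lemma weight_det_sum_first:
  assumes "\<And>l. l \<le> length ws \<Longrightarrow> (\<Sum>v\<in>V. a v l) = 0"
  shows "(\<Sum>v\<in>V. weight_det a (v # ws)) = 0"
proof -
  let ?n = "Suc (length ws)"
  let ?A = "\<lambda>v. Matrix.mat ?n ?n (\<lambda>(i, l). a ((v # ws) ! i) l)"
  define C where "C = (\<lambda>l. cofactor (?A undefined) 0 l)"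
  have del: "mat_delete (?A v) 0 l = mat_delete (?A undefined) 0 l" for v l
    by (rule eq_matI) (auto simp: mat_delete_def)
  have C: "cofactor (?A v) 0 l = C l" for v l
    unfolding C_def cofactor_def del[of v l] ..
  have "weight_det a (v # ws) = (\<Sum>l<?n. a v l * C l)" for v
    using laplace_expansion_row[of "?A v" ?n 0] by (simp add: weight_det_def C)
  then have "(\<Sum>v\<in>V. weight_det a (v # ws)) = (\<Sum>v\<in>V. \<Sum>l<?n. a v l * C l)" by simp
  also have "\<dots> = (\<Sum>l<?n. (\<Sum>v\<in>V. a v l) * C l)"
    by (subst sum.swap) (simp add: sum_distrib_right)
  also have "\<dots> = 0" using assms by (intro sum.neutral) auto
  finally show ?thesis .
qed

definition det_chain :: "'a set \<Rightarrow> ('a \<Rightarrow> nat \<Rightarrow> 'f::field) \<Rightarrow> nat \<Rightarrow> 'a list \<Rightarrow> 'f" where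
  "det_chain V a k ws = (if length ws = Suc k \<and> set ws \<subseteq> V then weight_det a ws else 0)"

text \<open>
The coefficient of \<open>ws\<close> in the boundary is the sum of the determinants with first row
\<open>a v\<close>, which is the determinant with first row \<open>\<Sum>v. a v = 0\<close>. For points in general
position with vectors summing to zero this is the fundamental cycle of the boundary of a simplex;
opposite vectors at opposite vertices give that of a cross-polytope.
\<close>

lemma det_chain_cycle:
  assumes V: "finite V" and sum0: "\<And>l. l \<le> k \<Longrightarrow> (\<Sum>v\<in>V. a v l) = 0"
    and face: "\<And>ws. length ws = Suc k \<Longrightarrow> set ws \<subseteq> V \<Longrightarrow> weight_det a ws \<noteq> 0 \<Longrightarrow> set ws \<in> K"
  shows "det_chain V a k \<in> cycles K k"
proof -
  have supp: "distinct ws \<and> length ws = Suc k \<and> set ws \<in> K" if "det_chain V a k ws \<noteq> 0" for ws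
    using that face weight_det_distinct[of a ws] by (auto simp: det_chain_def split: if_splits)
  have "{ws. det_chain V a k ws \<noteq> 0} \<subseteq> {ws. set ws \<subseteq> V \<and> length ws = Suc k}"
    by (auto simp: det_chain_def split: if_splits)
  then have "finite {ws. det_chain V a k ws \<noteq> 0}"
    using finite_lists_length_eq[OF V, of "Suc k"] by (rule finite_subset)
  moreover have "det_chain V a k (ws[i := ws ! j, j := ws ! i]) = - det_chain V a k ws"
    if "i < j" "j < length ws" for ws i j
  proof -
    have "set (ws[i := ws ! j, j := ws ! i]) = set ws"
      using that set_swap[of i ws j] by simp
    then show ?thesis using weight_det_swap[OF that, of a] by (simp add: det_chain_def)
  qed
  ultimately have "det_chain V a k \<in> oriented_chains K k"
    using supp by (simp add: oriented_chains_def)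
  moreover have "boundary (det_chain V a k) ws = 0" for ws
  proof -
    have "boundary (det_chain V a k) ws = (\<Sum>v\<in>V. det_chain V a k (v # ws))"
      by (rule boundary_eq_sum[OF V]) (auto simp: det_chain_def split: if_splits)
    also have "\<dots> = (if length ws = k \<and> set ws \<subseteq> V then \<Sum>v\<in>V. weight_det a (v # ws) else 0)"
    proof -
      have "det_chain V a k (v # ws)
          = (if length ws = k \<and> set ws \<subseteq> V then weight_det a (v # ws) else 0)" if "v \<in> V" for v
        using that by (simp add: det_chain_def)
      note eq = this
      show ?thesis
      proof (cases "length ws = k \<and> set ws \<subseteq> V")
        case True
        then show ?thesis by (simp add: eq)
      next
        case False
        have "det_chain V a k (v # ws) = 0" if "v \<in> V" for v
          using eq[OF that] unfolding if_not_P[OF False] .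
        then show ?thesis unfolding if_not_P[OF False] by (rule sum.neutral[OF ballI])
      qed
    qed
    also have "\<dots> = 0"
      using weight_det_sum_first[of ws a V] sum0 by auto
    finally show ?thesis .
  qed
  ultimately show ?thesis by (auto simp: cycles_def)
qed

section \<open>Robust configurations of points spanning a sphere\<close>

text \<open>
Any points \<open>p j\<close> near the places \<open>c + r *\<^sub>R u j\<close>, with a tolerance proportional to
\<open>r\<close>, form a complex on which \<open>det_chain\<close> with the vectors \<open>a j\<close> is a cycle,
while there are no faces with \<open>k + 2\<close> vertices that could bound it. The list \<open>js\<close> names
a face at which this cycle does not vanish. All scales and all centres are included because the
configuration is placed in every cube of a grid whose side shrinks with \<open>r\<close>.
\<close>

definition spherical_configuration ::
  "(real \<Rightarrow> 'v::euclidean_space set \<Rightarrow> bool) \<Rightarrow> nat \<Rightarrow> nat \<Rightarrow> (nat \<Rightarrow> 'v) \<Rightarrow> real \<Rightarrow>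
    (nat \<Rightarrow> nat \<Rightarrow> 'f::field) \<Rightarrow> nat list \<Rightarrow> bool" where
  "spherical_configuration face k m u \<eta> a js \<longleftrightarrow>
     0 < \<eta> \<and> (\<forall>l\<le>k. (\<Sum>j<m. a j l) = 0) \<and>
     length js = Suc k \<and> set js \<subseteq> {..<m} \<and> weight_det a js \<noteq> 0 \<and>
     (\<forall>c r p. 0 < r \<longrightarrow> (\<forall>j<m. dist (p j) (c + r *\<^sub>R u j) < \<eta> * r) \<longrightarrow>
        inj_on p {..<m} \<and>
        (\<forall>is. length is = Suc k \<longrightarrow> set is \<subseteq> {..<m} \<longrightarrow> weight_det a is \<noteq> 0 \<longrightarrow> face r (p ` set is)) \<and>
        (\<forall>T \<subseteq> {..<m}. card T = k + 2 \<longrightarrow> \<not> face r (p ` T)))"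

lemma positive_lower_bound:
  fixes g :: "'i \<Rightarrow> real"
  assumes "finite I" "\<And>i. i \<in> I \<Longrightarrow> 0 < g i"
  obtains e where "0 < e" "e \<le> 1" "\<And>i. i \<in> I \<Longrightarrow> e \<le> g i"
proof -
  have "0 < Min (insert 1 (g ` I))" using assms by (subst Min_gr_iff) auto
  then show thesis using assms by (intro that[of "Min (insert 1 (g ` I))"]) auto
qed

lemma dist_perturbed:
  fixes u u' p p' c :: "'v::real_normed_vector"
  assumes "0 \<le> r" "dist p (c + r *\<^sub>R u) < \<delta>" "dist p' (c + r *\<^sub>R u') < \<delta>'"
  shows "\<bar>dist p p' - r * dist u u'\<bar> < \<delta> + \<delta>'"
proof -
  have "dist (c + r *\<^sub>R u) (c + r *\<^sub>R u') = r * dist u u'"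
    using assms(1) by (simp add: dist_norm flip: scaleR_diff_right)
  moreover have "dist (c + r *\<^sub>R u) (c + r *\<^sub>R u') \<le> dist p (c + r *\<^sub>R u) + dist p p' + dist p' (c + r *\<^sub>R u')"
    by (smt (verit) dist_commute dist_triangle)
  moreover have "dist p p' \<le> dist p (c + r *\<^sub>R u) + dist (c + r *\<^sub>R u) (c + r *\<^sub>R u') + dist p' (c + r *\<^sub>R u')"
    by (smt (verit) dist_commute dist_triangle)
  ultimately show ?thesis using assms(2,3) by linarith
qed

definition rips_face :: "real \<Rightarrow> 'a::euclidean_space set \<Rightarrow> bool" where
  "rips_face r \<sigma> \<longleftrightarrow> (\<forall>p\<in>\<sigma>. \<forall>q\<in>\<sigma>. cball p (r / 2) \<inter> cball q (r / 2) \<noteq> {})"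

definition cech_face :: "real \<Rightarrow> 'a::euclidean_space set \<Rightarrow> bool" where
  "cech_face r \<sigma> \<longleftrightarrow> (\<Inter>p\<in>\<sigma>. cball p (r / 2)) \<noteq> {}"

lemma cballs_meet_iff:
  fixes p q :: "'a::euclidean_space"
  shows "cball p (r / 2) \<inter> cball q (r / 2) \<noteq> {} \<longleftrightarrow> dist p q \<le> r"
proof
  assume "cball p (r / 2) \<inter> cball q (r / 2) \<noteq> {}"
  then obtain y where "dist p y \<le> r / 2" "dist q y \<le> r / 2" by auto
  then show "dist p q \<le> r" using dist_triangle2[of p q y] by linarith
next
  assume "dist p q \<le> r"
  then have "midpoint p q \<in> cball p (r / 2) \<inter> cball q (r / 2)"
    by (simp add: dist_midpoint)
  then show "cball p (r / 2) \<inter> cball q (r / 2) \<noteq> {}" by blast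
qed

lemma rips_face_iff: "rips_face r \<sigma> \<longleftrightarrow> (\<forall>p\<in>\<sigma>. \<forall>q\<in>\<sigma>. dist p q \<le> r)"
  by (simp only: rips_face_def cballs_meet_iff)

subsection \<open>The cross-polytope\<close>

text \<open>
Vertices \<open>2 * i\<close> and \<open>2 * i + 1\<close> are opposite; they carry the unit vector number
\<open>i\<close> with opposite signs.
\<close>

definition cross_weight :: "nat \<Rightarrow> nat \<Rightarrow> 'f::field" where
  "cross_weight j l = (if j div 2 = l then (- 1) ^ j else 0)"

lemma sum_cross_weight: "(\<Sum>j<2 * n. cross_weight j l) = (0 :: 'f::field)"
  by (induction n) (auto simp: cross_weight_def)

lemma weight_det_identity:
  assumes "\<And>i l. i \<le> k \<Longrightarrow> l \<le> k \<Longrightarrow> a (js ! i) l = (if i = l then 1 else 0 :: 'f::field)"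
    and "length js = Suc k"
  shows "weight_det a js = 1"
proof -
  have "Matrix.mat (Suc k) (Suc k) (\<lambda>(i, l). a (js ! i) l) = 1\<^sub>m (Suc k)"
    by (rule eq_matI) (use assms in auto)
  then show ?thesis using assms(2) by (simp add: weight_det_def)
qed

text \<open>
The directions of \<open>(1, 0)\<close>, \<open>(1, 1)\<close>, \<open>(1, 2)\<close>, \<dots> in a coordinate plane,
which exists in dimension at least two.
\<close>

lemma nonparallel_unit_vectors:
  assumes "2 \<le> CARD('d::finite)"
  obtains w :: "nat \<Rightarrow> real ^ 'd" where "\<And>i. norm (w i) = 1"
    "\<And>i j c. w i = c *\<^sub>R w j \<Longrightarrow> i = j"
proof -
  have "\<not> card (UNIV :: 'd set) \<le> Suc 0" using assms by simp
  then obtain \<alpha> \<beta> :: 'd where ab: "\<alpha> \<noteq> \<beta>"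
    by (auto simp: card_le_Suc0_iff_eq)
  define y where "y = (\<lambda>i::nat. axis \<alpha> 1 + real i *\<^sub>R axis \<beta> (1::real))"
  have y: "y i $ \<alpha> = 1" "y i $ \<beta> = real i" for i
    using ab by (auto simp: y_def axis_def)
  have y0: "y i \<noteq> 0" for i using y(1)[of i] by (metis zero_index zero_neq_one)
  define w where "w = (\<lambda>i. sgn (y i))"
  have w: "w i $ \<alpha> > 0" "w i $ \<beta> = real i * w i $ \<alpha>" for i
  proof -
    have "w i $ l = y i $ l / norm (y i)" for l by (simp add: w_def sgn_div_norm divide_inverse)
    then show "w i $ \<alpha> > 0" "w i $ \<beta> = real i * w i $ \<alpha>"
      using y0[of i] y[of i] by simp_all
  qed
  show thesis
  proof (rule that[of w])
    show "norm (w i) = 1" for i using y0 by (simp add: w_def norm_sgn)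
    fix i j c assume h: "w i = c *\<^sub>R w j"
    have "real i * w i $ \<alpha> = c * (real j * w j $ \<alpha>)"
      using arg_cong[OF h, of "\<lambda>x. x $ \<beta>"] unfolding vector_scaleR_component w(2) by simp
    also have "\<dots> = real j * w i $ \<alpha>"
      using arg_cong[OF h, of "\<lambda>x. x $ \<alpha>"] unfolding vector_scaleR_component by simp
    finally show "i = j" using w(1)[of i] by simp
  qed
qed

text \<open>
Vertices are \<open>k + 1\<close> pairs of opposite unit vectors on different lines. Opposite vectors have
distance exactly \<open>2\<close>, all others have distance at most \<open>2 - e\<close> for some \<open>e > 0\<close>. After
scaling so that \<open>r\<close> separates the two cases, the faces are the sets without opposite vertices,
which is the boundary of a cross-polytope.
\<close>

lemma rips_spherical_configuration:
  assumes "2 \<le> CARD('d::finite)"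
  shows "\<exists>m u \<eta> a js. spherical_configuration (rips_face :: real \<Rightarrow> (real ^ 'd) set \<Rightarrow> bool) k m u \<eta>
    (a :: nat \<Rightarrow> nat \<Rightarrow> 'f::field) js"
proof -
  obtain w :: "nat \<Rightarrow> real ^ 'd" where w: "\<And>i. norm (w i) = 1"
    "\<And>i j c. w i = c *\<^sub>R w j \<Longrightarrow> i = j"
    using nonparallel_unit_vectors[OF assms] by blast
  define v where "v = (\<lambda>j. (- 1) ^ j *\<^sub>R w (j div 2))"
  define m where "m = 2 * Suc k"
  have nv: "norm (v j) = 1" for j by (simp add: v_def w(1))
  have par: "i div 2 = j div 2" if "v i = c *\<^sub>R v j" for i j c
  proof -
    have "w (i div 2) = (- 1) ^ i *\<^sub>R v i" by (simp add: v_def flip: power_mult_distrib)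
    also have "\<dots> = ((- 1) ^ i * c * (- 1) ^ j) *\<^sub>R w (j div 2)"
      by (subst that) (simp add: v_def)
    finally show ?thesis by (rule w(2))
  qed
  have anti: "v i = - v j" if "i \<noteq> j" "i div 2 = j div 2" for i j
  proof -
    have "even i \<noteq> even j" using that by presburger
    then show ?thesis using that(2) by (auto simp: v_def)
  qed
  have less2: "dist (v i) (v j) < 2" if "i div 2 \<noteq> j div 2" for i j
  proof -
    have "dist (v i) (v j) \<noteq> 2"
    proof
      assume "dist (v i) (v j) = 2"
      then have "norm (v i + - v j) = norm (v i) + norm (- v j)" by (simp add: nv dist_norm)
      then have "v i = (- 1) *\<^sub>R v j" by (simp only: norm_triangle_eq) (simp add: nv)
      then show False using par that by blast
    qed
    moreover have "dist (v i) (v j) \<le> 2"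
      using norm_triangle_ineq4[of "v i" "v j"] by (simp add: nv dist_norm)
    ultimately show ?thesis by simp
  qed
  have pos: "0 < dist (v i) (v j)" if "i \<noteq> j" for i j
  proof -
    have "v i \<noteq> v j"
    proof
      assume h: "v i = v j"
      then have "i div 2 = j div 2" using par[of i 1 j] by simp
      then have "v i = - v j" using anti that by blast
      then have "v j + v j = 0" using h by (simp add: eq_neg_iff_add_eq_0)
      then have "v j = 0" by (simp flip: scaleR_2)
      then show False using nv[of j] by simp
    qed
    then show ?thesis by simp
  qed
  define g where "g = (\<lambda>(i, j). min (dist (v i) (v j)) (if i div 2 = j div 2 then 1 else 2 - dist (v i) (v j)))"
  have "finite {(i, j). i < m \<and> j < m \<and> i \<noteq> j}"
    by (rule finite_subset[of _ "{..<m} \<times> {..<m}"]) auto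
  then obtain e where e: "0 < e" "e \<le> 1" "\<And>x. x \<in> {(i, j). i < m \<and> j < m \<and> i \<noteq> j} \<Longrightarrow> e \<le> g x"
    by (rule positive_lower_bound[of _ g]) (use pos less2 in \<open>auto simp: g_def\<close>)
  have e1: "e \<le> dist (v i) (v j)" if "i < m" "j < m" "i \<noteq> j" for i j
    using e(3)[of "(i, j)"] that by (auto simp: g_def)
  have e2: "dist (v i) (v j) \<le> 2 - e" if "i < m" "j < m" "i div 2 \<noteq> j div 2" for i j
  proof -
    have "i \<noteq> j" using that by auto
    then show ?thesis using e(3)[of "(i, j)"] that by (auto simp: g_def)
  qed
  \<comment> \<open>This scale puts \<open>1\<close> in the middle between \<open>s * (2 - e)\<close> and \<open>s * 2\<close>,
    at distance \<open>s * e / 2\<close>, twice the tolerance \<open>\<eta>\<close>, from both.\<close>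
  define s where "s = 2 / (4 - e)"
  have s: "0 < s" "s * (4 - e) = 2" using e(2) by (auto simp: s_def divide_eq_eq)
  define \<eta> where "\<eta> = s * e / 4"
  define js where "js = map (\<lambda>i. 2 * i) [0..<Suc k]"
  have "spherical_configuration rips_face k m (\<lambda>j. s *\<^sub>R v j) \<eta> (cross_weight :: nat \<Rightarrow> nat \<Rightarrow> 'f) js"
    unfolding spherical_configuration_def
  proof (intro conjI allI impI)
    show "0 < \<eta>" using s(1) e(1) by (simp add: \<eta>_def)
    show "(\<Sum>j<m. cross_weight j l) = (0::'f)" for l
      unfolding m_def by (rule sum_cross_weight)
    show "length js = Suc k" "set js \<subseteq> {..<m}" by (auto simp: js_def m_def)
    have "weight_det (cross_weight :: nat \<Rightarrow> nat \<Rightarrow> 'f) js = 1"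
      by (rule weight_det_identity[of k]) (auto simp: js_def cross_weight_def simp del: upt_Suc)
    then show "weight_det (cross_weight :: nat \<Rightarrow> nat \<Rightarrow> 'f) js \<noteq> 0" by simp
  next
    fix c :: "real ^ 'd" and r :: real and p
    assume r: "0 < r" and p: "\<forall>j<m. dist (p j) (c + r *\<^sub>R s *\<^sub>R v j) < \<eta> * r"
    have d: "\<bar>dist (p i) (p j) - r * (s * dist (v i) (v j))\<bar> < r * (s * (e / 2))"
      if "i < m" "j < m" for i j
    proof -
      have "dist (s *\<^sub>R v i) (s *\<^sub>R v j) = s * dist (v i) (v j)"
        using s(1) by (simp add: dist_norm flip: scaleR_diff_right)
      then show ?thesis
        using dist_perturbed[of r "p i" c "s *\<^sub>R v i" "\<eta> * r" "p j" "s *\<^sub>R v j" "\<eta> * r"] p r that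
        by (simp add: \<eta>_def algebra_simps)
    qed
    show "inj_on p {..<m}"
    proof (rule inj_onI, rule ccontr)
      fix i j assume ij: "i \<in> {..<m}" "j \<in> {..<m}" "p i = p j" "i \<noteq> j"
      have "r * (s * dist (v i) (v j)) < r * (s * (e / 2))" using d[of i j] ij s r by simp
      then have "dist (v i) (v j) < e / 2" using r s by simp
      then show False using e1[of i j] ij e(1) by simp
    qed
    have far: "r < dist (p i) (p j)" if "i < m" "j < m" "i \<noteq> j" "i div 2 = j div 2" for i j
    proof -
      have "v i - v j = - (2 *\<^sub>R v j)" using anti[OF that(3,4)] by (simp add: scaleR_2)
      then have "dist (v i) (v j) = 2" by (simp only: dist_norm norm_minus_cancel) (simp add: nv)
      then have "r * (s * 2) - r * (s * (e / 2)) < dist (p i) (p j)"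
        using d[OF that(1,2)] by (simp only: abs_less_iff) linarith
      moreover have "r * (s * 2) - r * (s * (e / 2)) = r * (s * (4 - e)) / 2" by (simp add: field_simps)
      ultimately show ?thesis unfolding s(2) by linarith
    qed
    have near: "dist (p i) (p j) \<le> r" if "i < m" "j < m" "i div 2 \<noteq> j div 2" for i j
    proof -
      have "r * (s * dist (v i) (v j)) \<le> r * (s * (2 - e))"
        using e2[OF that] r s(1) by (intro mult_left_mono) auto
      then have "dist (p i) (p j) < r * (s * (2 - e)) + r * (s * (e / 2))"
        using d[OF that(1,2)] by linarith
      moreover have "r * (s * (2 - e)) + r * (s * (e / 2)) = r * (s * (4 - e)) / 2" by (simp add: field_simps)
      ultimately show ?thesis unfolding s(2) by linarith
    qed
    show "rips_face r (p ` set is)"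
      if "is": "length is = Suc k" "set is \<subseteq> {..<m}"
        "weight_det (cross_weight :: nat \<Rightarrow> nat \<Rightarrow> 'f) is \<noteq> 0" for "is"
    proof -
      obtain \<pi> where \<pi>: "\<pi> permutes {0..<length is}"
        "\<And>i. i < length is \<Longrightarrow> (cross_weight (is ! i) (\<pi> i) :: 'f) \<noteq> 0"
        by (rule weight_det_transversal[OF "is"(3)]) (rule that)
      have \<pi>': "is ! i div 2 = \<pi> i" if "i < length is" for i
        using \<pi>(2)[OF that] by (simp add: cross_weight_def split: if_splits)
      have "dist (p (is ! i)) (p (is ! j)) \<le> r" if "i < length is" "j < length is" for i j
      proof (cases "i = j")
        case True
        then show ?thesis using r by simp
      next
        case False
        then have "\<pi> i \<noteq> \<pi> j" using permutes_inj[OF \<pi>(1)] by (simp add: inj_eq)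
        then have "is ! i div 2 \<noteq> is ! j div 2" using \<pi>'[OF that(1)] \<pi>'[OF that(2)] by simp
        moreover have "is ! i < m" "is ! j < m" using "is"(2) nth_mem[OF that(1)] nth_mem[OF that(2)] by auto
        ultimately show ?thesis by (intro near)
      qed
      note nth = this
      have "dist (p i) (p j) \<le> r" if ij: "i \<in> set is" "j \<in> set is" for i j
      proof -
        obtain i' j' where "i' < length is" "is ! i' = i" "j' < length is" "is ! j' = j"
          using ij unfolding in_set_conv_nth by metis
        then show ?thesis using nth[of i' j'] by simp
      qed
      then show ?thesis unfolding rips_face_iff by (simp add: ball_simps)
    qed
    show "\<not> rips_face r (p ` T)" if T: "T \<subseteq> {..<m}" "card T = k + 2" for T
    proof -
      have "(\<lambda>j. j div 2) ` T \<subseteq> {..<Suc k}"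
      proof (rule image_subsetI)
        fix j assume "j \<in> T"
        then have "j < Suc k * 2" using T(1) by (auto simp: m_def)
        then show "j div 2 \<in> {..<Suc k}" by (simp only: less_mult_imp_div_less lessThan_iff)
      qed
      then have "card ((\<lambda>j. j div 2) ` T) < card T"
        using card_mono[of "{..<Suc k}" "(\<lambda>j. j div 2) ` T"] T(2) by simp
      then have "\<not> inj_on (\<lambda>j. j div 2) T" by (rule pigeonhole)
      then obtain i j where "i \<in> T" "j \<in> T" "i \<noteq> j" "i div 2 = j div 2"
        by (auto simp: inj_on_def)
      then have "r < dist (p i) (p j)" using T(1) by (intro far) auto
      moreover have "dist (p i) (p j) \<le> r" if "rips_face r (p ` T)"
        using that \<open>i \<in> T\<close> \<open>j \<in> T\<close> unfolding rips_face_iff by blast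
      ultimately show ?thesis by linarith
    qed
  qed
  then show ?thesis by blast
qed

subsection \<open>The boundary of a simplex\<close>

text \<open>
The vertices \<open>0, \<dots>, k\<close> carry the unit vectors, the vertex \<open>k + 1\<close> carries minus their
sum.
\<close>

definition simplex_weight :: "nat \<Rightarrow> nat \<Rightarrow> nat \<Rightarrow> 'f::field" where
  "simplex_weight k j l = (if j = Suc k then - 1 else if j = l then 1 else 0)"

lemma sum_simplex_weight:
  assumes "l \<le> k"
  shows "(\<Sum>j<k + 2. simplex_weight k j l) = (0 :: 'f::field)"
proof -
  have "(\<Sum>j<Suc k. simplex_weight k j l) = (\<Sum>j<Suc k. if j = l then 1 else (0 :: 'f))"
    by (rule sum.cong) (auto simp: simplex_weight_def)
  also have "\<dots> = 1" using assms by simp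
  finally show ?thesis by (simp add: simplex_weight_def)
qed

text \<open>
If \<open>0\<close> is a positive combination of unit vectors, then the unit ball about \<open>0\<close> is the
smallest ball that contains them: some vector has a non-positive inner product with \<open>y\<close>, as
otherwise the combination would have a positive one, and its distance to \<open>y\<close> is at least \<open>1\<close>.
\<close>

lemma far_from_some:
  fixes v :: "nat \<Rightarrow> 'v::euclidean_space"
  assumes "\<And>j. j < m \<Longrightarrow> norm (v j) = 1" "\<And>j. j < m \<Longrightarrow> 0 < c j" "0 < m"
    and "(\<Sum>j<m. c j *\<^sub>R v j) = 0"
  shows "\<exists>j<m. 1 \<le> dist y (v j)"
proof -
  have "\<exists>j<m. inner y (v j) \<le> 0"
  proof (rule ccontr)
    assume "\<not> ?thesis"
    then have "0 < (\<Sum>j<m. c j * inner y (v j))"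
      using assms(2,3) by (intro sum_pos) (auto simp: not_le)
    also have "\<dots> = inner y (\<Sum>j<m. c j *\<^sub>R v j)" by (simp add: inner_sum_right)
    finally show False by (simp add: assms(4))
  qed
  then obtain j where j: "j < m" "inner y (v j) \<le> 0" by blast
  have "(dist y (v j))\<^sup>2 = (norm y)\<^sup>2 - 2 * inner y (v j) + (norm (v j))\<^sup>2"
    unfolding dist_norm power2_norm_eq_inner by (simp add: inner_diff_left inner_diff_right inner_commute)
  moreover have "(norm (v j))\<^sup>2 = 1" using assms(1)[OF j(1)] by simp
  ultimately have "1\<^sup>2 \<le> (dist y (v j))\<^sup>2"
    using j(2) zero_le_power2[of "norm y"] unfolding one_power2 by linarith
  then have "1 \<le> dist y (v j)" by (rule power2_le_imp_le) simp
  then show ?thesis using j(1) by blast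
qed

text \<open>
Moving from \<open>0\<close> a little in the direction \<open>z\<close> brings all the unit vectors closer.
\<close>

lemma close_to_all:
  fixes v :: "nat \<Rightarrow> 'v::euclidean_space"
  assumes "finite J" "\<And>j. j \<in> J \<Longrightarrow> norm (v j) = 1" "\<And>j. j \<in> J \<Longrightarrow> 0 < inner z (v j)"
  shows "\<exists>y. \<forall>j\<in>J. dist y (v j) < 1"
proof -
  obtain e where e: "0 < e" "e \<le> 1" "\<And>j. j \<in> J \<Longrightarrow> e \<le> inner z (v j)"
    by (rule positive_lower_bound[of J "\<lambda>j. inner z (v j)"]) (use assms in auto)
  define t where "t = e / ((norm z)\<^sup>2 + 1)"
  have n: "0 < (norm z)\<^sup>2 + 1" by (intro add_nonneg_pos) auto
  have t: "0 < t" using e(1) n by (simp add: t_def)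
  have te: "t * (norm z)\<^sup>2 < e"
  proof -
    have "e * (norm z)\<^sup>2 < e * ((norm z)\<^sup>2 + 1)" using e(1) by (intro mult_strict_left_mono) auto
    then show ?thesis using n by (simp add: t_def divide_less_eq)
  qed
  have "dist (t *\<^sub>R z) (v j) < 1" if "j \<in> J" for j
  proof -
    have "(dist (t *\<^sub>R z) (v j))\<^sup>2 = t * (t * (norm z)\<^sup>2) - 2 * (t * inner z (v j)) + (norm (v j))\<^sup>2"
      unfolding dist_norm power2_norm_eq_inner
      by (simp add: inner_diff_left inner_diff_right inner_commute)
    moreover have "(norm (v j))\<^sup>2 = 1" using assms(2)[OF that] by simp
    moreover have "t * (t * (norm z)\<^sup>2) < t * e" using te t by (intro mult_strict_left_mono)
    moreover have "t * e \<le> t * inner z (v j)" using e(3)[OF that] t by (intro mult_left_mono) auto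
    moreover have "0 < t * e" using t e(1) by simp
    ultimately have "(dist (t *\<^sub>R z) (v j))\<^sup>2 < 1\<^sup>2" by simp
    then show ?thesis by (rule power2_less_imp_less) simp
  qed
  then show ?thesis by blast
qed

text \<open>
Take \<open>k + 1\<close> coordinate vectors and the opposite of their normalised sum. Once one of these
vectors is left out, the others lie in an open half-space.
\<close>

lemma simplex_directions:
  assumes "k < CARD('d::finite)"
  obtains v :: "nat \<Rightarrow> real ^ 'd" and c where
    "\<And>j. j < k + 2 \<Longrightarrow> norm (v j) = 1" "\<And>j. j < k + 2 \<Longrightarrow> 0 < c j"
    "(\<Sum>j<k + 2. c j *\<^sub>R v j) = 0"
    "\<And>i. i < k + 2 \<Longrightarrow> \<exists>z. \<forall>j\<in>{..<k + 2} - {i}. 0 < inner z (v j)"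
proof -
  have "card {..<Suc k} \<le> card (UNIV :: 'd set)" using assms by simp
  then obtain b :: "nat \<Rightarrow> 'd" where b: "inj_on b {..<Suc k}"
    using card_le_inj[of "{..<Suc k}" "UNIV :: 'd set"] by auto
  define S :: "real ^ 'd" where "S = (\<Sum>j<Suc k. axis (b j) 1)"
  define v :: "nat \<Rightarrow> real ^ 'd" where
    "v = (\<lambda>j. if j = Suc k then - ((1 / norm S) *\<^sub>R S) else axis (b j) 1)"
  define c where "c = (\<lambda>j. if j = Suc k then norm S else 1)"
  have inS: "inner z S = (\<Sum>j<Suc k. z $ b j)" for z
    by (simp add: S_def inner_sum_right inner_axis del: sum.lessThan_Suc)
  have "inner (\<chi> i. 1) S = real (Suc k)" by (simp add: inS del: sum.lessThan_Suc)
  then have S0: "S \<noteq> 0" by auto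
  show thesis
  proof (rule that[of v c])
    show "norm (v j) = 1" if "j < k + 2" for j using S0 by (simp add: v_def)
    show "0 < c j" if "j < k + 2" for j using S0 by (simp add: c_def)
    have "(\<Sum>j<Suc k. c j *\<^sub>R v j) = S" by (simp add: S_def c_def v_def cong: sum.cong_simp)
    moreover have "c (Suc k) *\<^sub>R v (Suc k) = - S" using S0 by (simp add: c_def v_def)
    ultimately show "(\<Sum>j<k + 2. c j *\<^sub>R v j) = 0" by simp
    show "\<exists>z. \<forall>j\<in>{..<k + 2} - {i}. 0 < inner z (v j)" if i: "i < k + 2" for i
    proof (cases "i = Suc k")
      case True
      have "0 < inner (\<chi> i. 1) (v j)" if "j \<in> {..<k + 2} - {i}" for j
        using that True by (simp add: v_def inner_axis)
      then show ?thesis by blast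
    next
      case False
      then have i: "i < Suc k" using i by simp
      \<comment> \<open>Weighted so heavily against coordinate \<open>b i\<close> that the sum of the \<open>k + 1\<close>
        relevant coordinates is \<open>- 1\<close>.\<close>
      define z :: "real ^ 'd" where "z = (\<chi> l. if l = b i then - real (k + 1) else 1)"
      have zb: "z $ b j = (if j = i then - real (k + 1) else 1)" if "j < Suc k" for j
        using b that i by (auto simp: z_def inj_on_def)
      have "inner z S = (\<Sum>j<Suc k. if j = i then - real (k + 1) else 1)"
        unfolding inS by (rule sum.cong) (auto simp: zb)
      also have "\<dots> = (\<Sum>j<Suc k. 1 + (if j = i then - real (k + 2) else 0))"
        by (rule sum.cong) auto
      also have "\<dots> = - 1" using i by (simp add: sum.distrib del: sum.lessThan_Suc)
      finally have zS: "inner z S = - 1" .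
      have "0 < inner z (v j)" if "j \<in> {..<k + 2} - {i}" for j
        using that zb[of j] zS S0 by (cases "j = Suc k") (auto simp: v_def inner_axis)
      then show ?thesis by blast
    qed
  qed
qed

text \<open>
No point has distance less than \<open>1\<close> to all of the unit vectors \<open>v j\<close>, but for each \<open>i\<close>
some \<open>y i\<close> has distance at most \<open>1 - e\<close> to all of them except \<open>v i\<close>. After scaling
so that \<open>r / 2\<close> separates the two cases, the faces are the proper subsets of the vertices.
\<close>

lemma cech_spherical_configuration:
  assumes "k < CARD('d::finite)"
  shows "\<exists>m u \<eta> a js. spherical_configuration (cech_face :: real \<Rightarrow> (real ^ 'd) set \<Rightarrow> bool) k m u \<eta>
    (a :: nat \<Rightarrow> nat \<Rightarrow> 'f::field) js"
proof -
  define m where "m = k + 2"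
  obtain v :: "nat \<Rightarrow> real ^ 'd" and c where v: "\<And>j. j < m \<Longrightarrow> norm (v j) = 1"
    and c: "\<And>j. j < m \<Longrightarrow> 0 < c j" "(\<Sum>j<m. c j *\<^sub>R v j) = 0"
    and z: "\<And>i. i < m \<Longrightarrow> \<exists>z. \<forall>j\<in>{..<m} - {i}. 0 < inner z (v j)"
    unfolding m_def by (rule simplex_directions[OF assms]) blast
  have far: "\<exists>j<m. 1 \<le> dist y (v j)" for y
    by (rule far_from_some[of m v c]) (use v c in \<open>auto simp: m_def\<close>)
  have "\<exists>y. \<forall>j\<in>{..<m} - {i}. dist y (v j) < 1" if i: "i < m" for i
  proof -
    obtain z' where "\<forall>j\<in>{..<m} - {i}. 0 < inner z' (v j)" using z[OF i] by blast
    then show ?thesis using v by (intro close_to_all[of _ v z']) auto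
  qed
  then obtain y where y: "\<And>i j. i < m \<Longrightarrow> j < m \<Longrightarrow> j \<noteq> i \<Longrightarrow> dist (y i) (v j) < 1"
    by (metis Diff_iff lessThan_iff singletonD)
  have pos: "0 < dist (v i) (v j)" if "i < m" "j < m" "i \<noteq> j" for i j
  proof -
    have "v i \<noteq> v j"
    proof
      assume h: "v i = v j"
      obtain l where l: "l < m" "1 \<le> dist (y i) (v l)" using far by blast
      then have "l = i" using y[OF that(1) l(1)] by auto
      then show False using l(2) h y[OF that(1,2)] that(3) by auto
    qed
    then show ?thesis by simp
  qed
  define g where "g = (\<lambda>(i, j). min (dist (v i) (v j)) (1 - dist (y i) (v j)))"
  have "finite {(i, j). i < m \<and> j < m \<and> i \<noteq> j}"
    by (rule finite_subset[of _ "{..<m} \<times> {..<m}"]) auto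
  then obtain e where e: "0 < e" "e \<le> 1" "\<And>x. x \<in> {(i, j). i < m \<and> j < m \<and> i \<noteq> j} \<Longrightarrow> e \<le> g x"
    by (rule positive_lower_bound[of _ g]) (use pos y in \<open>auto simp: g_def\<close>)
  have e1: "e \<le> dist (v i) (v j)" and e2: "dist (y i) (v j) \<le> 1 - e"
    if "i < m" "j < m" "i \<noteq> j" for i j
    using e(3)[of "(i, j)"] that by (auto simp: g_def)
  \<comment> \<open>This scale puts \<open>1 / 2\<close> in the middle between \<open>s * (1 - e)\<close> and \<open>s\<close>,
    at distance \<open>\<eta>\<close> from both.\<close>
  define s where "s = 1 / (2 - e)"
  have s: "0 < s" "s * (2 - e) = 1" using e(2) by (auto simp: s_def)
  define \<eta> where "\<eta> = s * e / 2"
  have "spherical_configuration cech_face k m (\<lambda>j. s *\<^sub>R v j) \<eta>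
      (simplex_weight k :: nat \<Rightarrow> nat \<Rightarrow> 'f) [0..<Suc k]"
    unfolding spherical_configuration_def
  proof (intro conjI allI impI)
    show "0 < \<eta>" using s(1) e(1) by (simp add: \<eta>_def)
    show "(\<Sum>j<m. simplex_weight k j l) = (0::'f)" if "l \<le> k" for l
      unfolding m_def by (rule sum_simplex_weight[OF that])
    show "length [0..<Suc k] = Suc k" "set [0..<Suc k] \<subseteq> {..<m}" by (auto simp: m_def)
    have "weight_det (simplex_weight k :: nat \<Rightarrow> nat \<Rightarrow> 'f) [0..<Suc k] = 1"
      by (rule weight_det_identity[of k]) (auto simp: simplex_weight_def simp del: upt_Suc)
    then show "weight_det (simplex_weight k :: nat \<Rightarrow> nat \<Rightarrow> 'f) [0..<Suc k] \<noteq> 0" by simp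
  next
    fix c :: "real ^ 'd" and r :: real and p
    assume r: "0 < r" and p: "\<forall>j<m. dist (p j) (c + r *\<^sub>R s *\<^sub>R v j) < \<eta> * r"
    have scale: "dist (c + r *\<^sub>R s *\<^sub>R x) (c + r *\<^sub>R s *\<^sub>R x') = r * s * dist x x'" for x x' :: "real ^ 'd"
    proof -
      have "(c + r *\<^sub>R s *\<^sub>R x) - (c + r *\<^sub>R s *\<^sub>R x') = (r * s) *\<^sub>R (x - x')"
        by (simp add: algebra_simps)
      then show ?thesis using r s(1) by (simp only: dist_norm norm_scaleR) simp
    qed
    show "inj_on p {..<m}"
    proof (rule inj_onI, rule ccontr)
      fix i j assume ij: "i \<in> {..<m}" "j \<in> {..<m}" "p i = p j" "i \<noteq> j"
      have "dist (p i) (c + r *\<^sub>R s *\<^sub>R v i) < \<eta> * r" "dist (p i) (c + r *\<^sub>R s *\<^sub>R v j) < \<eta> * r"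
        using p ij by auto
      then have "r * s * dist (v i) (v j) < \<eta> * r + \<eta> * r"
        using dist_triangle3[of "c + r *\<^sub>R s *\<^sub>R v i" "c + r *\<^sub>R s *\<^sub>R v j" "p i"]
        unfolding scale by linarith
      also have "\<dots> = r * s * e" by (simp add: \<eta>_def)
      finally have "dist (v i) (v j) < e" using r s(1) by simp
      then show False using e1[of i j] ij by simp
    qed
    show "cech_face r (p ` set is)"
      if "is": "length is = Suc k" "set is \<subseteq> {..<m}"
        "weight_det (simplex_weight k :: nat \<Rightarrow> nat \<Rightarrow> 'f) is \<noteq> 0" for "is"
    proof -
      have "card (set is) = Suc k" using weight_det_distinct[OF "is"(3)] "is"(1) by (simp add: distinct_card)
      then have "card (set is) \<noteq> card {..<m}" unfolding m_def by simp
      then have "set is \<noteq> {..<m}" by metis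
      then obtain i where i: "i < m" "i \<notin> set is" using "is"(2) by blast
      have "dist (p j) (c + r *\<^sub>R s *\<^sub>R y i) \<le> r / 2" if "j \<in> set is" for j
      proof -
        have j: "j < m" "j \<noteq> i" using that i "is"(2) by auto
        have "dist (p j) (c + r *\<^sub>R s *\<^sub>R y i)
            \<le> dist (p j) (c + r *\<^sub>R s *\<^sub>R v j) + r * s * dist (v j) (y i)"
          using dist_triangle[of "p j" "c + r *\<^sub>R s *\<^sub>R y i" "c + r *\<^sub>R s *\<^sub>R v j"] by (simp only: scale)
        also have "\<dots> \<le> \<eta> * r + r * s * (1 - e)"
          using p j e2[OF i(1) j(1)] r s(1) by (intro add_mono mult_left_mono) (auto simp: dist_commute less_imp_le)
        also have "\<dots> = r * (s * (2 - e)) / 2" by (simp add: \<eta>_def field_simps)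
        finally show ?thesis unfolding s(2) by simp
      qed
      then have "c + r *\<^sub>R s *\<^sub>R y i \<in> (\<Inter>q\<in>p ` set is. cball q (r / 2))" by simp
      then show ?thesis unfolding cech_face_def by blast
    qed
    show "\<not> cech_face r (p ` T)" if T: "T \<subseteq> {..<m}" "card T = k + 2" for T
    proof
      assume "cech_face r (p ` T)"
      moreover have "T = {..<m}" using T by (intro card_subset_eq) (auto simp: m_def)
      ultimately have "(\<Inter>j<m. cball (p j) (r / 2)) \<noteq> {}" by (simp add: cech_face_def)
      then obtain q where "q \<in> (\<Inter>j<m. cball (p j) (r / 2))" by blast
      then have q: "dist (p j) q \<le> r / 2" if "j < m" for j
        using that by (simp only: INT_iff mem_cball lessThan_iff)
      define x where "x = (1 / (r * s)) *\<^sub>R (q - c)"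
      have qx: "q = c + r *\<^sub>R s *\<^sub>R x" using r s(1) by (simp add: x_def)
      obtain j where j: "j < m" "1 \<le> dist x (v j)" using far by blast
      have "r * s * 1 \<le> r * s * dist x (v j)" using j(2) r s(1) by (intro mult_left_mono) auto
      also have "\<dots> \<le> dist (p j) q + dist (p j) (c + r *\<^sub>R s *\<^sub>R v j)"
        using dist_triangle3[of q "c + r *\<^sub>R s *\<^sub>R v j" "p j"] scale[of x "v j"]
        unfolding qx[symmetric] by linarith
      also have "\<dots> < r / 2 + \<eta> * r" using q[OF j(1)] p[rule_format, OF j(1)] by linarith
      finally have "r * s < r / 2 + \<eta> * r" by simp
      moreover have "r * (s * (2 - e)) / 2 = r * s - \<eta> * r" by (simp add: \<eta>_def field_simps)
      ultimately have "r * (s * (2 - e)) / 2 < r / 2" by linarith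
      then show False unfolding s(2) by simp
    qed
  qed
  then show ?thesis by blast
qed

section \<open>Grids of cubes\<close>

text \<open>
The cubes are half-open, so that they partition space.
\<close>

definition grid_cell :: "real \<Rightarrow> int ^ 'd \<Rightarrow> (real ^ 'd::finite) set" where
  "grid_cell s z = {y. \<forall>i. s * of_int (z $ i) \<le> y $ i \<and> y $ i < s * (of_int (z $ i) + 1)}"

lemma grid_cell_borel [measurable, simp]: "grid_cell s z \<in> sets borel"
proof -
  have "grid_cell s z = (\<Inter>i\<in>UNIV. {y \<in> space borel. s * of_int (z $ i) \<le> y $ i \<and> y $ i < s * (of_int (z $ i) + 1)})"
    by (auto simp: grid_cell_def)
  also have "\<dots> \<in> sets borel" by (intro sets.finite_INT) auto
  finally show ?thesis .
qed

lemma mem_grid_cell_iff: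
  assumes "0 < s"
  shows "y \<in> grid_cell s z \<longleftrightarrow> z = (\<chi> i. \<lfloor>y $ i / s\<rfloor>)"
proof -
  have "s * of_int (z $ i) \<le> y $ i \<and> y $ i < s * (of_int (z $ i) + 1) \<longleftrightarrow> z $ i = \<lfloor>y $ i / s\<rfloor>" for i
  proof -
    have "s * of_int (z $ i) \<le> y $ i \<and> y $ i < s * (of_int (z $ i) + 1)
        \<longleftrightarrow> of_int (z $ i) \<le> y $ i / s \<and> y $ i / s < of_int (z $ i) + 1"
      using assms by (simp add: field_simps)
    also have "\<dots> \<longleftrightarrow> \<lfloor>y $ i / s\<rfloor> = z $ i" by (simp add: floor_eq_iff)
    finally show ?thesis by auto
  qed
  then show ?thesis by (simp add: grid_cell_def Finite_Cartesian_Product.vec_eq_iff)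
qed

lemma grid_cells_disjoint: "0 < s \<Longrightarrow> z \<noteq> z' \<Longrightarrow> grid_cell s z \<inter> grid_cell s z' = {}"
  by (auto simp: mem_grid_cell_iff)

lemma emeasure_grid_cell:
  assumes "0 < s"
  shows "emeasure lborel (grid_cell s (z :: int ^ 'd::finite)) = ennreal (s ^ CARD('d))"
proof -
  define l u :: "real ^ 'd" where "l = (\<chi> i. s * of_int (z $ i))" and "u = (\<chi> i. s * (of_int (z $ i) + 1))"
  have diff: "(u - l) \<bullet> b = s" if "b \<in> Basis" for b
    using that by (auto simp: Basis_vec_def inner_axis l_def u_def algebra_simps)
  then have le: "l \<bullet> b \<le> u \<bullet> b" if "b \<in> Basis" for b
    using that assms by (simp add: inner_diff_left) (smt (verit))
  have prod: "(\<Prod>b\<in>Basis. (u - l) \<bullet> b) = s ^ CARD('d)"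
    by (simp add: diff)
  have "box l u \<subseteq> grid_cell s z" "grid_cell s z \<subseteq> cbox l u"
    by (auto simp: grid_cell_def mem_box_cart l_def u_def less_imp_le)
  then have "emeasure lborel (box l u) \<le> emeasure lborel (grid_cell s z)"
    "emeasure lborel (grid_cell s z) \<le> emeasure lborel (cbox l u)"
    by (auto intro!: emeasure_mono)
  then show ?thesis
    using le by (simp add: prod)
qed

lemma measure_grid_cell:
  "0 < s \<Longrightarrow> measure lborel (grid_cell s (z :: int ^ 'd::finite)) = s ^ CARD('d)"
  by (simp add: measure_def emeasure_grid_cell)

lemma grid_cell_fmeasurable: "0 < s \<Longrightarrow> grid_cell s z \<in> fmeasurable lborel"
  by (rule fmeasurableI) (auto simp: emeasure_grid_cell)

lemma measure_Union_grid_cells: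
  assumes "0 < s" "finite Z" "A \<in> sets borel"
  shows "measure lborel ((\<Union>z\<in>Z. grid_cell s z) - A) = (\<Sum>z\<in>Z. measure lborel (grid_cell s z - A))"
proof -
  have "measure lborel (\<Union>z\<in>Z. grid_cell s z - A) = (\<Sum>z\<in>Z. measure lborel (grid_cell s z - A))"
  proof (rule measure_UNION')
    show "pairwise (\<lambda>i j. disjnt (grid_cell s i - A) (grid_cell s j - A)) Z"
      using grid_cells_disjoint[OF assms(1)] by (auto simp: pairwise_def disjnt_def)
    show "grid_cell s z - A \<in> fmeasurable lborel" for z
      using grid_cell_fmeasurable[OF assms(1)] assms(3) by (intro fmeasurable_Diff) auto
  qed (rule assms)
  moreover have "(\<Union>z\<in>Z. grid_cell s z - A) = (\<Union>z\<in>Z. grid_cell s z) - A" by auto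
  ultimately show ?thesis by simp
qed

lemma dist_grid_cell:
  fixes y y' :: "real ^ 'd::finite"
  assumes "y \<in> grid_cell s z" "y' \<in> grid_cell s z"
  shows "dist y y' \<le> real CARD('d) * s"
proof -
  have "dist y y' \<le> (\<Sum>i\<in>UNIV. \<bar>(y - y') $ i\<bar>)" unfolding dist_norm by (rule norm_le_l1_cart)
  also have "\<dots> \<le> (\<Sum>i\<in>(UNIV::'d set). s)"
  proof (rule sum_mono)
    fix i
    have "s * of_int (z $ i) \<le> y $ i" "y $ i < s * (of_int (z $ i) + 1)"
      "s * of_int (z $ i) \<le> y' $ i" "y' $ i < s * (of_int (z $ i) + 1)"
      using assms by (auto simp: grid_cell_def)
    then show "\<bar>(y - y') $ i\<bar> \<le> s" by (simp add: algebra_simps)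
  qed
  finally show ?thesis by simp
qed

text \<open>
Let the open set \<open>U\<close> contain \<open>K\<close> and exceed it in volume by at most the fraction
\<open>\<epsilon> / 2\<close>. Cubes of small side that meet \<open>K\<close> lie in \<open>U\<close>, and their total volume is
at least that of \<open>K\<close>. So the parts of these cubes outside \<open>K\<close> have total volume at most
\<open>\<epsilon> / 2\<close> times that of all the cubes, and by Markov's inequality the part outside \<open>K\<close> exceeds
the fraction \<open>\<epsilon>\<close> in at most half of them.
\<close>

lemma many_cells_mostly_inside_compact:
  fixes K :: "(real ^ 'd::finite) set"
  assumes K: "compact K" "0 < measure lborel K" and \<epsilon>: "0 < \<epsilon>"
  obtains s0 where "0 < s0" "\<And>s. 0 < s \<Longrightarrow> s < s0 \<Longrightarrow>
    \<exists>G. finite G \<and> measure lborel K / 2 \<le> real (card G) * s ^ CARD('d) \<and>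
      (\<forall>z\<in>G. measure lborel (grid_cell s z - K) \<le> \<epsilon> * s ^ CARD('d))"
proof -
  define vol where "vol = measure lborel K"
  have Kb: "K \<in> sets borel" using K(1) by (simp add: borel_compact)
  have Kf: "K \<in> fmeasurable lborel" using K(1) by (simp add: fmeasurable_compact)
  obtain U where U: "open U" "K \<subseteq> U" "emeasure lborel (U - K) < ennreal (\<epsilon> / 2 * vol)"
    using outer_regular_lborel[of K "\<epsilon> / 2 * vol"] K(2) \<epsilon> Kb by (auto simp: vol_def)
  have Ub: "U \<in> sets borel" using U(1) by simp
  have UKf: "U - K \<in> fmeasurable lborel"
    using U(3) Kb Ub by (intro fmeasurableI) (auto simp: less_top order.strict_trans2)
  have UK: "measure lborel (U - K) \<le> \<epsilon> / 2 * vol"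
    unfolding measure_def using U(3) \<epsilon> K(2) by (intro enn2real_leI) (auto simp: vol_def less_imp_le)
  have "U = (U - K) \<union> K" using U(2) by auto
  then have Uf: "U \<in> fmeasurable lborel" using UKf Kf fmeasurable.Un by metis
  obtain \<rho> where \<rho>: "\<rho> > 0" "(\<Union>y\<in>K. ball y \<rho>) \<subseteq> U"
    using compact_subset_open_imp_ball_epsilon_subset[OF K(1) U(1,2)] by blast
  define s0 where "s0 = \<rho> / real CARD('d)"
  show thesis
  proof (rule that[of s0])
    show "0 < s0" using \<rho>(1) by (simp add: s0_def)
    fix s :: real assume s: "0 < s" "s < s0"
    then have s\<rho>: "real CARD('d) * s < \<rho>" by (simp add: s0_def field_simps)
    define Z where "Z = {z. grid_cell s z \<inter> K \<noteq> {}}"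
    have ZU: "grid_cell s z \<subseteq> U" if "z \<in> Z" for z
    proof
      fix y assume y: "y \<in> grid_cell s z"
      obtain y' where "y' \<in> grid_cell s z" "y' \<in> K" using \<open>z \<in> Z\<close> by (auto simp: Z_def)
      then have "dist y' y < \<rho>" using dist_grid_cell[of y' s z y] y s\<rho> by simp
      then have "y \<in> ball y' \<rho>" by simp
      then show "y \<in> U" using \<rho>(2) \<open>y' \<in> K\<close> by blast
    qed
    have count: "real (card F) * s ^ CARD('d) \<le> measure lborel U" if F: "F \<subseteq> Z" "finite F" for F
    proof -
      have "real (card F) * s ^ CARD('d) = measure lborel (\<Union>z\<in>F. grid_cell s z)"
        using measure_Union_grid_cells[OF s(1) F(2), of "{}"] by (simp add: measure_grid_cell s(1))
      also have "\<dots> \<le> measure lborel U"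
        using F ZU Uf by (intro measure_mono_fmeasurable) auto
      finally show ?thesis .
    qed
    have sd: "0 < s ^ CARD('d)" using s(1) by simp
    have "finite Z \<and> card Z \<le> nat \<lfloor>measure lborel U / s ^ CARD('d)\<rfloor>"
    proof (rule finite_if_finite_subsets_card_bdd)
      fix F assume "F \<subseteq> Z" "finite F"
      then have "real (card F) \<le> measure lborel U / s ^ CARD('d)"
        using count sd by (simp add: pos_le_divide_eq)
      then show "card F \<le> nat \<lfloor>measure lborel U / s ^ CARD('d)\<rfloor>" by linarith
    qed
    then have Z: "finite Z" by simp
    have "K \<subseteq> (\<Union>z\<in>Z. grid_cell s z)"
    proof
      fix y assume "y \<in> K"
      then have "y \<in> grid_cell s (\<chi> i. \<lfloor>y $ i / s\<rfloor>)" "(\<chi> i. \<lfloor>y $ i / s\<rfloor>) \<in> Z"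
        using mem_grid_cell_iff[OF s(1), of y "\<chi> i. \<lfloor>y $ i / s\<rfloor>"] by (auto simp: Z_def)
      then show "y \<in> (\<Union>z\<in>Z. grid_cell s z)" by blast
    qed
    moreover have "(\<Union>z\<in>Z. grid_cell s z) \<in> fmeasurable lborel"
      using Z grid_cell_fmeasurable[OF s(1)] by (intro fmeasurable.finite_UN) auto
    ultimately have "vol \<le> measure lborel (\<Union>z\<in>Z. grid_cell s z)"
      unfolding vol_def using Kb by (intro measure_mono_fmeasurable) auto
    also have "\<dots> = real (card Z) * s ^ CARD('d)"
      using measure_Union_grid_cells[OF s(1) Z, of "{}"] by (simp add: measure_grid_cell s(1))
    finally have NZ: "vol \<le> real (card Z) * s ^ CARD('d)" .
    define bad where "bad = {z \<in> Z. \<epsilon> * s ^ CARD('d) < measure lborel (grid_cell s z - K)}"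
    have bad: "finite bad" "bad \<subseteq> Z" using Z by (auto simp: bad_def)
    have "real (card bad) * (\<epsilon> * s ^ CARD('d)) \<le> (\<Sum>z\<in>bad. measure lborel (grid_cell s z - K))"
      by (rule sum_bounded_below) (auto simp: bad_def)
    also have "\<dots> = measure lborel ((\<Union>z\<in>bad. grid_cell s z) - K)"
      by (rule measure_Union_grid_cells[OF s(1) bad(1) Kb, symmetric])
    also have "\<dots> \<le> measure lborel (U - K)"
      using ZU bad Kb UKf by (intro measure_mono_fmeasurable) auto
    also have "\<dots> \<le> \<epsilon> / 2 * (real (card Z) * s ^ CARD('d))"
      using UK NZ \<epsilon> by (smt (verit) mult_left_mono half_gt_zero)
    finally have "(\<epsilon> * s ^ CARD('d)) * real (card bad) \<le> (\<epsilon> * s ^ CARD('d)) * (real (card Z) / 2)"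
      by (simp add: algebra_simps)
    then have half: "real (card bad) \<le> real (card Z) / 2"
      using \<epsilon> sd by (simp add: mult_le_cancel_left)
    have "real (card (Z - bad)) = real (card Z) - real (card bad)"
      using bad Z by (simp add: card_Diff_subset card_mono of_nat_diff)
    then have "real (card Z) / 2 \<le> real (card (Z - bad))" using half by linarith
    then have "real (card Z) / 2 * s ^ CARD('d) \<le> real (card (Z - bad)) * s ^ CARD('d)"
      using sd by (intro mult_right_mono) auto
    then have "vol / 2 \<le> real (card (Z - bad)) * s ^ CARD('d)" using NZ by simp
    then show "\<exists>G. finite G \<and> measure lborel K / 2 \<le> real (card G) * s ^ CARD('d) \<and>
      (\<forall>z\<in>G. measure lborel (grid_cell s z - K) \<le> \<epsilon> * s ^ CARD('d))"
      using Z by (intro exI[of _ "Z - bad"]) (auto simp: bad_def vol_def not_less)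
  qed
qed

text \<open>
The sets where the density is at least \<open>1 / (n + 1)\<close> exhaust the set where it is positive, so one
of them has positive mass; inner regularity provides the compact subset.
\<close>

lemma density_large_on_compact:
  fixes f :: "'v::euclidean_space \<Rightarrow> real"
  assumes f: "f \<in> borel_measurable borel" "prob_space (density lborel (\<lambda>v. ennreal (f v)))"
  obtains K \<delta> where "compact K" "0 < measure lborel K" "0 < \<delta>" "\<And>v. v \<in> K \<Longrightarrow> \<delta> \<le> f v"
proof -
  let ?D = "density lborel (\<lambda>v. ennreal (f v))"
  interpret D: prob_space ?D by (rule f(2))
  define A where "A = (\<lambda>n::nat. {v. inverse (real (Suc n)) \<le> f v})"
  have A: "A n \<in> sets borel" for n
    using f(1) unfolding A_def by measurable
  have "\<exists>n. emeasure ?D (A n) \<noteq> 0"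
  proof (rule ccontr)
    assume "\<not> ?thesis"
    then have "A n \<in> null_sets ?D" for n using A by (auto simp: null_sets_def)
    then have null: "(\<Union>n. A n) \<in> null_sets ?D" by blast
    have pos: "(\<Union>n. A n) = {v. 0 < f v}"
    proof (rule equalityI; rule subsetI)
      fix v assume "v \<in> (\<Union>n. A n)"
      then obtain n where "inverse (real (Suc n)) \<le> f v" by (auto simp: A_def)
      moreover have "0 < inverse (real (Suc n))" by simp
      ultimately have "0 < f v" by linarith
      then show "v \<in> {v. 0 < f v}" by simp
    next
      fix v assume "v \<in> {v. 0 < f v}"
      then obtain n where "inverse (real (Suc n)) < f v" using reals_Archimedean by auto
      then show "v \<in> (\<Union>n. A n)" by (auto simp: A_def intro!: exI[of _ n] less_imp_le)
    qed
    have "AE v in ?D. v \<notin> {v. 0 < f v}" using AE_not_in[OF null] by (simp add: pos)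
    moreover have "AE v in ?D. 0 < f v"
      using f(1) by (subst AE_density) (auto simp: ennreal_less_zero_iff)
    ultimately have "AE v in ?D. False" by eventually_elim simp
    then show False using D.AE_False D.emeasure_space_1 by simp
  qed
  then obtain n where n: "emeasure ?D (A n) \<noteq> 0" by blast
  have "emeasure ?D (A n) = (SUP K\<in>{K. K \<subseteq> A n \<and> compact K}. emeasure ?D K)"
    by (rule inner_regular) (use A D.emeasure_space_1 in auto)
  moreover have "(SUP K\<in>{K. K \<subseteq> A n \<and> compact K}. emeasure ?D K) \<le> 0"
    if "\<And>K. K \<subseteq> A n \<Longrightarrow> compact K \<Longrightarrow> emeasure ?D K = 0"
    by (rule SUP_least) (simp add: that)
  ultimately obtain K where K: "K \<subseteq> A n" "compact K" "emeasure ?D K \<noteq> 0"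
    using n by (metis le_zero_eq)
  have Kb: "K \<in> sets borel" using K(2) by (simp add: borel_compact)
  have "emeasure lborel K \<noteq> 0"
  proof
    assume "emeasure lborel K = 0"
    then have "K \<in> null_sets lborel" using Kb by auto
    then have "K \<in> null_sets ?D"
      using absolutely_continuousI_density[of "\<lambda>v. ennreal (f v)" lborel] f(1)
      by (auto simp: absolutely_continuous_def)
    then show False using K(3) by auto
  qed
  moreover have "emeasure lborel K < \<infinity>"
    by (rule emeasure_bounded_finite[OF compact_imp_bounded[OF K(2)]])
  ultimately have "0 < measure lborel K"
    unfolding measure_def by (intro enn2real_positive_iff[THEN iffD2]) (simp add: zero_less_iff_neq_zero)
  then show thesis using K(1,2) by (intro that[of K "inverse (real (Suc n))"]) (auto simp: A_def)
qed

section \<open>Independent points with a bounded density\<close>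

locale random_points = prob_space M for M :: "'w measure" +
  fixes x :: "nat \<Rightarrow> 'w \<Rightarrow> real ^ 'd::finite" and f :: "real ^ 'd \<Rightarrow> real" and bd :: real
  assumes f_borel [measurable]: "f \<in> borel_measurable borel"
    and f_nonneg: "0 \<le> f v" and f_le: "f v \<le> bd"
    and indep: "indep_vars (\<lambda>_. borel) x {1..}"
    and distributed_point: "1 \<le> i \<Longrightarrow> distributed M lborel (x i) (\<lambda>v. ennreal (f v))"
begin

definition law :: "(real ^ 'd) measure" where
  "law = density lborel (\<lambda>v. ennreal (f v))"

lemma sets_law [simp, measurable_cong]: "sets law = sets borel"
  by (simp add: law_def)

lemma point_borel: "1 \<le> i \<Longrightarrow> x i \<in> borel_measurable M"
  using distributed_measurable[OF distributed_point] by simp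

lemma distr_point: "1 \<le> i \<Longrightarrow> distr M lborel (x i) = law"
  unfolding law_def by (rule distributed_distr_eq_density[OF distributed_point])

lemma prob_space_law: "prob_space law"
  using prob_space_distr[of "x 1" lborel] point_borel[of 1] distr_point[of 1] by simp

sublocale law: prob_space law
  by (rule prob_space_law)

lemma prob_point:
  assumes "1 \<le> i" "S \<in> sets borel"
  shows "prob (x i -` S \<inter> space M) = measure law S"
  using measure_distr[of "x i" M lborel S] point_borel assms distr_point by simp

lemma prob_points:
  assumes J: "finite J" "J \<subseteq> {1..}" and S: "\<And>i. i \<in> J \<Longrightarrow> S i \<in> sets borel"
  shows "prob {\<omega> \<in> space M. \<forall>i\<in>J. x i \<omega> \<in> S i} = (\<Prod>i\<in>J. measure law (S i))"
proof (cases "J = {}")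
  case True
  then show ?thesis by (simp add: prob_space)
next
  case False
  have "{\<omega> \<in> space M. \<forall>i\<in>J. x i \<omega> \<in> S i} = (\<Inter>i\<in>J. x i -` S i \<inter> space M)"
    using False by auto
  then have "prob {\<omega> \<in> space M. \<forall>i\<in>J. x i \<omega> \<in> S i} = (\<Prod>i\<in>J. prob (x i -` S i \<inter> space M))"
    using indep_varsD[OF indep False J S] by simp
  also have "\<dots> = (\<Prod>i\<in>J. measure law (S i))"
    by (rule prod.cong) (use J S in \<open>auto intro!: prob_point\<close>)
  finally show ?thesis .
qed

lemma events_points:
  assumes J: "finite J" "J \<subseteq> {1..}" and S: "\<And>i. i \<in> J \<Longrightarrow> S i \<in> sets borel"
  shows "{\<omega> \<in> space M. \<forall>i\<in>J. x i \<omega> \<in> S i} \<in> events"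
proof (rule sets.sets_Collect_finite_All[OF _ J(1)])
  fix i assume "i \<in> J"
  then have "x i -` S i \<inter> space M \<in> events"
    using point_borel[of i] S[of i] J(2) by (intro measurable_sets) auto
  moreover have "x i -` S i \<inter> space M = {\<omega> \<in> space M. x i \<omega> \<in> S i}" by auto
  ultimately show "{\<omega> \<in> space M. x i \<omega> \<in> S i} \<in> events" by simp
qed

lemma bd_nonneg: "0 \<le> bd"
  using f_nonneg[of 0] f_le[of 0] by linarith

lemma law_le:
  assumes "S \<in> fmeasurable lborel"
  shows "measure law S \<le> bd * measure lborel S"
proof -
  have S: "S \<in> sets borel" "emeasure lborel S = ennreal (measure lborel S)"
    using assms by (auto simp: fmeasurable_def emeasure_eq_ennreal_measure)
  have "emeasure law S = (\<integral>\<^sup>+v. ennreal (f v) * indicator S v \<partial>lborel)"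
    unfolding law_def using S(1) by (simp add: emeasure_density)
  also have "\<dots> \<le> (\<integral>\<^sup>+v. ennreal bd * indicator S v \<partial>lborel)"
    by (intro nn_integral_mono mult_right_mono ennreal_leI f_le) simp
  also have "\<dots> = ennreal bd * emeasure lborel S"
    using S(1) by (simp add: nn_integral_cmult_indicator)
  also have "\<dots> = ennreal (bd * measure lborel S)"
    using bd_nonneg by (simp add: S(2) ennreal_mult')
  finally show ?thesis
    unfolding measure_def by (intro enn2real_leI) (auto intro: mult_nonneg_nonneg bd_nonneg)
qed

lemma law_ge:
  assumes "S \<in> fmeasurable lborel" "K \<in> sets borel" "0 \<le> \<delta>" "\<And>v. v \<in> K \<Longrightarrow> \<delta> \<le> f v"
  shows "\<delta> * (measure lborel S - measure lborel (S - K)) \<le> measure law S"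
proof -
  have SK: "S \<inter> K \<in> fmeasurable lborel" "S - K \<in> fmeasurable lborel"
    using assms(1,2) by (auto intro: fmeasurable_Int_fmeasurable fmeasurable_Diff)
  have "measure lborel (S - S \<inter> K) = measure lborel S - measure lborel (S \<inter> K)"
    by (rule measurable_measure_Diff) (use assms(1) SK in auto)
  moreover have "S - S \<inter> K = S - K" by auto
  ultimately have eq: "measure lborel S - measure lborel (S - K) = measure lborel (S \<inter> K)" by simp
  have S: "S \<inter> K \<in> sets borel" "emeasure lborel (S \<inter> K) = ennreal (measure lborel (S \<inter> K))"
    using SK by (auto simp: fmeasurable_def emeasure_eq_ennreal_measure)
  have "ennreal (\<delta> * measure lborel (S \<inter> K)) = ennreal \<delta> * emeasure lborel (S \<inter> K)"
    using assms(3) by (simp add: S(2) ennreal_mult')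
  also have "\<dots> = (\<integral>\<^sup>+v. ennreal \<delta> * indicator (S \<inter> K) v \<partial>lborel)"
    using S(1) by (simp add: nn_integral_cmult_indicator)
  also have "\<dots> \<le> (\<integral>\<^sup>+v. ennreal (f v) * indicator (S \<inter> K) v \<partial>lborel)"
    using assms(4) by (intro nn_integral_mono) (auto simp: indicator_def intro!: ennreal_leI)
  also have "\<dots> = emeasure law (S \<inter> K)"
    unfolding law_def using S(1) by (simp add: emeasure_density)
  finally have "\<delta> * measure lborel (S \<inter> K) \<le> measure law (S \<inter> K)"
    by (simp add: law.emeasure_eq_measure)
  also have "\<dots> \<le> measure law S"
    using assms(1) by (intro law.finite_measure_mono) (auto simp: fmeasurable_def)
  finally show ?thesis by (simp only: eq)
qed

lemma law_grid_cells:
  assumes "0 < s"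
  shows "(\<integral>\<^sup>+z. emeasure law (grid_cell s z) \<partial>count_space UNIV) = 1"
proof -
  have "y \<in> (\<Union>z. grid_cell s z)" for y :: "real ^ 'd"
    using mem_grid_cell_iff[OF assms, of y "\<chi> i. \<lfloor>y $ i / s\<rfloor>"] by blast
  then have cover: "(\<Union>z. grid_cell s z) = (UNIV :: (real ^ 'd) set)" by blast
  have "emeasure law (\<Union>z. grid_cell s z) = (\<integral>\<^sup>+z. emeasure law (grid_cell s z) \<partial>count_space UNIV)"
    using grid_cells_disjoint[OF assms]
    by (intro emeasure_UN_countable) (auto simp: disjoint_family_on_def)
  then show ?thesis using law.emeasure_space_1 by (simp add: cover law_def)
qed

text \<open>
A cell of side \<open>r\<close> that contains the first point confines the others to the cube of side
\<open>3 * r\<close> around the cell. Conditioning on the cell instead of on the position of the first point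
leaves only independence of events with fixed sets, and no integration over product spaces.
\<close>

lemma prob_close_le:
  assumes "is": "distinct is" "length is = Suc k" "set is \<subseteq> {1..}" and r: "0 < r"
  shows "prob {\<omega> \<in> space M. \<forall>i\<in>set is. dist (x i \<omega>) (x (hd is) \<omega>) \<le> r}
    \<le> (bd * (3 * r) ^ CARD('d)) ^ k"
proof -
  define C where "C = bd * (3 * r) ^ CARD('d)"
  have C: "0 \<le> C" using r bd_nonneg by (simp add: C_def)
  \<comment> \<open>Every point within distance \<open>r\<close> of the cell \<open>z\<close> lies in \<open>N z\<close>.\<close>
  define N :: "int ^ 'd \<Rightarrow> (real ^ 'd) set" where
    "N = (\<lambda>z. cbox (\<chi> i. r * (of_int (z $ i) - 1)) (\<chi> i. r * (of_int (z $ i) + 2)))"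
  have hd: "hd is \<in> set is" using "is"(2) by (cases "is") auto
  have "measure lborel (N z) = (3 * r) ^ CARD('d)" for z
  proof -
    have "measure lborel (N z) = (\<Prod>i\<in>(UNIV::'d set). 3 * r)"
      unfolding N_def using r by (subst content_cbox_cart) (auto simp: algebra_simps interval_eq_empty_cart(2) not_less intro!: prod.cong)
    then show ?thesis by simp
  qed
  then have DN: "measure law (N z) \<le> C" for z
    using law_le[of "N z"] by (simp add: N_def C_def)
  define A where "A = (\<lambda>z. {\<omega> \<in> space M. \<forall>i\<in>set is. x i \<omega> \<in> (if i = hd is then grid_cell r z else N z)})"
  have borel: "(if i = hd is then grid_cell r z else N z) \<in> sets borel" for i z
    by (simp add: N_def)
  have A_events: "A z \<in> events" for z
    unfolding A_def by (rule events_points) (use "is"(3) borel in auto)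
  have probA: "prob (A z) \<le> C ^ k * measure law (grid_cell r z)" for z
  proof -
    have "prob (A z) = (\<Prod>i\<in>set is. measure law (if i = hd is then grid_cell r z else N z))"
      unfolding A_def by (rule prob_points) (use "is"(3) borel in auto)
    also have "\<dots> = measure law (grid_cell r z) * (\<Prod>i\<in>set is - {hd is}. measure law (N z))"
      using hd by (subst prod.remove[of _ "hd is"]) (auto intro!: prod.cong)
    also have "\<dots> = measure law (grid_cell r z) * measure law (N z) ^ k"
      using "is"(1,2) hd by (simp add: distinct_card)
    also have "\<dots> \<le> measure law (grid_cell r z) * C ^ k"
      using DN by (intro mult_left_mono power_mono) auto
    finally show ?thesis by (simp add: mult.commute)
  qed
  have cover: "{\<omega> \<in> space M. \<forall>i\<in>set is. dist (x i \<omega>) (x (hd is) \<omega>) \<le> r} \<subseteq> (\<Union>z. A z)"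
  proof clarify
    fix \<omega> assume w: "\<omega> \<in> space M" "\<forall>i\<in>set is. dist (x i \<omega>) (x (hd is) \<omega>) \<le> r"
    define z :: "int ^ 'd" where "z = (\<chi> l. \<lfloor>x (hd is) \<omega> $ l / r\<rfloor>)"
    have z: "x (hd is) \<omega> \<in> grid_cell r z" using mem_grid_cell_iff[OF r, of "x (hd is) \<omega>" z] z_def by simp
    have "x i \<omega> \<in> N z" if "i \<in> set is" for i
    proof -
      have "r * (of_int (z $ l) - 1) \<le> x i \<omega> $ l \<and> x i \<omega> $ l \<le> r * (of_int (z $ l) + 2)" for l
      proof -
        have "\<bar>x i \<omega> $ l - x (hd is) \<omega> $ l\<bar> \<le> r"
          using dist_vec_nth_le[of "x i \<omega>" l "x (hd is) \<omega>"] w(2) that by (force simp: dist_real_def)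
        moreover have "r * of_int (z $ l) \<le> x (hd is) \<omega> $ l" "x (hd is) \<omega> $ l < r * (of_int (z $ l) + 1)"
          using z by (auto simp: grid_cell_def)
        ultimately show ?thesis by (auto simp: algebra_simps abs_le_iff)
      qed
      then show ?thesis by (simp add: N_def mem_box_cart)
    qed
    then have "\<omega> \<in> A z" using w(1) z by (simp add: A_def)
    then show "\<omega> \<in> (\<Union>z. A z)" by blast
  qed
  have "emeasure M {\<omega> \<in> space M. \<forall>i\<in>set is. dist (x i \<omega>) (x (hd is) \<omega>) \<le> r} \<le> emeasure M (\<Union>z. A z)"
    by (rule emeasure_mono[OF cover]) (use A_events in auto)
  also have "\<dots> = (\<integral>\<^sup>+z. emeasure M (A z) \<partial>count_space UNIV)"
  proof (rule emeasure_UN_countable)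
    show "disjoint_family A"
      unfolding disjoint_family_on_def
    proof (intro ballI impI)
      fix z z' :: "int ^ 'd" assume "z \<noteq> z'"
      then have "grid_cell r z \<inter> grid_cell r z' = {}" by (rule grid_cells_disjoint[OF r])
      moreover have "x (hd is) \<omega> \<in> grid_cell r z" if "\<omega> \<in> A z" for \<omega> z
        using that hd by (auto simp: A_def)
      ultimately show "A z \<inter> A z' = {}" by blast
    qed
  qed (use A_events in auto)
  also have "\<dots> \<le> (\<integral>\<^sup>+z. ennreal (C ^ k) * emeasure law (grid_cell r z) \<partial>count_space UNIV)"
  proof (rule nn_integral_mono)
    fix z
    have "emeasure M (A z) \<le> ennreal (C ^ k * measure law (grid_cell r z))"
      using probA[of z] by (simp add: emeasure_eq_measure ennreal_leI)
    also have "\<dots> = ennreal (C ^ k) * emeasure law (grid_cell r z)"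
      using C by (simp add: ennreal_mult law.emeasure_eq_measure)
    finally show "emeasure M (A z) \<le> ennreal (C ^ k) * emeasure law (grid_cell r z)" .
  qed
  also have "\<dots> = ennreal (C ^ k)"
    by (simp add: nn_integral_cmult law_grid_cells[OF r])
  finally show ?thesis
    unfolding C_def[symmetric] measure_def using C by (intro enn2real_leI) auto
qed

end

section \<open>Complexes determined by a face condition\<close>

text \<open>
Both kinds of complexes have this form, and the probabilistic arguments are carried out for it.
\<close>

definition face_complex :: "(real \<Rightarrow> 'v set \<Rightarrow> bool) \<Rightarrow> 'v set \<Rightarrow> real \<Rightarrow> 'v set set" where
  "face_complex face S r = {\<sigma>. \<sigma> \<subseteq> S \<and> finite \<sigma> \<and> \<sigma> \<noteq> {} \<and> face r \<sigma>}"

lemma Collect_restrict_eq_iff: "T \<subseteq> U \<Longrightarrow> {x \<in> U. R x} = T \<longleftrightarrow> (\<forall>x\<in>U. R x \<longleftrightarrow> x \<in> T)"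
  by blast

locale geometric_faces =
  fixes face :: "real \<Rightarrow> 'v::euclidean_space set \<Rightarrow> bool"
  assumes face_subset: "face r \<sigma> \<Longrightarrow> \<tau> \<subseteq> \<sigma> \<Longrightarrow> face r \<tau>"
    and face_dist: "face r \<sigma> \<Longrightarrow> y \<in> \<sigma> \<Longrightarrow> y' \<in> \<sigma> \<Longrightarrow> dist y y' \<le> r"
begin

lemma simplicial_face_complex: "simplicial_complex (face_complex face S r)"
  unfolding simplicial_complex_def face_complex_def
  using face_subset by (auto intro: finite_subset)

lemma face_complex_subset: "face_complex face S r \<subseteq> Pow S"
  by (auto simp: face_complex_def)

text \<open>
The coincidences between the points matter because several indices may name the same vertex.
\<close>

lemma betti_cong_pattern:
  fixes F :: "'f::field itself" and p q :: "'i \<Rightarrow> 'v"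
  assumes A: "finite A"
    and eq: "\<And>i j. i \<in> A \<Longrightarrow> j \<in> A \<Longrightarrow> p i = p j \<longleftrightarrow> q i = q j"
    and face: "\<And>I. I \<subseteq> A \<Longrightarrow> face r (p ` I) \<longleftrightarrow> face r (q ` I)"
  shows "betti F (face_complex face (p ` A) r) k = betti F (face_complex face (q ` A) r) k"
proof -
  define h where "h = q \<circ> inv_into A p"
  have h: "h (p i) = q i" if "i \<in> A" for i
  proof -
    have "inv_into A p (p i) \<in> A" "p (inv_into A p (p i)) = p i"
      using that by (auto intro: inv_into_into f_inv_into_f)
    then show ?thesis using eq that by (simp add: h_def)
  qed
  have "bij_betw h (p ` A) (q ` A)"
    unfolding bij_betw_def using h eq by (auto simp: inj_on_def image_image)
  moreover have "\<sigma> \<in> face_complex face (p ` A) r \<longleftrightarrow> h ` \<sigma> \<in> face_complex face (q ` A) r"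
    if s: "\<sigma> \<subseteq> p ` A" for \<sigma>
  proof -
    obtain I where I: "I \<subseteq> A" "\<sigma> = p ` I" using s by (meson subset_imageE)
    have hs: "h ` \<sigma> = q ` I" using I h by (auto simp: image_image subset_iff intro!: image_cong)
    have "finite I" using I(1) A by (rule finite_subset)
    then show ?thesis
      using I face[OF I(1)] unfolding hs by (auto simp: face_complex_def)
  qed
  ultimately show ?thesis
    using A simplicial_face_complex face_complex_subset
    by (intro betti_isomorphic[symmetric, of h "p ` A" "q ` A"]) auto
qed

text \<open>
The coincidences between the points and the index sets that span faces form a finite pattern which
is measurable as a function of the outcome and determines the Betti number.
\<close>

lemma betti_measurable:
  fixes F :: "'f::field itself" and X :: "nat \<Rightarrow> 'w \<Rightarrow> 'v"
  assumes X: "\<And>i. i \<in> {1..n} \<Longrightarrow> X i \<in> borel_measurable M"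
    and face: "\<And>I. I \<subseteq> {1..n} \<Longrightarrow> {\<omega> \<in> space M. face r ((\<lambda>i. X i \<omega>) ` I)} \<in> sets M"
  shows "(\<lambda>\<omega>. real (betti F (face_complex face ((\<lambda>i. X i \<omega>) ` {1..n}) r) k)) \<in> borel_measurable M"
proof -
  define A where "A = {1..n}"
  define b where "b = (\<lambda>\<omega>. real (betti F (face_complex face ((\<lambda>i. X i \<omega>) ` {1..n}) r) k))"
  define pat where "pat = (\<lambda>\<omega>. ({I \<in> Pow A. face r ((\<lambda>i. X i \<omega>) ` I)}, {e \<in> A \<times> A. X (fst e) \<omega> = X (snd e) \<omega>}))"
  have b_pat: "b \<omega> = b \<omega>'" if "pat \<omega> = pat \<omega>'" for \<omega> \<omega>'
  proof -
    have 1: "I \<in> {I \<in> Pow A. face r ((\<lambda>i. X i \<omega>) ` I)} \<longleftrightarrow> I \<in> {I \<in> Pow A. face r ((\<lambda>i. X i \<omega>') ` I)}" for I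
      using that by (simp add: pat_def)
    have 2: "e \<in> {e \<in> A \<times> A. X (fst e) \<omega> = X (snd e) \<omega>} \<longleftrightarrow> e \<in> {e \<in> A \<times> A. X (fst e) \<omega>' = X (snd e) \<omega>'}" for e
      using that by (simp add: pat_def)
    show ?thesis
      unfolding b_def A_def[symmetric] of_nat_eq_iff
    proof (rule betti_cong_pattern)
      show "finite A" by (simp add: A_def)
      show "X i \<omega> = X j \<omega> \<longleftrightarrow> X i \<omega>' = X j \<omega>'" if "i \<in> A" "j \<in> A" for i j
        using 2[of "(i, j)"] that by simp
      show "face r ((\<lambda>i. X i \<omega>) ` I) \<longleftrightarrow> face r ((\<lambda>i. X i \<omega>') ` I)" if "I \<subseteq> A" for I
        using 1[of I] that by simp
    qed
  qed
  define P where "P = Pow (Pow A) \<times> Pow (A \<times> A)"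
  have P: "finite P" by (simp add: P_def A_def)
  have iff_set: "{\<omega> \<in> space M. R \<omega> \<longleftrightarrow> c} \<in> sets M" if "{\<omega> \<in> space M. R \<omega>} \<in> sets M" for R c
    using that sets.sets_Collect_neg[OF that] by (cases c) simp_all
  have "pat \<in> measurable M (count_space P)"
    unfolding measurable_count_space_eq2[OF P]
  proof (intro conjI ballI)
    show "pat \<in> space M \<rightarrow> P" by (auto simp: pat_def P_def)
    fix e assume "e \<in> P"
    then obtain S E where SE: "e = (S, E)" "S \<subseteq> Pow A" "E \<subseteq> A \<times> A" by (auto simp: P_def)
    have "pat \<omega> = e \<longleftrightarrow> (\<forall>I\<in>Pow A. face r ((\<lambda>i. X i \<omega>) ` I) \<longleftrightarrow> I \<in> S)
        \<and> (\<forall>e\<in>A \<times> A. X (fst e) \<omega> = X (snd e) \<omega> \<longleftrightarrow> e \<in> E)" for \<omega>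
      unfolding SE(1) pat_def prod.inject Collect_restrict_eq_iff[OF SE(2)] Collect_restrict_eq_iff[OF SE(3)] ..
    then have "pat -` {e} \<inter> space M = {\<omega> \<in> space M. \<forall>I\<in>Pow A. face r ((\<lambda>i. X i \<omega>) ` I) \<longleftrightarrow> I \<in> S}
        \<inter> {\<omega> \<in> space M. \<forall>e\<in>A \<times> A. X (fst e) \<omega> = X (snd e) \<omega> \<longleftrightarrow> e \<in> E}"
      by auto
    also have "\<dots> \<in> sets M"
    proof (intro sets.Int sets.sets_Collect_finite_All iff_set)
      show "{\<omega> \<in> space M. face r ((\<lambda>i. X i \<omega>) ` I)} \<in> sets M" if "I \<in> Pow A" for I
        using face that by (simp add: A_def)
      show "{\<omega> \<in> space M. X (fst e) \<omega> = X (snd e) \<omega>} \<in> sets M" if "e \<in> A \<times> A" for e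
      proof -
        have [measurable]: "X (fst e) \<in> borel_measurable M" "X (snd e) \<in> borel_measurable M"
          using X that by (auto simp: A_def)
        show ?thesis by measurable
      qed
    qed (auto simp: A_def)
    finally show "pat -` {e} \<inter> space M \<in> sets M" .
  qed
  note pat = this
  define g where "g = (\<lambda>e. b (SOME \<omega>. pat \<omega> = e))"
  have "(\<lambda>\<omega>. g (pat \<omega>)) \<in> borel_measurable M"
    by (rule measurable_compose[OF pat]) simp
  moreover have "g (pat \<omega>) = b \<omega>" for \<omega>
    unfolding g_def by (rule b_pat) (rule someI[of _ \<omega>], simp)
  ultimately show ?thesis by (simp add: b_def)
qed

end

definition cell_center :: "real \<Rightarrow> int ^ 'd \<Rightarrow> real ^ 'd::finite" where
  "cell_center s z = (\<chi> i. s * (of_int (z $ i) + 1 / 2))"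

lemma mem_grid_cell_if_close:
  assumes "dist y (cell_center s z) < s / 2"
  shows "y \<in> grid_cell s z"
proof -
  have "\<bar>y $ i - s * (of_int (z $ i) + 1 / 2)\<bar> < s / 2" for i
    using dist_vec_nth_le[of y i "cell_center s z"] assms by (simp add: dist_real_def cell_center_def)
  note less = this
  have "s * of_int (z $ i) \<le> y $ i \<and> y $ i < s * (of_int (z $ i) + 1)" for i
  proof -
    have "y $ i - (s * of_int (z $ i) + s / 2) < s / 2" "- (y $ i - (s * of_int (z $ i) + s / 2)) < s / 2"
      using less[of i] unfolding abs_less_iff distrib_left by simp_all
    then show ?thesis unfolding distrib_left by linarith
  qed
  then show ?thesis by (simp add: grid_cell_def)
qed

text \<open>
An element \<open>(z, \<tau>)\<close> of \<open>S\<close> says that the points with indices \<open>\<tau> 0, \<dots>, \<tau> (m - 1)\<close>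
are in position near the places about the centre of the cell \<open>z\<close> and are the only points of the
cell. Requiring \<open>\<tau> j\<close> to lie in the block \<open>j\<close> makes \<open>\<tau>\<close> unique for given points, so
different elements of \<open>S\<close> have disjoint vertex sets. A face that meets a sphere stays in its cell,
hence consists of its vertices, hence has at most \<open>k + 1\<close> elements; so every \<open>k\<close>-face of
a sphere is a maximal face.
\<close>

lemma (in geometric_faces) card_isolated_spheres_le_betti:
  fixes F :: "'f::field itself" and a :: "nat \<Rightarrow> nat \<Rightarrow> 'f" and p :: "'i \<Rightarrow> 'v" and S :: "('c \<times> (nat \<Rightarrow> 'i)) set"
  assumes conf: "spherical_configuration face k m u \<eta> a js" and r: "0 < r"
    and A: "finite A" and S: "finite S"
    and blocks: "\<And>z \<tau>. (z, \<tau>) \<in> S \<Longrightarrow> \<tau> \<in> (\<Pi>\<^sub>E j\<in>{..<m}. block j)"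
      "\<And>i j. i < m \<Longrightarrow> j < m \<Longrightarrow> block i \<inter> block j \<noteq> {} \<Longrightarrow> i = j"
      "\<And>j. j < m \<Longrightarrow> block j \<subseteq> A"
    and cells: "\<And>z z'. z \<noteq> z' \<Longrightarrow> cell z \<inter> cell z' = {}"
    and near: "\<And>z \<tau> j. (z, \<tau>) \<in> S \<Longrightarrow> j < m \<Longrightarrow> dist (p (\<tau> j)) (center z + r *\<^sub>R u j) < \<eta> * r"
    and inside: "\<And>z \<tau> j y. (z, \<tau>) \<in> S \<Longrightarrow> j < m \<Longrightarrow> dist (p (\<tau> j)) y \<le> r \<Longrightarrow> y \<in> cell z"
    and isolated: "\<And>z \<tau> i. (z, \<tau>) \<in> S \<Longrightarrow> i \<in> A \<Longrightarrow> i \<notin> \<tau> ` {..<m} \<Longrightarrow> p i \<notin> cell z"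
  shows "card S \<le> betti F (face_complex face (p ` A) r) k"
proof -
  let ?K = "face_complex face (p ` A) r"
  define P where "P = (\<lambda>(t :: 'c \<times> (nat \<Rightarrow> 'i)) (j :: nat). p (snd t j) :: 'v)"
  define V where "V = (\<lambda>t :: 'c \<times> (nat \<Rightarrow> 'i). P t ` {..<m})"
  define ind where "ind = (\<lambda>t :: 'c \<times> (nat \<Rightarrow> 'i). inv_into {..<m} (P t))"
  define apex where "apex = (\<lambda>t :: 'c \<times> (nat \<Rightarrow> 'i). map (P t) js)"
  define zc where "zc = (\<lambda>t :: 'c \<times> (nat \<Rightarrow> 'i). det_chain (V t) (\<lambda>y. a (ind t y)) k)"
  have js: "length js = Suc k" "set js \<subseteq> {..<m}" "weight_det a js \<noteq> 0"
    and sum0: "\<And>l. l \<le> k \<Longrightarrow> (\<Sum>j<m. a j l) = 0"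
    using conf by (auto simp: spherical_configuration_def)
  have sphere: "inj_on (P t) {..<m}"
    "\<And>is. length is = Suc k \<Longrightarrow> set is \<subseteq> {..<m} \<Longrightarrow> weight_det a is \<noteq> 0 \<Longrightarrow> face r (P t ` set is)"
    "\<And>T. T \<subseteq> {..<m} \<Longrightarrow> card T = k + 2 \<Longrightarrow> \<not> face r (P t ` T)" if t: "t \<in> S" for t
  proof -
    have "\<forall>j<m. dist (P t j) (center (fst t) + r *\<^sub>R u j) < \<eta> * r"
      using near[of "fst t" "snd t"] t by (simp add: P_def)
    then have "inj_on (P t) {..<m} \<and>
        (\<forall>is. length is = Suc k \<longrightarrow> set is \<subseteq> {..<m} \<longrightarrow> weight_det a is \<noteq> 0 \<longrightarrow> face r (P t ` set is)) \<and>
        (\<forall>T \<subseteq> {..<m}. card T = k + 2 \<longrightarrow> \<not> face r (P t ` T))"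
      using conf r unfolding spherical_configuration_def by blast
    then show "inj_on (P t) {..<m}"
      "\<And>is. length is = Suc k \<Longrightarrow> set is \<subseteq> {..<m} \<Longrightarrow> weight_det a is \<noteq> 0 \<Longrightarrow> face r (P t ` set is)"
      "\<And>T. T \<subseteq> {..<m} \<Longrightarrow> card T = k + 2 \<Longrightarrow> \<not> face r (P t ` T)" by auto
  qed
  have ind: "ind t (P t j) = j" if "t \<in> S" "j < m" for t j
    unfolding ind_def by (rule inv_into_f_f[OF sphere(1)[OF that(1)]]) (use that in simp)
  have V_A: "V t \<subseteq> p ` A" if "t \<in> S" for t
    using blocks(1)[of "fst t" "snd t"] blocks(3) that by (fastforce simp: V_def P_def PiE_def Pi_def)
  have V_cell: "V t \<subseteq> cell (fst t)" if "t \<in> S" for t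
    using inside[of "fst t" "snd t"] that r by (auto simp: V_def P_def)
  have V_disjoint: "V s \<inter> V t = {}" if st: "s \<in> S" "t \<in> S" "s \<noteq> t" for s t
  proof (cases "fst s = fst t")
    case False
    then show ?thesis using cells V_cell[OF st(1)] V_cell[OF st(2)] by blast
  next
    case True
    have "snd s j = snd t j" if j: "j < m" for j
    proof -
      have s_block: "snd s j \<in> block j" and t_block: "snd t i \<in> block i" if "i < m" for i
        using blocks(1)[of "fst s" "snd s"] blocks(1)[of "fst t" "snd t"] st j that by auto
      have "p (snd s j) \<in> cell (fst t)"
        using V_cell[OF st(1)] j True by (auto simp: V_def P_def)
      moreover have "snd s j \<in> A" using s_block[OF j] blocks(3)[OF j] by blast
      ultimately have "snd s j \<in> snd t ` {..<m}"
        using isolated[of "fst t" "snd t" "snd s j"] st(2) by auto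
      then obtain i where i: "i < m" "snd s j = snd t i" by auto
      then have "i = j" using blocks(2)[OF i(1) j] s_block[OF j] t_block[OF i(1)] by auto
      then show ?thesis using i by simp
    qed
    then have "snd s = snd t"
      using blocks(1)[of "fst s" "snd s"] blocks(1)[of "fst t" "snd t"] st
      by (intro PiE_ext[of _ "{..<m}" block]) auto
    then show ?thesis using True st(3) by (simp add: prod_eq_iff)
  qed
  show ?thesis
  proof (rule card_le_betti[OF simplicial_face_complex _ S, of _ _ _ zc apex])
    show "finite (simplex_lists ?K k)"
      using A face_complex_subset by (intro finite_simplex_lists[of "p ` A"]) auto
    fix t assume t: "t \<in> S"
    have Vi: "P t (ind t y) = y" "ind t y < m" if "y \<in> V t" for y
      using that ind[OF t] by (auto simp: V_def)
    show "zc t \<in> cycles ?K k"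
      unfolding zc_def
    proof (rule det_chain_cycle)
      show "finite (V t)" by (simp add: V_def)
      show "(\<Sum>y\<in>V t. a (ind t y) l) = 0" if "l \<le> k" for l
      proof -
        have "(\<Sum>y\<in>V t. a (ind t y) l) = (\<Sum>j<m. a (ind t (P t j)) l)"
          unfolding V_def using sum.reindex[OF sphere(1)[OF t]] by simp
        also have "\<dots> = (\<Sum>j<m. a j l)" using ind[OF t] by simp
        finally show ?thesis using sum0[OF that] by simp
      qed
      fix ws assume ws: "length ws = Suc k" "set ws \<subseteq> V t" "weight_det (\<lambda>y. a (ind t y)) ws \<noteq> 0"
      have "P t ` set (map (ind t) ws) = set ws"
        using ws(2) Vi(1) by (force simp: image_image)
      moreover have "set (map (ind t) ws) \<subseteq> {..<m}" using ws(2) Vi(2) by auto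
      ultimately have "face r (set ws)"
        using sphere(2)[OF t, of "map (ind t) ws"] ws by (simp add: weight_det_map)
      then show "set ws \<in> ?K"
        using ws V_A[OF t] by (auto simp: face_complex_def)
    qed
    have apex_V: "set (apex t) \<subseteq> V t" "length (apex t) = Suc k"
      using js by (auto simp: apex_def V_def)
    have "map (ind t) (apex t) = js"
      using js(2) ind[OF t] by (auto simp: apex_def intro!: map_idI)
    then have "weight_det (\<lambda>y. a (ind t y)) (apex t) = weight_det a js"
      using weight_det_map[of a "ind t" "apex t"] by simp
    then show "zc t (apex t) \<noteq> 0"
      using js apex_V by (simp add: zc_def det_chain_def)
    show "zc s (apex t) = 0" if "s \<in> S" "s \<noteq> t" for s
    proof -
      have "\<not> set (apex t) \<subseteq> V s"
        using V_disjoint[OF that(1) t that(2)] apex_V by (cases "apex t") auto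
      then show ?thesis by (simp add: zc_def det_chain_def)
    qed
    fix \<sigma> assume \<sigma>: "\<sigma> \<in> ?K" "set (apex t) \<subseteq> \<sigma>"
    show "card \<sigma> \<noteq> k + 2"
    proof
      assume card: "card \<sigma> = k + 2"
      have "\<sigma> \<subseteq> V t"
      proof
        fix y assume y: "y \<in> \<sigma>"
        have j0: "hd js \<in> set js" using js(1) by (cases js) auto
        then have "P t (hd js) \<in> \<sigma>" using \<sigma>(2) by (auto simp: apex_def)
        then have "dist (p (snd t (hd js))) y \<le> r"
          using \<sigma>(1) y face_dist by (auto simp: face_complex_def P_def)
        then have "y \<in> cell (fst t)"
          using inside[of "fst t" "snd t" "hd js" y] t j0 js(2) by auto
        moreover obtain i where i: "i \<in> A" "y = p i" using \<sigma>(1) y by (auto simp: face_complex_def)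
        ultimately have "i \<in> snd t ` {..<m}" using isolated[of "fst t" "snd t" i] t by auto
        then show "y \<in> V t" using i by (auto simp: V_def P_def)
      qed
      then obtain T where T: "T \<subseteq> {..<m}" "\<sigma> = P t ` T"
        unfolding V_def by (meson subset_imageE)
      have "card T = k + 2"
        using card card_image[OF inj_on_subset[OF sphere(1)[OF t] T(1)]] T(2) by simp
      then show False using sphere(3)[OF t T(1)] \<sigma>(1) T(2) by (auto simp: face_complex_def)
    qed
  qed
qed

section \<open>Expected Betti numbers\<close>

locale random_geometric_complex = random_points M x f bd + geometric_faces face
  for M :: "'w measure" and x :: "nat \<Rightarrow> 'w \<Rightarrow> real ^ 'd::finite" and f and bd
    and face :: "real \<Rightarrow> (real ^ 'd) set \<Rightarrow> bool" +
  assumes face_measurable: "finite I \<Longrightarrow> I \<subseteq> {1..} \<Longrightarrow>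
    {\<omega> \<in> space M. face r ((\<lambda>i. x i \<omega>) ` I)} \<in> events"
begin

abbreviation random_betti :: "'f::field itself \<Rightarrow> nat \<Rightarrow> real \<Rightarrow> nat \<Rightarrow> 'w \<Rightarrow> nat" where
  "random_betti F n r k \<omega> \<equiv> betti F (face_complex face ((\<lambda>i. x i \<omega>) ` {1..n}) r) k"

lemma random_betti_measurable: "(\<lambda>\<omega>. real (random_betti F n r k \<omega>)) \<in> borel_measurable M"
proof (rule betti_measurable)
  show "x i \<in> borel_measurable M" if "i \<in> {1..n}" for i
    using that by (intro point_borel) simp
  show "{\<omega> \<in> space M. face r ((\<lambda>i. x i \<omega>) ` I)} \<in> events" if "I \<subseteq> {1..n}" for I
    using that by (intro face_measurable) (auto intro: finite_subset)
qed

definition index_lists :: "nat \<Rightarrow> nat \<Rightarrow> nat list set" where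
  "index_lists n k = {is. distinct is \<and> length is = Suc k \<and> set is \<subseteq> {1..n}}"

lemma finite_index_lists: "finite (index_lists n k)"
  by (rule finite_subset[OF _ finite_lists_length_eq[of "{1..n}" "Suc k"]]) (auto simp: index_lists_def)

lemma card_index_lists: "card (index_lists n k) \<le> n ^ Suc k"
proof -
  have "card (index_lists n k) \<le> card {is. set is \<subseteq> {1..n} \<and> length is = Suc k}"
    by (rule card_mono[OF finite_lists_length_eq]) (auto simp: index_lists_def)
  then show ?thesis by (simp add: card_lists_length_eq)
qed

definition close_event :: "real \<Rightarrow> nat list \<Rightarrow> 'w set" where
  "close_event r is = {\<omega> \<in> space M. \<forall>i\<in>set is. dist (x i \<omega>) (x (hd is) \<omega>) \<le> r}"

lemma close_event_events:
  assumes "is \<in> index_lists n k"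
  shows "close_event r is \<in> events"
  unfolding close_event_def
proof (rule sets.sets_Collect_finite_All)
  fix i assume i: "i \<in> set is"
  have "hd is \<in> set is" using assms by (cases "is") (auto simp: index_lists_def)
  then have [measurable]: "x i \<in> borel_measurable M" "x (hd is) \<in> borel_measurable M"
    using assms i by (auto simp: index_lists_def intro!: point_borel)
  show "{\<omega> \<in> space M. dist (x i \<omega>) (x (hd is) \<omega>) \<le> r} \<in> events" by measurable
qed simp

text \<open>
The vertices of a face are within distance \<open>r\<close> of each other, so every list of them comes from a
list of indices whose close event occurs.
\<close>

lemma random_betti_le:
  assumes "\<omega> \<in> space M"
  shows "real (random_betti F n r k \<omega>) \<le> (\<Sum>is\<in>index_lists n k. indicator (close_event r is) \<omega>)"
proof -
  let ?K = "face_complex face ((\<lambda>i. x i \<omega>) ` {1..n}) r"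
  let ?L = "{is \<in> index_lists n k. \<omega> \<in> close_event r is}"
  have fin: "finite (simplex_lists ?K k)"
    using face_complex_subset by (intro finite_simplex_lists[of "(\<lambda>i. x i \<omega>) ` {1..n}"]) auto
  have "simplex_lists ?K k \<subseteq> map (\<lambda>i. x i \<omega>) ` ?L"
  proof
    fix vs assume vs: "vs \<in> simplex_lists ?K k"
    then have "set vs \<subseteq> (\<lambda>i. x i \<omega>) ` {1..n}" "face r (set vs)" "distinct vs" "length vs = Suc k"
      by (auto simp: simplex_lists_def face_complex_def)
    moreover define "is" where "is = map (inv_into {1..n} (\<lambda>i. x i \<omega>)) vs"
    moreover have "is": "set is \<subseteq> {1..n}" "vs = map (\<lambda>i. x i \<omega>) is"
    proof -
      show "set is \<subseteq> {1..n}"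
        using calculation(1) unfolding is_def by (auto dest!: subsetD intro: inv_into_into)
      have "x (inv_into {1..n} (\<lambda>i. x i \<omega>) v) \<omega> = v" if "v \<in> set vs" for v
        using calculation(1) that f_inv_into_f[of v "\<lambda>i. x i \<omega>" "{1..n}"] by blast
      then show "vs = map (\<lambda>i. x i \<omega>) is" by (simp add: is_def map_idI)
    qed
    moreover have "distinct is" using \<open>distinct vs\<close> unfolding "is"(2) distinct_map by blast
    moreover have "length is = Suc k" using \<open>length vs = Suc k\<close> unfolding is_def by simp
    ultimately have L: "is \<in> index_lists n k" unfolding index_lists_def by blast
    then have hd: "hd is \<in> set is" by (cases "is") (auto simp: index_lists_def)
    have "\<omega> \<in> close_event r is"
      using assms face_dist[OF \<open>face r (set vs)\<close>] hd by (auto simp: close_event_def "is"(2))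
    then show "vs \<in> map (\<lambda>i. x i \<omega>) ` ?L" using L "is"(2) by auto
  qed
  then have "card (simplex_lists ?K k) \<le> card ?L"
    using finite_index_lists by (intro surj_card_le) auto
  then have "real (random_betti F n r k \<omega>) \<le> real (card ?L)"
    using betti_le[OF simplicial_face_complex fin, of F] by linarith
  also have "\<dots> = (\<Sum>is\<in>index_lists n k. indicator (close_event r is) \<omega>)"
    using finite_index_lists by (simp add: indicator_def sum.If_cases Int_def conj_commute)
  finally show ?thesis .
qed

lemma random_betti_integrable: "integrable M (\<lambda>\<omega>. real (random_betti F n r k \<omega>))"
proof (rule integrable_const_bound)
  show "AE \<omega> in M. norm (real (random_betti F n r k \<omega>)) \<le> real (card (index_lists n k))"
  proof (rule AE_I2)
    fix \<omega> assume "\<omega> \<in> space M"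
    then have "real (random_betti F n r k \<omega>) \<le> (\<Sum>is\<in>index_lists n k. indicator (close_event r is) \<omega>)"
      by (rule random_betti_le)
    also have "\<dots> \<le> (\<Sum>is\<in>index_lists n k. 1)" by (intro sum_mono) (auto simp: indicator_def)
    finally show "norm (real (random_betti F n r k \<omega>)) \<le> real (card (index_lists n k))" by simp
  qed
qed (rule random_betti_measurable)

lemma expectation_random_betti_le:
  assumes r: "0 < r"
  shows "expectation (\<lambda>\<omega>. real (random_betti F n r k \<omega>)) \<le> real n ^ Suc k * (bd * (3 * r) ^ CARD('d)) ^ k"
proof -
  let ?C = "(bd * (3 * r) ^ CARD('d)) ^ k"
  have C: "0 \<le> ?C" using bd_nonneg r by simp
  have int: "integrable M (indicator (close_event r is) :: 'w \<Rightarrow> real)" if "is \<in> index_lists n k" for "is"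
    by (rule integrable_real_indicator[OF close_event_events[OF that]]) (simp add: emeasure_eq_measure)
  have "expectation (\<lambda>\<omega>. real (random_betti F n r k \<omega>))
      \<le> expectation (\<lambda>\<omega>. \<Sum>is\<in>index_lists n k. indicator (close_event r is) \<omega>)"
    by (intro integral_mono random_betti_integrable Bochner_Integration.integrable_sum int random_betti_le)
  also have "\<dots> = (\<Sum>is\<in>index_lists n k. prob (close_event r is))"
    using close_event_events int by (subst Bochner_Integration.integral_sum) (auto intro!: sum.cong)
  also have "\<dots> \<le> (\<Sum>is\<in>index_lists n k. ?C)"
  proof (rule sum_mono)
    fix "is" assume "is \<in> index_lists n k"
    then show "prob (close_event r is) \<le> ?C"
      unfolding close_event_def by (intro prob_close_le r) (auto simp: index_lists_def)
  qed
  also have "\<dots> = real (card (index_lists n k)) * ?C" by simp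
  also have "\<dots> \<le> real (n ^ Suc k) * ?C"
    using card_index_lists C by (intro mult_right_mono of_nat_mono)
  finally show ?thesis by simp
qed

lemma near_cell_center:
  assumes u: "norm u \<le> U" and r: "0 < r" "r * (1 + \<eta> + U) < s / 2"
    and y: "dist y (cell_center s z + r *\<^sub>R u) < \<eta> * r" "dist y y' \<le> r"
  shows "y' \<in> grid_cell s z"
proof (rule mem_grid_cell_if_close)
  have "dist (cell_center s z + r *\<^sub>R u) (cell_center s z) = r * norm u"
    using r(1) by (simp add: dist_norm)
  moreover have "r * norm u \<le> r * U" using u r(1) by (intro mult_left_mono) auto
  moreover have "dist y' (cell_center s z) \<le> dist y y' + dist y (cell_center s z + r *\<^sub>R u)
      + dist (cell_center s z + r *\<^sub>R u) (cell_center s z)"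
    using dist_triangle3[of y' "cell_center s z" y] dist_triangle[of y "cell_center s z" "cell_center s z + r *\<^sub>R u"]
    by linarith
  ultimately have "dist y' (cell_center s z) < r + \<eta> * r + r * U" using y by linarith
  also have "\<dots> = r * (1 + \<eta> + U)" by (simp add: algebra_simps)
  also note r(2)
  finally show "dist y' (cell_center s z) < s / 2" .
qed

text \<open>
With \<open>q = n div m\<close> the blocks \<open>0, \<dots>, m - 1\<close> are disjoint subsets of the indices
\<open>1, \<dots>, n\<close>. The choices of one index from each block number \<open>q ^ m\<close>, which is still of
order \<open>n ^ m\<close>.
\<close>

definition index_block :: "nat \<Rightarrow> nat \<Rightarrow> nat set" where
  "index_block q j = {Suc (j * q)..Suc j * q}"

lemma index_block_disjoint:
  assumes "index_block q i \<inter> index_block q j \<noteq> {}"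
  shows "i = j"
proof -
  obtain l where "l \<in> index_block q i" "l \<in> index_block q j" using assms by blast
  then have l: "Suc (i * q) \<le> l" "l \<le> Suc i * q" "Suc (j * q) \<le> l" "l \<le> Suc j * q"
    by (simp_all add: index_block_def)
  have "i * q < Suc j * q" "j * q < Suc i * q" using l by linarith+
  then have "i < Suc j" "j < Suc i" by (simp_all only: mult_less_cancel2)
  then show ?thesis by simp
qed

lemma index_block_subset: "j < m \<Longrightarrow> index_block (n div m) j \<subseteq> {1..n}"
proof -
  assume "j < m"
  then have "Suc j * (n div m) \<le> m * (n div m)" by (intro mult_le_mono1) simp
  also have "\<dots> \<le> n" by simp
  finally show ?thesis by (auto simp: index_block_def)
qed

definition sphere_event ::
  "nat \<Rightarrow> nat \<Rightarrow> (nat \<Rightarrow> real ^ 'd) \<Rightarrow> real \<Rightarrow> real \<Rightarrow> real \<Rightarrow> (int ^ 'd) \<times> (nat \<Rightarrow> nat) \<Rightarrow> 'w set" where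
  "sphere_event n m u \<eta> r s t = {\<omega> \<in> space M.
     (\<forall>j<m. dist (x (snd t j) \<omega>) (cell_center s (fst t) + r *\<^sub>R u j) < \<eta> * r) \<and>
     (\<forall>i\<in>{1..n} - snd t ` {..<m}. x i \<omega> \<notin> grid_cell s (fst t))}"

lemma card_sphere_events_le:
  fixes F :: "'f::field itself" and a :: "nat \<Rightarrow> nat \<Rightarrow> 'f"
  assumes conf: "spherical_configuration face k m u \<eta> a js"
    and u: "\<And>j. j < m \<Longrightarrow> norm (u j) \<le> U" and r: "0 < r" "r * (1 + \<eta> + U) < s / 2" and s: "0 < s"
    and G: "finite G"
  shows "card {t \<in> G \<times> (\<Pi>\<^sub>E j\<in>{..<m}. index_block (n div m) j). \<omega> \<in> sphere_event n m u \<eta> r s t}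
    \<le> random_betti F n r k \<omega>" (is "card ?S \<le> _")
proof (rule card_isolated_spheres_le_betti[OF conf r(1), where block = "index_block (n div m)"
      and cell = "grid_cell s" and center = "cell_center s"])
  have "finite (G \<times> (\<Pi>\<^sub>E j\<in>{..<m}. index_block (n div m) j))"
    using G by (intro finite_cartesian_product finite_PiE) (auto simp: index_block_def)
  then show "finite ?S" by simp
  show "index_block (n div m) j \<subseteq> {1..n}" if "j < m" for j
    by (rule index_block_subset[OF that])
  show "i = j" if "i < m" "j < m" "index_block (n div m) i \<inter> index_block (n div m) j \<noteq> {}" for i j
    using index_block_disjoint that(3) by blast
  show "grid_cell s z \<inter> grid_cell s z' = {}" if "z \<noteq> z'" for z z' :: "int ^ 'd"
    by (rule grid_cells_disjoint[OF s that])
  fix z \<tau> assume t: "(z, \<tau>) \<in> ?S"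
  show "\<tau> \<in> (\<Pi>\<^sub>E j\<in>{..<m}. index_block (n div m) j)" using t by blast
  show near: "dist (x (\<tau> j) \<omega>) (cell_center s z + r *\<^sub>R u j) < \<eta> * r" if "j < m" for j
    using t that by (auto simp: sphere_event_def)
  show "y \<in> grid_cell s z" if "j < m" "dist (x (\<tau> j) \<omega>) y \<le> r" for j y
    by (rule near_cell_center[OF u[OF that(1)] r near[OF that(1)] that(2)])
  show "x i \<omega> \<notin> grid_cell s z" if "i \<in> {1..n}" "i \<notin> \<tau> ` {..<m}" for i
    using t that by (auto simp: sphere_event_def)
qed simp

text \<open>
The event prescribes a set for each point separately, so its probability is a product. Here
\<open>g\<close> is a lower bound for the mass near each of the \<open>m\<close> places: the ball there lies in the
cell, of which only the volume \<open>\<epsilon>\<close> is outside \<open>K\<close>.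
\<close>

lemma sphere_event_prob:
  assumes u: "\<And>j. j < m \<Longrightarrow> norm (u j) \<le> U" and r: "0 < r" "r * (1 + \<eta> + U) < s / 2" and s: "0 < s"
    and \<eta>: "0 < \<eta>"
    and K: "K \<in> sets borel" "0 \<le> \<delta>" "\<And>v. v \<in> K \<Longrightarrow> \<delta> \<le> f v"
    and z: "measure lborel (grid_cell s z - K) \<le> \<epsilon>"
    and \<tau>: "\<tau> \<in> (\<Pi>\<^sub>E j\<in>{..<m}. index_block (n div m) j)"
    and g: "0 \<le> g" "g \<le> \<delta> * (measure lborel (ball (0 :: real ^ 'd) (\<eta> * r)) - \<epsilon>)"
    and small: "bd * s ^ CARD('d) \<le> 1"
  shows "sphere_event n m u \<eta> r s (z, \<tau>) \<in> events"
    and "g ^ m * (1 - bd * s ^ CARD('d)) ^ n \<le> prob (sphere_event n m u \<eta> r s (z, \<tau>))"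
proof -
  let ?T = "\<tau> ` {..<m}"
  let ?B = "\<lambda>j. ball (cell_center s z + r *\<^sub>R u j) (\<eta> * r)"
  have \<tau>_block: "\<tau> j \<in> index_block (n div m) j" if "j < m" for j
    using \<tau> that by auto
  have inj: "inj_on \<tau> {..<m}"
  proof (rule inj_onI)
    fix i j assume "i \<in> {..<m}" "j \<in> {..<m}" "\<tau> i = \<tau> j"
    then show "i = j" using \<tau>_block[of i] \<tau>_block[of j] index_block_disjoint[of "n div m" i j] by auto
  qed
  have T: "?T \<subseteq> {1..n}" using \<tau>_block index_block_subset by blast
  \<comment> \<open>The set to which the event confines the point number \<open>i\<close>.\<close>
  define S where "S = (\<lambda>i. if i \<in> ?T then ?B (inv_into {..<m} \<tau> i) else - grid_cell s z)"
  have S\<tau>: "S (\<tau> j) = ?B j" if "j < m" for j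
    using that inj by (simp add: S_def)
  have S_borel: "S i \<in> sets borel" for i by (simp add: S_def)
  have "(\<forall>i\<in>{1..n}. x i \<omega> \<in> S i) \<longleftrightarrow> (\<forall>j<m. dist (x (\<tau> j) \<omega>) (cell_center s z + r *\<^sub>R u j) < \<eta> * r)
      \<and> (\<forall>i\<in>{1..n} - ?T. x i \<omega> \<notin> grid_cell s z)" for \<omega>
  proof -
    have "(\<forall>i\<in>{1..n}. x i \<omega> \<in> S i) \<longleftrightarrow> (\<forall>i\<in>?T. x i \<omega> \<in> S i) \<and> (\<forall>i\<in>{1..n} - ?T. x i \<omega> \<in> S i)"
      using T by blast
    also have "(\<forall>i\<in>?T. x i \<omega> \<in> S i) \<longleftrightarrow> (\<forall>j<m. x (\<tau> j) \<omega> \<in> S (\<tau> j))"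
      by auto
    also have "\<dots> \<longleftrightarrow> (\<forall>j<m. dist (x (\<tau> j) \<omega>) (cell_center s z + r *\<^sub>R u j) < \<eta> * r)"
      using S\<tau> by (simp add: dist_commute)
    also have "(\<forall>i\<in>{1..n} - ?T. x i \<omega> \<in> S i) \<longleftrightarrow> (\<forall>i\<in>{1..n} - ?T. x i \<omega> \<notin> grid_cell s z)"
      by (simp add: S_def)
    finally show ?thesis .
  qed
  then have event: "sphere_event n m u \<eta> r s (z, \<tau>) = {\<omega> \<in> space M. \<forall>i\<in>{1..n}. x i \<omega> \<in> S i}"
    by (simp add: sphere_event_def)
  show "sphere_event n m u \<eta> r s (z, \<tau>) \<in> events"
    unfolding event by (rule events_points) (auto simp: S_borel)
  have cell: "measure law (grid_cell s z) \<le> bd * s ^ CARD('d)"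
    using law_le[OF grid_cell_fmeasurable[OF s]] by (simp add: measure_grid_cell[OF s])
  have ball: "g \<le> measure law (?B j)" if j: "j < m" for j
  proof -
    have sub: "?B j \<subseteq> grid_cell s z"
      using near_cell_center[OF u[OF j] r, of _ z] r(1) by (auto simp: dist_commute)
    have "measure lborel (?B j - K) \<le> measure lborel (grid_cell s z - K)"
      using sub K(1) grid_cell_fmeasurable[OF s, of z] by (intro measure_mono_fmeasurable fmeasurable_Diff) auto
    then have "measure lborel (?B j - K) \<le> \<epsilon>" using z by simp
    moreover have "measure lborel (?B j) = measure lborel (ball (0 :: real ^ 'd) (\<eta> * r))"
      using \<eta> r(1) by (simp add: content_ball)
    ultimately have "\<delta> * (measure lborel (ball (0 :: real ^ 'd) (\<eta> * r)) - \<epsilon>)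
        \<le> \<delta> * (measure lborel (?B j) - measure lborel (?B j - K))"
      using K(2) by (intro mult_left_mono) auto
    also have "\<dots> \<le> measure law (?B j)" by (rule law_ge) (use K in \<open>auto intro: fmeasurableI emeasure_lborel_ball_finite\<close>)
    finally show ?thesis using g(2) by simp
  qed
  let ?h = "1 - bd * s ^ CARD('d)"
  have h: "0 \<le> ?h" "?h \<le> 1" using small bd_nonneg s by auto
  have "prob (sphere_event n m u \<eta> r s (z, \<tau>)) = (\<Prod>i\<in>{1..n}. measure law (S i))"
    unfolding event by (rule prob_points) (auto simp: S_borel)
  also have "\<dots> = (\<Prod>i\<in>{1..n} - ?T. measure law (S i)) * (\<Prod>i\<in>?T. measure law (S i))"
    by (rule prod.subset_diff[OF T]) simp
  also have "(\<Prod>i\<in>?T. measure law (S i)) = (\<Prod>j<m. measure law (?B j))"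
    using S\<tau> by (simp add: prod.reindex[OF inj])
  finally have prob_eq: "prob (sphere_event n m u \<eta> r s (z, \<tau>))
      = (\<Prod>i\<in>{1..n} - ?T. measure law (S i)) * (\<Prod>j<m. measure law (?B j))" .
  have "g ^ m = (\<Prod>j<m. g)" by simp
  also have "\<dots> \<le> (\<Prod>j<m. measure law (?B j))" by (intro prod_mono conjI g(1) ball) auto
  finally have 1: "g ^ m \<le> (\<Prod>j<m. measure law (?B j))" .
  have "?h ^ n \<le> ?h ^ card ({1..n} - ?T)"
    using card_mono[of "{1..n}" "{1..n} - ?T"] h by (intro power_decreasing) auto
  also have "\<dots> = (\<Prod>i\<in>{1..n} - ?T. ?h)" by simp
  also have "\<dots> \<le> (\<Prod>i\<in>{1..n} - ?T. measure law (S i))"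
  proof (intro prod_mono conjI h(1))
    fix i assume "i \<in> {1..n} - ?T"
    then have "measure law (S i) = 1 - measure law (grid_cell s z)"
      using law.prob_compl[of "grid_cell s z"] by (simp add: S_def Compl_eq_Diff_UNIV law_def)
    then show "?h \<le> measure law (S i)" using cell by simp
  qed
  finally have 2: "?h ^ n \<le> (\<Prod>i\<in>{1..n} - ?T. measure law (S i))" .
  have "g ^ m * ?h ^ n = ?h ^ n * g ^ m" by simp
  also have "\<dots> \<le> prob (sphere_event n m u \<eta> r s (z, \<tau>))"
    unfolding prob_eq using 1 2 g(1) h(1) by (intro mult_mono prod_nonneg zero_le_power) auto
  finally show "g ^ m * ?h ^ n \<le> prob (sphere_event n m u \<eta> r s (z, \<tau>))" .
qed

lemma expectation_random_betti_ge:
  fixes F :: "'f::field itself" and a :: "nat \<Rightarrow> nat \<Rightarrow> 'f"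
  assumes conf: "spherical_configuration face k m u \<eta> a js"
    and u: "\<And>j. j < m \<Longrightarrow> norm (u j) \<le> U" and r: "0 < r" "r * (1 + \<eta> + U) < s / 2" and s: "0 < s"
    and K: "K \<in> sets borel" "0 \<le> \<delta>" "\<And>v. v \<in> K \<Longrightarrow> \<delta> \<le> f v"
    and G: "finite G" "\<And>z. z \<in> G \<Longrightarrow> measure lborel (grid_cell s z - K) \<le> \<epsilon>"
    and g: "0 \<le> g" "g \<le> \<delta> * (measure lborel (ball (0 :: real ^ 'd) (\<eta> * r)) - \<epsilon>)"
    and small: "bd * s ^ CARD('d) \<le> 1"
  shows "real (card G) * (real (n div m) * g) ^ m * (1 - bd * s ^ CARD('d)) ^ n
    \<le> expectation (\<lambda>\<omega>. real (random_betti F n r k \<omega>))"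
proof -
  let ?R = "G \<times> (\<Pi>\<^sub>E j\<in>{..<m}. index_block (n div m) j)"
  let ?c = "g ^ m * (1 - bd * s ^ CARD('d)) ^ n"
  have \<eta>: "0 < \<eta>" using conf by (simp add: spherical_configuration_def)
  have fin: "finite ?R"
    using G(1) by (intro finite_cartesian_product finite_PiE) (auto simp: index_block_def)
  have card: "card ?R = card G * (n div m) ^ m"
    by (simp add: card_cartesian_product card_PiE index_block_def)
  have ev: "sphere_event n m u \<eta> r s t \<in> events" "?c \<le> prob (sphere_event n m u \<eta> r s t)" if "t \<in> ?R" for t
    using sphere_event_prob[OF u r s \<eta> K G(2) _ g small, where z = "fst t" and \<tau> = "snd t" and n = n] that by auto
  have int: "integrable M (indicator (sphere_event n m u \<eta> r s t) :: 'w \<Rightarrow> real)" if "t \<in> ?R" for t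
    by (rule integrable_real_indicator[OF ev(1)[OF that]]) (simp add: emeasure_eq_measure)
  have "real (card G) * (real (n div m) * g) ^ m * (1 - bd * s ^ CARD('d)) ^ n = (\<Sum>t\<in>?R. ?c)"
    by (simp only: sum_constant card) (simp add: power_mult_distrib)
  also have "\<dots> \<le> (\<Sum>t\<in>?R. prob (sphere_event n m u \<eta> r s t))"
    by (intro sum_mono ev(2))
  also have "\<dots> = expectation (\<lambda>\<omega>. \<Sum>t\<in>?R. indicator (sphere_event n m u \<eta> r s t) \<omega>)"
    using ev(1) int by (subst Bochner_Integration.integral_sum) (auto intro!: sum.cong)
  also have "\<dots> \<le> expectation (\<lambda>\<omega>. real (random_betti F n r k \<omega>))"
  proof (intro integral_mono random_betti_integrable Bochner_Integration.integrable_sum int)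
    fix \<omega>
    have "(\<Sum>t\<in>?R. indicator (sphere_event n m u \<eta> r s t) \<omega>)
        = real (card {t \<in> ?R. \<omega> \<in> sphere_event n m u \<eta> r s t})"
      using fin by (simp add: indicator_def sum.If_cases Int_def)
    also have "\<dots> \<le> real (random_betti F n r k \<omega>)"
      using card_sphere_events_le[OF conf u r s G(1), where n = n] by (rule of_nat_mono)
    finally show "(\<Sum>t\<in>?R. indicator (sphere_event n m u \<eta> r s t) \<omega>) \<le> real (random_betti F n r k \<omega>)" .
  qed
  finally show ?thesis .
qed

text \<open>
With \<open>r^d\<close> of order \<open>1/n\<close>, the two bounds for the expectation become constants times
\<open>n\<close>: in the lower bound there are at least of order \<open>1 / s^d\<close>, that is of order \<open>n\<close>,
good cells, the factors \<open>real (n div m) * g\<close> are bounded below, and the last factor is at least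
\<open>(1 - L / n) ^ n\<close>, which tends to \<open>exp (- L)\<close>.
\<close>

lemma expected_betti_bigtheta:
  fixes F :: "'f::field itself" and a :: "nat \<Rightarrow> nat \<Rightarrow> 'f" and r :: "nat \<Rightarrow> real"
  assumes conf: "spherical_configuration face k m u \<eta> a js"
    and r_pos: "\<And>n. 1 \<le> n \<Longrightarrow> 0 < r n"
    and r_theta: "r \<in> \<Theta>(\<lambda>n. real n powr (- 1 / real CARD('d)))"
  shows "(\<lambda>n. expectation (\<lambda>\<omega>. real (random_betti F n (r n) k \<omega>))) \<in> \<Theta>(\<lambda>n. real n)"
proof -
  let ?d = "CARD('d)"
  let ?E = "\<lambda>n. expectation (\<lambda>\<omega>. real (random_betti F n (r n) k \<omega>))"
  obtain c1 where c1: "0 < c1" "\<forall>\<^sub>F n in at_top. norm (r n) \<ge> c1 * norm (real n powr (- 1 / real ?d))"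
    using landau_omega.bigE[OF bigthetaD2[OF r_theta]] by blast
  obtain c2 where c2: "0 < c2" "\<forall>\<^sub>F n in at_top. norm (r n) \<le> c2 * norm (real n powr (- 1 / real ?d))"
    using landau_o.bigE[OF bigthetaD1[OF r_theta]] by blast
  define A B where "A = c1 ^ ?d" and "B = c2 ^ ?d"
  have AB: "0 < A" "0 < B" using c1(1) c2(1) by (simp_all add: A_def B_def)
  have rd: "\<forall>\<^sub>F n in at_top. A / real n \<le> r n ^ ?d \<and> r n ^ ?d \<le> B / real n"
    using c1(2) c2(2) eventually_ge_at_top[of 1]
  proof eventually_elim
    case (elim n)
    have "(real n powr (- (1 / real ?d))) ^ ?d = real n powr (real ?d * - (1 / real ?d))"
      by (rule powr_power) (use elim(3) in simp)
    then have pw: "(real n powr (- (1 / real ?d))) ^ ?d = 1 / real n"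
      using elim(3) by (simp add: powr_minus_divide)
    have "(c1 * real n powr (- 1 / real ?d)) ^ ?d \<le> r n ^ ?d"
      using elim(1) c1(1) r_pos[OF elim(3)] by (intro power_mono) auto
    moreover have "r n ^ ?d \<le> (c2 * real n powr (- 1 / real ?d)) ^ ?d"
      using elim(2) c2(1) r_pos[OF elim(3)] by (intro power_mono) auto
    ultimately show ?case by (simp add: power_mult_distrib pw A_def B_def)
  qed
  \<comment> \<open>The added \<open>1\<close> makes the constant visibly positive.\<close>
  have upper: "\<forall>\<^sub>F n in at_top. ?E n \<le> ((bd * 3 ^ ?d * B) ^ k + 1) * real n"
    using rd eventually_ge_at_top[of 1]
  proof eventually_elim
    case (elim n)
    have n: "0 < real n" using elim(2) by simp
    have "bd * (3 * r n) ^ ?d \<le> bd * 3 ^ ?d * B / real n"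
      using elim(1) bd_nonneg mult_left_mono[of "r n ^ ?d" "B / real n" "bd * 3 ^ ?d"]
      by (simp add: power_mult_distrib mult.assoc)
    then have "(bd * (3 * r n) ^ ?d) ^ k \<le> (bd * 3 ^ ?d * B / real n) ^ k"
      using bd_nonneg r_pos[OF elim(2)] by (intro power_mono) auto
    then have "?E n \<le> real n ^ Suc k * (bd * 3 ^ ?d * B / real n) ^ k"
      using expectation_random_betti_le[OF r_pos[OF elim(2)], of F n k]
      by (elim order_trans) (intro mult_left_mono, auto)
    also have "\<dots> = (bd * 3 ^ ?d * B) ^ k * real n" using n by (simp add: power_divide)
    also have "\<dots> \<le> ((bd * 3 ^ ?d * B) ^ k + 1) * real n" using n by (intro mult_right_mono) auto
    finally show ?case .
  qed
  obtain K \<delta> where K: "compact K" "0 < measure lborel K" "0 < \<delta>" "\<And>v. v \<in> K \<Longrightarrow> \<delta> \<le> f v"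
    using density_large_on_compact[OF f_borel] prob_space_law unfolding law_def by blast
  have Kb: "K \<in> sets borel" using K(1) by (simp add: borel_compact)
  have \<eta>: "0 < \<eta>" and m: "0 < m"
    using conf by (auto simp: spherical_configuration_def intro: gr0I)
  define U where "U = (\<Sum>j<m. norm (u j))"
  have U: "norm (u j) \<le> U" if "j < m" for j
    unfolding U_def using that by (intro member_le_sum) auto
  have U0: "0 \<le> U" by (simp add: U_def sum_nonneg)
  \<comment> \<open>A cube of side \<open>C * r\<close> contains everything within distance \<open>r\<close> of the
    perturbed configuration at its centre.\<close>
  define C where "C = 2 * (1 + \<eta> + U) + 1"
  have C: "0 < C" using \<eta> U0 by (simp add: C_def)
  define \<kappa> where "\<kappa> = measure lborel (ball (0 :: real ^ 'd) (\<eta> / C))"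
  have \<kappa>: "0 < \<kappa>" using \<eta> C by (simp add: \<kappa>_def)
  obtain s0 where s0: "0 < s0" "\<And>s. 0 < s \<Longrightarrow> s < s0 \<Longrightarrow>
    \<exists>G. finite G \<and> measure lborel K / 2 \<le> real (card G) * s ^ ?d \<and>
      (\<forall>z\<in>G. measure lborel (grid_cell s z - K) \<le> \<kappa> / 2 * s ^ ?d)"
    using many_cells_mostly_inside_compact[OF K(1,2), of "\<kappa> / 2"] \<kappa> by auto
  define L where "L = bd * C ^ ?d * B"
  define q where "q = \<delta> * \<kappa> * C ^ ?d * A / (4 * real m)"
  define b where "b = measure lborel K / (2 * C ^ ?d * B) * q ^ m * (exp (- L) / 2)"
  have L: "0 \<le> L" using bd_nonneg C AB by (simp add: L_def)
  have q: "0 < q" using K(3) \<kappa> C AB m by (simp add: q_def)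
  have b: "0 < b" using K(2) C AB q by (simp add: b_def)
  have lim: "(\<lambda>n. (1 + (- L) / real n) ^ n) \<longlonglongrightarrow> exp (- L)"
    by (rule tendsto_exp_limit_sequentially)
  have ev_exp: "\<forall>\<^sub>F n in at_top. exp (- L) / 2 < (1 + (- L) / real n) ^ n"
    by (rule order_tendstoD(1)[OF lim]) simp
  have ev_s0: "\<forall>\<^sub>F n in at_top. C ^ ?d * B / real n < s0 ^ ?d"
    by (rule order_tendstoD(2)[OF tendsto_divide_0[OF tendsto_const filterlim_at_top_imp_at_infinity[OF filterlim_real_sequentially]]])
      (use s0(1) in simp)
  have ev_L: "\<forall>\<^sub>F n in at_top. L / real n < 1"
    by (rule order_tendstoD(2)[OF tendsto_divide_0[OF tendsto_const filterlim_at_top_imp_at_infinity[OF filterlim_real_sequentially]]])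
      simp
  have lower: "\<forall>\<^sub>F n in at_top. b * real n \<le> ?E n"
    using rd ev_exp ev_s0 ev_L eventually_ge_at_top[of "2 * m"] eventually_ge_at_top[of 1]
  proof eventually_elim
    case (elim n)
    have n: "0 < real n" using elim(6) by simp
    have r: "0 < r n" by (rule r_pos[OF elim(6)])
    define s where "s = C * r n"
    have s: "0 < s" using C r by (simp add: s_def)
    have sd: "C ^ ?d * A / real n \<le> s ^ ?d" "s ^ ?d \<le> C ^ ?d * B / real n"
      using elim(1) C mult_left_mono[of "A / real n" "r n ^ ?d" "C ^ ?d"]
        mult_left_mono[of "r n ^ ?d" "B / real n" "C ^ ?d"] by (auto simp: s_def power_mult_distrib)
    have "s ^ ?d < s0 ^ ?d" using sd(2) elim(3) by linarith
    then have "s < s0" by (rule power_less_imp_less_base) (use s0(1) in simp)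
    then obtain G where G: "finite G" "measure lborel K / 2 \<le> real (card G) * s ^ ?d"
      "\<And>z. z \<in> G \<Longrightarrow> measure lborel (grid_cell s z - K) \<le> \<kappa> / 2 * s ^ ?d"
      using s0(2)[OF s] by blast
    have ball: "measure lborel (ball (0 :: real ^ 'd) (\<eta> * r n)) = \<kappa> * s ^ ?d"
      using \<eta> C r by (simp add: content_ball \<kappa>_def s_def power_mult_distrib power_divide)
    define g where "g = \<delta> * (\<kappa> / 2 * s ^ ?d)"
    have g: "0 \<le> g" "g \<le> \<delta> * (measure lborel (ball (0 :: real ^ 'd) (\<eta> * r n)) - \<kappa> / 2 * s ^ ?d)"
      using K(3) \<kappa> s by (auto simp: g_def ball)
    have bds: "bd * s ^ ?d \<le> L / real n"
      using mult_left_mono[OF sd(2) bd_nonneg] by (simp add: L_def mult.assoc)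
    have "r n * (1 + \<eta> + U) < s / 2"
      using r by (simp add: s_def C_def algebra_simps)
    then have E: "real (card G) * (real (n div m) * g) ^ m * (1 - bd * s ^ ?d) ^ n \<le> ?E n"
      using bds elim(4) by (intro expectation_random_betti_ge[OF conf U r _ s Kb less_imp_le[OF K(3)] K(4) G(1) G(3) g]) auto
    have "exp (- L) / 2 \<le> (1 - L / real n) ^ n" using elim(2) by simp
    also have "\<dots> \<le> (1 - bd * s ^ ?d) ^ n" using bds elim(4) by (intro power_mono) auto
    finally have e: "exp (- L) / 2 \<le> (1 - bd * s ^ ?d) ^ n" .
    have "measure lborel K / 2 \<le> real (card G) * (C ^ ?d * B / real n)"
      using G(2) sd(2) by (elim order_trans) (intro mult_left_mono, auto)
    then have cG: "measure lborel K / (2 * C ^ ?d * B) * real n \<le> real (card G)"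
      using n C AB by (simp add: field_simps)
    have "real n / (2 * real m) \<le> real (n div m)"
    proof -
      have "real n = real m * real (n div m) + real (n mod m)"
        by (metis mult_div_mod_eq of_nat_add of_nat_mult)
      moreover have "real (n mod m) \<le> real m" using m by simp
      moreover have "2 * real m \<le> real n" using elim(5) by linarith
      ultimately have "real n \<le> 2 * (real m * real (n div m))" by linarith
      then show ?thesis using m by (simp add: field_simps)
    qed
    moreover have "\<delta> * (\<kappa> / 2 * (C ^ ?d * A / real n)) \<le> g"
      unfolding g_def using K(3) \<kappa> sd(1) by (intro mult_left_mono) auto
    ultimately have "real n / (2 * real m) * (\<delta> * (\<kappa> / 2 * (C ^ ?d * A / real n))) \<le> real (n div m) * g"
      using K(3) \<kappa> C AB by (intro mult_mono) auto
    then have "q \<le> real (n div m) * g" using n m by (simp add: q_def field_simps)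
    then have qm: "q ^ m \<le> (real (n div m) * g) ^ m" using q by (intro power_mono) auto
    have "b * real n = measure lborel K / (2 * C ^ ?d * B) * real n * q ^ m * (exp (- L) / 2)"
      by (simp add: b_def)
    also have "\<dots> \<le> real (card G) * (real (n div m) * g) ^ m * (1 - bd * s ^ ?d) ^ n"
      using cG qm e q g(1) K(2) C AB by (intro mult_mono) auto
    finally show ?case using E by linarith
  qed
  show ?thesis
  proof (rule bigthetaI'[of b "(bd * 3 ^ ?d * B) ^ k + 1"])
    show "0 < (bd * 3 ^ ?d * B) ^ k + 1" using bd_nonneg AB by (intro add_nonneg_pos) auto
    show "\<forall>\<^sub>F n in at_top. b * norm (real n) \<le> norm (?E n) \<and> norm (?E n) \<le> ((bd * 3 ^ ?d * B) ^ k + 1) * norm (real n)"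
      using lower upper
    proof eventually_elim
      case (elim n)
      have "0 \<le> ?E n" by (rule Bochner_Integration.integral_nonneg) simp
      then show ?case using elim by simp
    qed
  qed (rule b)
qed

end

section \<open>Vietoris-Rips and Cech complexes\<close>

lemma geometric_faces_rips: "geometric_faces (rips_face :: real \<Rightarrow> 'v::euclidean_space set \<Rightarrow> bool)"
  by standard (auto simp: rips_face_iff)

lemma geometric_faces_cech: "geometric_faces (cech_face :: real \<Rightarrow> 'v::euclidean_space set \<Rightarrow> bool)"
proof
  fix r and \<sigma> \<tau> :: "'v set"
  show "cech_face r \<tau>" if "cech_face r \<sigma>" "\<tau> \<subseteq> \<sigma>"
    using that unfolding cech_face_def by blast
  fix y y' assume "cech_face r \<sigma>" "y \<in> \<sigma>" "y' \<in> \<sigma>"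
  then have "cball y (r / 2) \<inter> cball y' (r / 2) \<noteq> {}" unfolding cech_face_def by blast
  then show "dist y y' \<le> r" by (simp only: cballs_meet_iff)
qed

lemma rips_face_measurable:
  fixes X :: "'i \<Rightarrow> 'w \<Rightarrow> 'v::euclidean_space"
  assumes I: "finite I" "\<And>i. i \<in> I \<Longrightarrow> X i \<in> borel_measurable M"
  shows "{\<omega> \<in> space M. rips_face r ((\<lambda>i. X i \<omega>) ` I)} \<in> sets M"
proof -
  have "{\<omega> \<in> space M. rips_face r ((\<lambda>i. X i \<omega>) ` I)}
      = {\<omega> \<in> space M. \<forall>i\<in>I. \<forall>j\<in>I. dist (X i \<omega>) (X j \<omega>) \<le> r}"
    by (auto simp: rips_face_iff)
  also have "\<dots> \<in> sets M"
  proof (intro sets.sets_Collect_finite_All I(1))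
    fix i j assume "i \<in> I" "j \<in> I"
    then have [measurable]: "X i \<in> borel_measurable M" "X j \<in> borel_measurable M" using I(2) by auto
    show "{\<omega> \<in> space M. dist (X i \<omega>) (X j \<omega>) \<le> r} \<in> sets M" by measurable
  qed
  finally show ?thesis .
qed

text \<open>
Expresses the existence of a common point of the balls by countably many conditions on the centres.
Compactness turns common points of the slightly enlarged balls into one of the balls themselves.
\<close>

lemma balls_meet_iff_approximately:
  fixes P :: "'v::euclidean_space set"
  assumes D: "\<And>T. open T \<Longrightarrow> T \<noteq> {} \<Longrightarrow> \<exists>y\<in>D. y \<in> T" and P: "P \<noteq> {}"
  shows "(\<Inter>p\<in>P. cball p \<rho>) \<noteq> {} \<longleftrightarrow>
    (\<forall>n::nat. \<exists>y\<in>D. \<forall>p\<in>P. dist p y \<le> \<rho> + inverse (real (Suc n)))"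
proof
  assume "(\<Inter>p\<in>P. cball p \<rho>) \<noteq> {}"
  then obtain c where "c \<in> (\<Inter>p\<in>P. cball p \<rho>)" by blast
  then have c: "dist p c \<le> \<rho>" if "p \<in> P" for p using that by simp
  show "\<forall>n. \<exists>y\<in>D. \<forall>p\<in>P. dist p y \<le> \<rho> + inverse (real (Suc n))"
  proof
    fix n :: nat
    have "ball c (inverse (real (Suc n))) \<noteq> {}" by simp
    then obtain y where y: "y \<in> D" "dist c y < inverse (real (Suc n))"
      using D[OF open_ball] by (metis mem_ball)
    have "dist p y \<le> \<rho> + inverse (real (Suc n))" if "p \<in> P" for p
      using c[OF that] y(2) dist_triangle[of p y c] by linarith
    then show "\<exists>y\<in>D. \<forall>p\<in>P. dist p y \<le> \<rho> + inverse (real (Suc n))" using y(1) by blast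
  qed
next
  assume h: "\<forall>n::nat. \<exists>y\<in>D. \<forall>p\<in>P. dist p y \<le> \<rho> + inverse (real (Suc n))"
  define N where "N = (\<lambda>n::nat. \<Inter>p\<in>P. cball p (\<rho> + inverse (real (Suc n))))"
  have "\<Inter>(range N) \<noteq> {}"
  proof (rule compact_nest)
    show "compact (N n)" for n
      unfolding N_def using P by (intro compact_Inter) auto
    show "N n \<noteq> {}" for n
    proof -
      obtain y where "\<forall>p\<in>P. dist p y \<le> \<rho> + inverse (real (Suc n))" using h by blast
      then have "y \<in> N n" by (simp add: N_def)
      then show ?thesis by blast
    qed
    show "N n \<subseteq> N l" if "l \<le> n" for l n
    proof -
      have "inverse (real (Suc n)) \<le> inverse (real (Suc l))" using that by (intro le_imp_inverse_le) auto
      then have "cball p (\<rho> + inverse (real (Suc n))) \<subseteq> cball p (\<rho> + inverse (real (Suc l)))" for p :: 'v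
        by (intro subset_cball) simp
      then show ?thesis unfolding N_def by blast
    qed
  qed
  then obtain c where c: "c \<in> N n" for n by blast
  have "dist p c \<le> \<rho>" if "p \<in> P" for p
  proof (rule field_le_epsilon)
    fix e :: real assume "0 < e"
    then obtain n where "inverse (real (Suc n)) < e" using reals_Archimedean by blast
    moreover have "dist p c \<le> \<rho> + inverse (real (Suc n))" using c[of n] that by (simp add: N_def)
    ultimately show "dist p c \<le> \<rho> + e" by linarith
  qed
  then have "c \<in> (\<Inter>p\<in>P. cball p \<rho>)" by simp
  then show "(\<Inter>p\<in>P. cball p \<rho>) \<noteq> {}" by blast
qed

lemma cech_face_measurable:
  fixes X :: "'i \<Rightarrow> 'w \<Rightarrow> 'v::euclidean_space"
  assumes I: "finite I" "\<And>i. i \<in> I \<Longrightarrow> X i \<in> borel_measurable M"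
  shows "{\<omega> \<in> space M. cech_face r ((\<lambda>i. X i \<omega>) ` I)} \<in> sets M"
proof (cases "I = {}")
  case True
  then show ?thesis by (simp add: cech_face_def)
next
  case False
  obtain D :: "'v set" where D: "countable D" "\<And>T. open T \<Longrightarrow> T \<noteq> {} \<Longrightarrow> \<exists>y\<in>D. y \<in> T"
    by (rule countable_dense_setE) blast
  have "{\<omega> \<in> space M. cech_face r ((\<lambda>i. X i \<omega>) ` I)}
      = {\<omega> \<in> space M. \<forall>n::nat. \<exists>y\<in>D. \<forall>i\<in>I. dist (X i \<omega>) y \<le> r / 2 + inverse (real (Suc n))}"
    unfolding cech_face_def using balls_meet_iff_approximately[OF D(2), of "(\<lambda>i. X i _) ` I"] False by simp
  also have "\<dots> \<in> sets M"
  proof (intro sets.sets_Collect_countable_All sets.sets_Collect_countable_Ex' sets.sets_Collect_finite_All I(1) D(1))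
    fix n :: nat and y :: 'v and i assume "i \<in> I"
    then have [measurable]: "X i \<in> borel_measurable M" using I(2) by auto
    show "{\<omega> \<in> space M. dist (X i \<omega>) y \<le> r / 2 + inverse (real (Suc n))} \<in> sets M" by measurable
  qed
  finally show ?thesis .
qed

lemma vietoris_rips_eq: "vietoris_rips S r = face_complex rips_face S r"
  by (simp add: vietoris_rips_def face_complex_def rips_face_def)

lemma cech_eq: "cech S r = face_complex cech_face S r"
  by (simp add: cech_def face_complex_def cech_face_def)

theorem theorem4p1:
  fixes F :: "'f::field itself"
    and M :: "'w measure"
    and x :: "nat \<Rightarrow> 'w \<Rightarrow> real ^ 'd"
    and f :: "real ^ 'd \<Rightarrow> real"
    and r :: "nat \<Rightarrow> real"
    and k :: nat
  assumes "prob_space M"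
    and "f \<in> borel_measurable borel" and "\<And>v. 0 \<le> f v" and "bounded (range f)"
    and "prob_space.indep_vars M (\<lambda>_. borel) x {1..}"
    and "\<And>i. 1 \<le> i \<Longrightarrow> distributed M lborel (x i) (\<lambda>v. ennreal (f v))"
    and "\<And>n. 1 \<le> n \<Longrightarrow> 0 < r n"
    and "r \<in> \<Theta>(\<lambda>n. real n powr (- 1 / real CARD('d)))"
    and "1 \<le> k"
    and "2 \<le> CARD('d)"
  shows "(\<lambda>n. prob_space.expectation M
           (\<lambda>\<omega>. real (betti F (vietoris_rips ((\<lambda>i. x i \<omega>) ` {1..n}) (r n)) k))) \<in> \<Theta>(\<lambda>n. real n) \<and>
         (k < CARD('d) \<longrightarrow>
          (\<lambda>n. prob_space.expectation M
           (\<lambda>\<omega>. real (betti F (cech ((\<lambda>i. x i \<omega>) ` {1..n}) (r n)) k))) \<in> \<Theta>(\<lambda>n. real n))"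
proof -
  obtain bd where bd: "\<And>v. f v \<le> bd"
    using assms(4) by (auto simp: bounded_iff abs_le_iff)
  interpret random_points M x f bd
    using assms bd by (simp add: random_points_def random_points_axioms_def)
  interpret rips: random_geometric_complex M x f bd rips_face
    by (intro random_geometric_complex.intro random_geometric_complex_axioms.intro random_points_axioms
        geometric_faces_rips rips_face_measurable point_borel) auto
  interpret cech: random_geometric_complex M x f bd cech_face
    by (intro random_geometric_complex.intro random_geometric_complex_axioms.intro random_points_axioms
        geometric_faces_cech cech_face_measurable point_borel) auto
  obtain m u \<eta> a js where rips:
    "spherical_configuration (rips_face :: real \<Rightarrow> (real ^ 'd) set \<Rightarrow> bool) k m u \<eta> (a :: nat \<Rightarrow> nat \<Rightarrow> 'f) js"
    using rips_spherical_configuration[OF assms(10)] by blast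
  show ?thesis
  proof (intro conjI impI)
    show "(\<lambda>n. expectation (\<lambda>\<omega>. real (betti F (vietoris_rips ((\<lambda>i. x i \<omega>) ` {1..n}) (r n)) k))) \<in> \<Theta>(\<lambda>n. real n)"
      unfolding vietoris_rips_eq by (rule rips.expected_betti_bigtheta[OF rips assms(7,8)])
    assume "k < CARD('d)"
    then obtain m u \<eta> a js where
      "spherical_configuration (cech_face :: real \<Rightarrow> (real ^ 'd) set \<Rightarrow> bool) k m u \<eta> (a :: nat \<Rightarrow> nat \<Rightarrow> 'f) js"
      using cech_spherical_configuration by blast
    from cech.expected_betti_bigtheta[OF this assms(7,8)]
    show "(\<lambda>n. expectation (\<lambda>\<omega>. real (betti F (cech ((\<lambda>i. x i \<omega>) ` {1..n}) (r n)) k))) \<in> \<Theta>(\<lambda>n. real n)"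
      unfolding cech_eq .
  qed
qed

end
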